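(* Let $W \subset \mathbb{R}^2$ be the Warsaw Circle. Then its Milnor-Thurston homology groups satisfy $\mathcal{H}_n(W) = 0$ for every $n > 0$.
   Context: The Warsaw Circle $W \subset \mathbb{R}^2$ is the union of: the portion of the topologist's sine curve $\{(x,y) : y = \sin(1/x),\ x>0\}$ between the line $x=0$ and its rightmost minimum; the segment $\{(0,y) : -1 \leq y \leq 1\}$; and an arc (disjoint from the rest except at endpoints) joining $(0,-1)$ to that rightmost minimum. Milnor-Thurston (measure) homology: for a topological space $X$ and integer $k \geq 0$, let $C^0(\Delta^k, X)$ be the space of continuous maps from the standard $k$-simplex $\Delta^k$ to $X$, with the compact-open topology. $\mathcal{C}_k(X)$ is the real vector space of finite signed Borel measures on $C^0(\Delta^k,X)$ admitting a compact carrier (a set whose complement contains only Borel sets of measure zero). The boundary $\partial : \mathcal{C}_k(X) \to \mathcal{C}_{k-1}(X)$ is $\partial = \sum_{i=0}^k (-1)^i \partial_i$, where $\partial_i \mu$ is the image measure $A \mapsto \mu(\{\sigma : \sigma\circ\delta_i \in A\})$, with $\delta_i : \Delta^{k-1} \to \Delta^k$ the standard inclusion of the $i$-th face. The homology $\mathcal{H}_*(X)$ of this chain complex is the Milnor-Thurston homology of $X$. *)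

theory Defs
  imports "HOL-Analysis.Analysis" "HOL-Homology.Homology"
begin

text \<open>Singular k-simplices in X are represented as in HOL-Homology (singular_simplex):
continuous maps from the standard simplex, extensional outside it. The space
C^0(Delta^k, X) carries the compact-open topology.\<close>

definition compact_open_top :: "nat \<Rightarrow> 'a topology \<Rightarrow> ((nat \<Rightarrow> real) \<Rightarrow> 'a) topology" where
  "compact_open_top k X =
     subtopology
       (topology_generated_by
          {{\<sigma> \<in> singular_simplex_set k X. \<sigma> ` K \<subseteq> U} | K U.
              compactin (subtopology (powertop_real UNIV) (standard_simplex k)) K \<and> openin X U})
       (singular_simplex_set k X)"

definition MT_borel :: "nat \<Rightarrow> 'a topology \<Rightarrow> ((nat \<Rightarrow> real) \<Rightarrow> 'a) set set" where
  "MT_borel k X = sigma_sets (singular_simplex_set k X) {U. openin (compact_open_top k X) U}"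

text \<open>Finite signed Borel measures (real-valued, countably additive set functions on the
Borel sets; values on non-Borel sets are irrelevant) admitting a compact carrier.\<close>
definition MT_chains :: "nat \<Rightarrow> 'a topology \<Rightarrow> (((nat \<Rightarrow> real) \<Rightarrow> 'a) set \<Rightarrow> real) set" where
  "MT_chains k X =
     {\<mu>. \<mu> {} = 0
        \<and> (\<forall>A :: nat \<Rightarrow> ((nat \<Rightarrow> real) \<Rightarrow> 'a) set.
              range A \<subseteq> MT_borel k X \<and> disjoint_family A \<longrightarrow> (\<lambda>n. \<mu> (A n)) sums \<mu> (\<Union>n. A n))
        \<and> (\<exists>K. compactin (compact_open_top k X) K \<and>
              (\<forall>A \<in> MT_borel k X. A \<subseteq> singular_simplex_set k X - K \<longrightarrow> \<mu> A = 0))}"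

definition MT_boundary :: "nat \<Rightarrow> 'a topology \<Rightarrow> (((nat \<Rightarrow> real) \<Rightarrow> 'a) set \<Rightarrow> real)
                            \<Rightarrow> (((nat \<Rightarrow> real) \<Rightarrow> 'a) set \<Rightarrow> real)" where
  "MT_boundary k X \<mu> =
     (\<lambda>A. \<Sum>i\<le>k. (-1) ^ i * \<mu> {\<sigma> \<in> singular_simplex_set k X. singular_face k i \<sigma> \<in> A})"

definition MT_homology_trivial :: "nat \<Rightarrow> 'a topology \<Rightarrow> bool" where
  "MT_homology_trivial n X \<longleftrightarrow>
     (\<forall>\<mu> \<in> MT_chains n X.
        (\<forall>A \<in> MT_borel (n - 1) X. MT_boundary n X \<mu> A = 0) \<longrightarrow>
        (\<exists>\<nu> \<in> MT_chains (Suc n) X. \<forall>A \<in> MT_borel n X. MT_boundary (Suc n) X \<nu> A = \<mu> A))"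

definition sine_part :: "(real \<times> real) set" where
  "sine_part = {(x, sin (1 / x)) | x. 0 < x \<and> x \<le> 2 / (3 * pi)}"

definition limit_segment :: "(real \<times> real) set" where
  "limit_segment = {(0, y) | y. -1 \<le> y \<and> y \<le> 1}"

definition warsaw_circle :: "(real \<Rightarrow> real \<times> real) \<Rightarrow> (real \<times> real) set" where
  "warsaw_circle \<gamma> = sine_part \<union> limit_segment \<union> path_image \<gamma>"

end

theory Submission
  imports Defs
begin

text \<open>The Warsaw circle is the image of an injective path on \<open>[0, \<infinity>)\<close>: down the limit segment, along
  the arc, then along the sine curve towards the segment. Since a small connected subset meets at
  most one hump of the sine curve, every singular simplex lifts to the half-line, and an
  equicontinuous family of simplices, such as a compact carrier, has equicontinuous lifts. The lifts
  need not be uniformly bounded, but their diameters are bounded by some \<open>M\<close>.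

  The half-line is contractible, but coning to a fixed point does not preserve compact carriers.
  Instead a simplex is coned to the point \<open>c M\<close>, where the level \<open>c\<close> is determined by its lowest
  vertex. The faces of level \<open>c + 1\<close> obstruct this operator from being a contraction; joining them to
  the edge from \<open>c M\<close> to \<open>(c + 1) M\<close> repairs it, except in degree one, where multiples of
  these edges remain. Their total mass vanishes for a cycle, because a ray carries no
  1-cycles of finite mass.\<close>

subsection \<open>Equicontinuity and the compact-open topology\<close>

text \<open>A set of simplices in a compact metric space lies in a compact set exactly when it is
  equicontinuous (Ascoli), so an operator on chains preserves compact carriers if it preserves
  equicontinuity. A cone over an equicontinuous family stays equicontinuous as soon as the apex is
  within a bounded distance of the base; a simplex far out on the half-line therefore needs an apex
  far out. The spacing of the apexes is the diameter bound \<open>M\<close>: with it the vertices of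
  a simplex have at most two consecutive levels, so a face has level c or c + 1, and a face of level
  c + 1 has all its vertices on that level. Passing to the lift is not continuous, so the cone
  operators are only Borel, which suffices for image measures. The chain identities are proved for
  simplices of diameter at most \<open>M\<close>, hence on the carrier; they reach the measure as
  identities between simple functions, with an integral built from finite additivity alone, so that
  signed measures need not be decomposed into positive ones.\<close>

definition coord_near :: "real \<Rightarrow> (nat \<Rightarrow> real) \<Rightarrow> (nat \<Rightarrow> real) \<Rightarrow> bool" where
  "coord_near d s t \<longleftrightarrow> (\<forall>i. \<bar>s i - t i\<bar> < d)"

text \<open>Uniform equicontinuity, measured in coordinates because faces and cones have explicit
  coordinate estimates. On singletons it encodes continuity, the simplex being compact.\<close>

definition equicont :: "nat \<Rightarrow> ((nat \<Rightarrow> real) \<Rightarrow> 'a::metric_space) set \<Rightarrow> bool" where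
  "equicont n F \<longleftrightarrow>
     (\<forall>e>0. \<exists>d>0. \<forall>f\<in>F. \<forall>s\<in>standard_simplex n. \<forall>t\<in>standard_simplex n.
        coord_near d s t \<longrightarrow> dist (f s) (f t) < e)"

lemma equicontD:
  assumes "equicont n F" "e > 0"
  obtains d where "d > 0"
    "\<And>f s t. f \<in> F \<Longrightarrow> s \<in> standard_simplex n \<Longrightarrow> t \<in> standard_simplex n \<Longrightarrow>
       coord_near d s t \<Longrightarrow> dist (f s) (f t) < e"
proof -
  have "\<exists>d>0. \<forall>f\<in>F. \<forall>s\<in>standard_simplex n. \<forall>t\<in>standard_simplex n.
        coord_near d s t \<longrightarrow> dist (f s) (f t) < e"
    using assms unfolding equicont_def by simp
  then show ?thesis using that by auto
qed

lemma equicont_singletonD: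
  assumes "equicont n {f}" "e > 0"
  obtains d where "d > 0"
    "\<And>s t. s \<in> standard_simplex n \<Longrightarrow> t \<in> standard_simplex n \<Longrightarrow> coord_near d s t \<Longrightarrow> dist (f s) (f t) < e"
  by (rule equicontD[OF assms]) simp

lemma equicont_subset:
  assumes "equicont n F" "G \<subseteq> F"
  shows "equicont n G"
  unfolding equicont_def
proof (intro allI impI)
  fix e :: real assume "e > 0"
  with assms(1) have "\<exists>d>0. \<forall>f\<in>F. \<forall>s\<in>standard_simplex n. \<forall>t\<in>standard_simplex n.
        coord_near d s t \<longrightarrow> dist (f s) (f t) < e"
    unfolding equicont_def by simp
  then show "\<exists>d>0. \<forall>f\<in>G. \<forall>s\<in>standard_simplex n. \<forall>t\<in>standard_simplex n.
        coord_near d s t \<longrightarrow> dist (f s) (f t) < e"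
    using assms(2) by (meson subsetD)
qed

text \<open>Only the values on the simplex matter, so the extensional encoding of singular simplices
  does not disturb equicontinuity.\<close>

lemma equicont_cong:
  assumes "equicont n F"
    and "\<And>g. g \<in> G \<Longrightarrow> \<exists>f\<in>F. \<forall>t\<in>standard_simplex n. g t = f t"
  shows "equicont n G"
  unfolding equicont_def
proof (intro allI impI)
  fix e :: real assume "e > 0"
  then obtain d where d: "d > 0"
    "\<And>f s t. f \<in> F \<Longrightarrow> s \<in> standard_simplex n \<Longrightarrow> t \<in> standard_simplex n \<Longrightarrow>
       coord_near d s t \<Longrightarrow> dist (f s) (f t) < e"
    using equicontD[OF assms(1)] by blast
  show "\<exists>d>0. \<forall>f\<in>G. \<forall>s\<in>standard_simplex n. \<forall>t\<in>standard_simplex n.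
          coord_near d s t \<longrightarrow> dist (f s) (f t) < e"
  proof (intro exI[of _ d] conjI ballI impI)
    fix g s t assume "g \<in> G" and st: "s \<in> standard_simplex n" "t \<in> standard_simplex n" "coord_near d s t"
    then obtain f where "f \<in> F" "\<forall>t\<in>standard_simplex n. g t = f t" using assms(2) by blast
    then show "dist (g s) (g t) < e" using d(2) st by metis
  qed (use d in auto)
qed

lemma coord_near_mono: "coord_near d s t \<Longrightarrow> d \<le> d' \<Longrightarrow> coord_near d' s t"
  unfolding coord_near_def by (meson less_le_trans)

lemma equicont_Un:
  assumes "equicont n F" "equicont n G"
  shows "equicont n (F \<union> G)"
  unfolding equicont_def
proof (intro allI impI)
  fix e :: real assume e: "e > 0"
  obtain d where d: "d > 0"
    "\<And>f s t. f \<in> F \<Longrightarrow> s \<in> standard_simplex n \<Longrightarrow> t \<in> standard_simplex n \<Longrightarrow>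
       coord_near d s t \<Longrightarrow> dist (f s) (f t) < e"
    using equicontD[OF assms(1) e] by blast
  obtain d' where d': "d' > 0"
    "\<And>f s t. f \<in> G \<Longrightarrow> s \<in> standard_simplex n \<Longrightarrow> t \<in> standard_simplex n \<Longrightarrow>
       coord_near d' s t \<Longrightarrow> dist (f s) (f t) < e"
    using equicontD[OF assms(2) e] by blast
  have "dist (f s) (f t) < e"
    if "f \<in> F \<union> G" "s \<in> standard_simplex n" "t \<in> standard_simplex n" "coord_near (min d d') s t" for f s t
    using that d(2)[of f s t] d'(2)[of f s t] coord_near_mono[OF that(4)] by auto
  then show "\<exists>d>0. \<forall>f\<in>F \<union> G. \<forall>s\<in>standard_simplex n. \<forall>t\<in>standard_simplex n.
          coord_near d s t \<longrightarrow> dist (f s) (f t) < e"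
    using d(1) d'(1) by (intro exI[of _ "min d d'"]) simp
qed

lemma equicont_uniformly_continuous:
  assumes F: "equicont n F" and q: "uniformly_continuous_on S q"
    and FS: "\<And>f t. f \<in> F \<Longrightarrow> t \<in> standard_simplex n \<Longrightarrow> f t \<in> S"
  shows "equicont n ((\<lambda>f. q \<circ> f) ` F)"
  unfolding equicont_def
proof (intro allI impI)
  fix e :: real assume "e > 0"
  with q obtain e' where e': "e' > 0" "\<And>x y. x \<in> S \<Longrightarrow> y \<in> S \<Longrightarrow> dist x y < e' \<Longrightarrow> dist (q x) (q y) < e"
    unfolding uniformly_continuous_on_def by (metis dist_commute)
  obtain d where d: "d > 0"
    "\<And>f s t. f \<in> F \<Longrightarrow> s \<in> standard_simplex n \<Longrightarrow> t \<in> standard_simplex n \<Longrightarrow>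
       coord_near d s t \<Longrightarrow> dist (f s) (f t) < e'"
    using equicontD[OF F e'(1)] by blast
  show "\<exists>d>0. \<forall>f\<in>(\<lambda>f. q \<circ> f) ` F. \<forall>s\<in>standard_simplex n. \<forall>t\<in>standard_simplex n.
          coord_near d s t \<longrightarrow> dist (f s) (f t) < e"
    using d e'(2) FS by (auto intro!: exI[of _ d])
qed

lemma simplical_face_coord_near:
  "d > 0 \<Longrightarrow> coord_near d s t \<Longrightarrow> coord_near d (simplical_face k s) (simplical_face k t)"
  by (auto simp: coord_near_def simplical_face_def)

lemma equicont_singular_face:
  assumes F: "equicont (Suc n) F" and "k \<le> Suc n"
  shows "equicont n (singular_face (Suc n) k ` F)"
  unfolding equicont_def
proof (intro allI impI)
  fix e :: real assume "e > 0"
  then obtain d where d: "d > 0"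
    "\<And>f s t. f \<in> F \<Longrightarrow> s \<in> standard_simplex (Suc n) \<Longrightarrow> t \<in> standard_simplex (Suc n) \<Longrightarrow>
       coord_near d s t \<Longrightarrow> dist (f s) (f t) < e"
    using equicontD[OF F] by blast
  show "\<exists>d>0. \<forall>f\<in>singular_face (Suc n) k ` F. \<forall>s\<in>standard_simplex n. \<forall>t\<in>standard_simplex n.
          coord_near d s t \<longrightarrow> dist (f s) (f t) < e"
    using d assms(2) simplical_face_in_standard_simplex[of "Suc n" k] simplical_face_coord_near[OF d(1)]
    by (auto intro!: exI[of _ d] simp: singular_face_def)
qed

lemma compact_standard_simplex: "compact (standard_simplex n)"
  using compactin_standard_simplex[of n] by (simp add: euclidean_product_topology)

text \<open>The distance of functions is a sum of truncated coordinate distances with weights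
  \<open>(1/2)^n\<close>, and these weights add up to 2.\<close>

lemma coord_near_imp_dist_le:
  assumes "coord_near d s t"
  shows "dist s t \<le> 2 * d"
proof -
  have d0: "d \<ge> 0" using assms unfolding coord_near_def by (metis abs_ge_zero less_eq_real_def order_le_less_trans)
  have sm: "summable (\<lambda>n. (1/2::real)^n * d)" by (intro summable_mult2 summable_geometric) auto
  have le: "(1/2)^n * min (dist (s (from_nat n)) (t (from_nat n))) 1 \<le> (1/2)^n * d" for n
    using assms by (intro mult_left_mono) (auto simp: coord_near_def dist_real_def intro: min.coboundedI1 less_imp_le)
  have "dist s t \<le> suminf (\<lambda>n. (1/2)^n * d)"
    unfolding dist_fun_def
    by (rule suminf_le[OF le _ sm], rule summable_comparison_test'[OF sm, of 0])
       (use le in auto)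
  also have "\<dots> = 2 * d"
    by (subst suminf_mult2[symmetric]) (auto simp: suminf_geometric intro: summable_geometric)
  finally show ?thesis .
qed

lemma open_coord_box: "open {s :: nat \<Rightarrow> real. \<forall>i\<le>n. \<bar>s i - b i\<bar> < d}"
proof -
  have "open (\<Inter>i\<in>{..n}. {s :: nat \<Rightarrow> real. \<bar>s i - b i\<bar> < d})"
    by (intro open_INT ballI open_Collect_less continuous_intros) auto
  also have "(\<Inter>i\<in>{..n}. {s :: nat \<Rightarrow> real. \<bar>s i - b i\<bar> < d}) = {s. \<forall>i\<le>n. \<bar>s i - b i\<bar> < d}" by auto
  finally show ?thesis .
qed

lemma closed_coord_box: "closed {s :: nat \<Rightarrow> real. \<forall>i\<le>n. \<bar>s i - b i\<bar> \<le> d}"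
proof -
  have "closed (\<Inter>i\<in>{..n}. {s :: nat \<Rightarrow> real. \<bar>s i - b i\<bar> \<le> d})"
    by (intro closed_INT ballI closed_Collect_le continuous_intros) auto
  also have "(\<Inter>i\<in>{..n}. {s :: nat \<Rightarrow> real. \<bar>s i - b i\<bar> \<le> d}) = {s. \<forall>i\<le>n. \<bar>s i - b i\<bar> \<le> d}" by auto
  finally show ?thesis .
qed

text \<open>Coordinates beyond \<open>n\<close> vanish on the simplex, so nearness is a condition on
  finitely many coordinates and defines an open box of the product topology.\<close>

lemma coord_near_standard_simplex:
  assumes "s \<in> standard_simplex n" "t \<in> standard_simplex n" "d > 0"
  shows "coord_near d s t \<longleftrightarrow> (\<forall>i\<le>n. \<bar>s i - t i\<bar> < d)"
  using assms unfolding coord_near_def standard_simplex_def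
  by (auto, metis diff_self abs_zero linorder_not_less)

lemma singular_simplex_top_of_set:
  fixes W :: "'a::metric_space set"
  shows "singular_simplex n (top_of_set W) f \<longleftrightarrow>
    f \<in> extensional (standard_simplex n) \<and> f ` standard_simplex n \<subseteq> W \<and> equicont n {f}"
proof -
  have "continuous_on (standard_simplex n) f \<longleftrightarrow> equicont n {f}"
  proof
    assume "continuous_on (standard_simplex n) f"
    then have uc: "uniformly_continuous_on (standard_simplex n) f"
      by (rule compact_uniformly_continuous[OF _ compact_standard_simplex])
    show "equicont n {f}"
      unfolding equicont_def
    proof (intro allI impI)
      fix e :: real assume "e > 0"
      with uc obtain d where d: "d > 0"
        "\<And>s t. s \<in> standard_simplex n \<Longrightarrow> t \<in> standard_simplex n \<Longrightarrow> dist s t < d \<Longrightarrow> dist (f s) (f t) < e"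
        unfolding uniformly_continuous_on_def by (metis dist_commute)
      \<comment> \<open>Nearness up to \<open>d/3\<close> only bounds the distance by
        \<open>2 * d/3\<close>, still below \<open>d\<close>.\<close>
      have "dist s t < d" if "coord_near (d/3) s t" for s t
        using coord_near_imp_dist_le[OF that] d(1) by simp
      then show "\<exists>d>0. \<forall>f\<in>{f}. \<forall>s\<in>standard_simplex n. \<forall>t\<in>standard_simplex n.
          coord_near d s t \<longrightarrow> dist (f s) (f t) < e"
        using d by (intro exI[of _ "d/3"]) auto
    qed
  next
    assume eq: "equicont n {f}"
    show "continuous_on (standard_simplex n) f"
      unfolding continuous_on_topological
    proof (intro ballI allI impI)
      fix s B assume s: "s \<in> standard_simplex n" and B: "open B" "f s \<in> B"
      then obtain e where e: "e > 0" "ball (f s) e \<subseteq> B" using open_contains_ball by blast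
      obtain d where d: "d > 0"
        "\<And>t u. t \<in> standard_simplex n \<Longrightarrow> u \<in> standard_simplex n \<Longrightarrow>
           coord_near d t u \<Longrightarrow> dist (f t) (f u) < e"
        by (rule equicont_singletonD[OF eq e(1)]) (rule that)
      let ?A = "{t :: nat \<Rightarrow> real. \<forall>i\<le>n. \<bar>t i - s i\<bar> < d}"
      have "f t \<in> B" if "t \<in> standard_simplex n" "t \<in> ?A" for t
      proof -
        have "dist (f t) (f s) < e"
          using that s d coord_near_standard_simplex[OF that(1) s d(1)] by auto
        then show ?thesis using e(2) by (auto simp: dist_commute)
      qed
      then show "\<exists>A. open A \<and> s \<in> A \<and> (\<forall>t\<in>standard_simplex n. t \<in> A \<longrightarrow> f t \<in> B)"
        using open_coord_box[of n s d] d(1) by (intro exI[of _ ?A]) auto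
    qed
  qed
  then show ?thesis
    unfolding singular_simplex_def
    by (auto simp: euclidean_product_topology continuous_map_in_subtopology)
qed

text \<open>Total boundedness of the simplex. The net consists of points of the simplex, so that
  simplices can be evaluated on it.\<close>

lemma coord_net:
  assumes "d > 0"
  obtains N where "finite N" "N \<subseteq> standard_simplex n"
    "\<And>s. s \<in> standard_simplex n \<Longrightarrow> \<exists>b\<in>N. coord_near d s b"
proof -
  let ?U = "\<lambda>b. {s :: nat \<Rightarrow> real. \<forall>i\<le>n. \<bar>s i - b i\<bar> < d}"
  have "standard_simplex n \<subseteq> (\<Union>b\<in>standard_simplex n. ?U b)"
    using assms by fastforce
  then obtain N where N: "N \<subseteq> standard_simplex n" "finite N" "standard_simplex n \<subseteq> (\<Union>b\<in>N. ?U b)"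
    by (rule compactE_image[OF compact_standard_simplex, of _ ?U, rotated]) (erule (2) that, rule open_coord_box)
  show ?thesis
  proof (rule that[OF N(2,1)])
    fix s assume s: "s \<in> standard_simplex n"
    then obtain b where b: "b \<in> N" "\<forall>i\<le>n. \<bar>s i - b i\<bar> < d" using N(3) by blast
    then have "coord_near d s b"
      using coord_near_standard_simplex[OF s _ assms, of b] N(1) by auto
    then show "\<exists>b\<in>N. coord_near d s b" using b(1) by blast
  qed
qed

section \<open>Uniform convergence and Ascoli's theorem\<close>

definition sup_near :: "nat \<Rightarrow> real \<Rightarrow> ((nat \<Rightarrow> real) \<Rightarrow> 'a::metric_space) \<Rightarrow> ((nat \<Rightarrow> real) \<Rightarrow> 'a) \<Rightarrow> bool" where
  "sup_near n e f g \<longleftrightarrow> (\<forall>t\<in>standard_simplex n. dist (f t) (g t) < e)"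

lemma topspace_compact_open [simp]:
  "topspace (compact_open_top n X) = singular_simplex_set n X"
proof -
  have "singular_simplex_set n X = {\<sigma> \<in> singular_simplex_set n X. \<sigma> ` {} \<subseteq> {}}" by auto
  then have "singular_simplex_set n X \<in> {{\<sigma> \<in> singular_simplex_set n X. \<sigma> ` K \<subseteq> U} | K U.
              compactin (subtopology (powertop_real UNIV) (standard_simplex n)) K \<and> openin X U}"
    using compactin_empty openin_empty by blast
  then show ?thesis unfolding compact_open_top_def topspace_subtopology topology_generated_by_topspace
    by blast
qed

text \<open>The domain is compact, so the compact-open topology is the topology of uniform
  convergence.\<close>

lemma openin_compact_open_iff:
  fixes W :: "'a::metric_space set" and n :: nat
  defines "S \<equiv> singular_simplex_set n (top_of_set W)"
  shows "openin (compact_open_top n (top_of_set W)) U \<longleftrightarrow>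
    U \<subseteq> S \<and> (\<forall>\<sigma>\<in>U. \<exists>e>0. \<forall>\<tau>\<in>S. sup_near n e \<tau> \<sigma> \<longrightarrow> \<tau> \<in> U)"
proof -
  define B where "B = {{\<sigma> \<in> S. \<sigma> ` K \<subseteq> U} | K U.
      compactin (subtopology (powertop_real UNIV) (standard_simplex n)) K \<and> openin (top_of_set W) U}"
  have co: "compact_open_top n (top_of_set W) = subtopology (topology_generated_by B) S"
    unfolding compact_open_top_def B_def S_def ..
  \<comment> \<open>Subbasic sets are uniformly open: the image of \<open>K\<close> under
    \<open>\<sigma>\<close> is compact, so balls of one fixed radius around its points stay inside
    the open set.\<close>
  have basic: "\<exists>e>0. \<forall>\<tau>\<in>S. sup_near n e \<tau> \<sigma> \<longrightarrow> \<tau> \<in> T"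
    if T: "generate_topology_on B T" and "\<sigma> \<in> T" "\<sigma> \<in> S" for T \<sigma>
    using that
  proof (induction arbitrary: \<sigma> rule: generate_topology_on.induct)
    case Empty
    then show ?case by simp
  next
    case (Int a b)
    obtain e where e: "e > 0" "\<forall>\<tau>\<in>S. sup_near n e \<tau> \<sigma> \<longrightarrow> \<tau> \<in> a" using Int by blast
    obtain e' where e': "e' > 0" "\<forall>\<tau>\<in>S. sup_near n e' \<tau> \<sigma> \<longrightarrow> \<tau> \<in> b" using Int by blast
    show ?case
      using e e' by (intro exI[of _ "min e e'"]) (auto simp: sup_near_def)
  next
    case (UN K)
    then show ?case by (meson UnionE UnionI)
  next
    case (Basis s)
    then obtain K U where K: "compactin (subtopology (powertop_real UNIV) (standard_simplex n)) K"
      and U: "openin (top_of_set W) U" and s: "s = {\<sigma> \<in> S. \<sigma> ` K \<subseteq> U}"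
      unfolding B_def by blast
    have KS: "K \<subseteq> standard_simplex n" using K by (simp add: compactin_subtopology)
    obtain V where V: "open V" "U = W \<inter> V" using U by (metis openin_open)
    have "compactin (top_of_set W) (\<sigma> ` K)"
      using Basis.prems(2) K image_compactin unfolding S_def singular_simplex_def by blast
    then have "compact (\<sigma> ` K)" by (simp add: compactin_subtopology)
    moreover have "\<sigma> ` K \<subseteq> V" using Basis.prems(1) s V by auto
    ultimately obtain e where e: "e > 0" "(\<Union>x\<in>\<sigma> ` K. ball x e) \<subseteq> V"
      using compact_subset_open_imp_ball_epsilon_subset[OF _ V(1)] by metis
    have "\<tau> \<in> s" if "\<tau> \<in> S" "sup_near n e \<tau> \<sigma>" for \<tau>
    proof -
      have "\<tau> x \<in> U" if "x \<in> K" for x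
      proof -
        have "\<tau> x \<in> W" using \<open>\<tau> \<in> S\<close> that KS unfolding S_def singular_simplex_top_of_set by auto
        moreover have "\<tau> x \<in> V"
          using e(2) \<open>sup_near n e \<tau> \<sigma>\<close> that KS unfolding sup_near_def by (force simp: dist_commute)
        ultimately show ?thesis using V by simp
      qed
      then show ?thesis using s that by auto
    qed
    then show ?case using e(1) by blast
  qed
  \<comment> \<open>Conversely, a uniform ball contains a finite intersection of subbasic sets. On
    the compact cell \<open>K b\<close> around a net point \<open>b\<close>, \<open>\<sigma>\<close>
    varies by less than \<open>e/2\<close>; confining the image of each cell to the ball of radius
    \<open>e/2\<close> around \<open>\<sigma> b\<close> keeps \<open>\<tau>\<close> within
    \<open>e\<close> of \<open>\<sigma>\<close>.\<close>
  have nbhd: "\<exists>V. openin (compact_open_top n (top_of_set W)) V \<and> \<sigma> \<in> V \<and> (\<forall>\<tau>\<in>V. sup_near n e \<tau> \<sigma>)"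
    if \<sigma>: "\<sigma> \<in> S" and e: "e > 0" for \<sigma> and e :: real
  proof -
    have "equicont n {\<sigma>}" using \<sigma> unfolding S_def singular_simplex_top_of_set by simp
    then obtain d where d: "d > 0"
      "\<And>s t. s \<in> standard_simplex n \<Longrightarrow> t \<in> standard_simplex n \<Longrightarrow> coord_near d s t \<Longrightarrow> dist (\<sigma> s) (\<sigma> t) < e/2"
      by (rule equicont_singletonD[of n \<sigma> "e/2"]) (use e in \<open>auto intro: that\<close>)
    obtain N where N: "finite N" "N \<subseteq> standard_simplex n"
      "\<And>s. s \<in> standard_simplex n \<Longrightarrow> \<exists>b\<in>N. coord_near (d/2) s b"
      using coord_net[of "d/2" n] d(1) by auto
    define K where "K b = standard_simplex n \<inter> {s. \<forall>i\<le>n. \<bar>s i - b i\<bar> \<le> d/2}" for b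
    define V where "V = (\<Inter>b\<in>N. {\<tau> \<in> S. \<tau> ` K b \<subseteq> W \<inter> ball (\<sigma> b) (e/2)}) \<inter> S"
    have Kc: "compactin (subtopology (powertop_real UNIV) (standard_simplex n)) (K b)" for b
    proof -
      have "compact (K b)"
        unfolding K_def by (intro compact_Int_closed compact_standard_simplex closed_coord_box)
      moreover have "K b \<subseteq> standard_simplex n" unfolding K_def by blast
      ultimately show ?thesis by (simp add: compactin_subtopology euclidean_product_topology)
    qed
    have "openin (topology_generated_by B) {\<tau> \<in> S. \<tau> ` K b \<subseteq> W \<inter> ball (\<sigma> b) (e/2)}" for b
    proof (rule topology_generated_by_Basis)
      show "{\<tau> \<in> S. \<tau> ` K b \<subseteq> W \<inter> ball (\<sigma> b) (e/2)} \<in> B"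
        using Kc openin_open_Int[OF open_ball] unfolding B_def by blast
    qed
    then have "openin (compact_open_top n (top_of_set W)) {\<tau> \<in> S. \<tau> ` K b \<subseteq> W \<inter> ball (\<sigma> b) (e/2)}" for b
      unfolding co openin_subtopology by blast
    moreover have "N \<noteq> {}" using N(3) nonempty_standard_simplex by blast
    moreover have "V = (\<Inter>b\<in>N. {\<tau> \<in> S. \<tau> ` K b \<subseteq> W \<inter> ball (\<sigma> b) (e/2)})"
      using \<open>N \<noteq> {}\<close> unfolding V_def by auto
    ultimately have "openin (compact_open_top n (top_of_set W)) V"
      using N(1) by (auto intro!: openin_Inter)
    moreover have "\<sigma> \<in> V"
    proof -
      have "\<sigma> s \<in> W \<inter> ball (\<sigma> b) (e/2)" if "b \<in> N" "s \<in> K b" for b s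
      proof -
        have s: "s \<in> standard_simplex n" and b: "b \<in> standard_simplex n" using that N(2) unfolding K_def by auto
        moreover have "coord_near d s b"
          unfolding coord_near_standard_simplex[OF s b d(1)]
          using that d(1) unfolding K_def by force
        ultimately have "dist (\<sigma> s) (\<sigma> b) < e/2" by (rule d(2))
        moreover have "\<sigma> s \<in> W" using \<sigma> s unfolding S_def singular_simplex_top_of_set by auto
        ultimately show ?thesis by (simp add: dist_commute)
      qed
      then show ?thesis unfolding V_def using \<sigma> by auto
    qed
    moreover have "sup_near n e \<tau> \<sigma>" if "\<tau> \<in> V" for \<tau>
      unfolding sup_near_def
    proof
      fix s assume s: "s \<in> standard_simplex n"
      then obtain b where b: "b \<in> N" "coord_near (d/2) s b" using N(3) by blast
      then have sK: "s \<in> K b" unfolding K_def using s by (auto simp: coord_near_def less_imp_le)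
      have "b \<in> standard_simplex n" using b N(2) by auto
      moreover have "coord_near d s b" using b(2) coord_near_mono d(1) by fastforce
      ultimately have "dist (\<sigma> s) (\<sigma> b) < e/2" using d(2) s by blast
      moreover have "\<tau> s \<in> ball (\<sigma> b) (e/2)" using that sK b(1) unfolding V_def by blast
      then have "dist (\<sigma> b) (\<tau> s) < e/2" by simp
      ultimately show "dist (\<tau> s) (\<sigma> s) < e" by (smt (verit) dist_commute dist_triangle field_sum_of_halves)
    qed
    ultimately show ?thesis by blast
  qed
  show ?thesis
  proof
    assume "openin (compact_open_top n (top_of_set W)) U"
    then obtain T where T: "generate_topology_on B T" "U = T \<inter> S"
      unfolding co openin_subtopology openin_topology_generated_by_iff by blast
    then show "U \<subseteq> S \<and> (\<forall>\<sigma>\<in>U. \<exists>e>0. \<forall>\<tau>\<in>S. sup_near n e \<tau> \<sigma> \<longrightarrow> \<tau> \<in> U)"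
      using basic[OF T(1)] by auto
  next
    assume U: "U \<subseteq> S \<and> (\<forall>\<sigma>\<in>U. \<exists>e>0. \<forall>\<tau>\<in>S. sup_near n e \<tau> \<sigma> \<longrightarrow> \<tau> \<in> U)"
    show "openin (compact_open_top n (top_of_set W)) U"
    proof (subst openin_subopen, intro ballI)
      fix \<sigma> assume "\<sigma> \<in> U"
      then obtain e where "e > 0" "\<forall>\<tau>\<in>S. sup_near n e \<tau> \<sigma> \<longrightarrow> \<tau> \<in> U" and "\<sigma> \<in> S" using U by blast
      moreover from nbhd[OF this(3,1)] obtain V where
        V: "openin (compact_open_top n (top_of_set W)) V" "\<sigma> \<in> V" "\<forall>\<tau>\<in>V. sup_near n e \<tau> \<sigma>" by blast
      moreover have "V \<subseteq> S" using openin_subset[OF V(1)] by (simp add: S_def)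
      ultimately show "\<exists>T. openin (compact_open_top n (top_of_set W)) T \<and> \<sigma> \<in> T \<and> T \<subseteq> U" by blast
    qed
  qed
qed

text \<open>The radius \<open>r < e\<close> leaves room for the triangle inequality, without an
  appeal to the supremum being attained.\<close>

lemma openin_sup_ball:
  fixes W :: "'a::metric_space set"
  assumes "\<sigma> \<in> singular_simplex_set n (top_of_set W)"
  shows "openin (compact_open_top n (top_of_set W))
    {\<tau> \<in> singular_simplex_set n (top_of_set W). \<exists>r<e. sup_near n r \<tau> \<sigma>}"
  unfolding openin_compact_open_iff
proof (intro conjI ballI)
  fix \<tau> assume "\<tau> \<in> {\<tau> \<in> singular_simplex_set n (top_of_set W). \<exists>r<e. sup_near n r \<tau> \<sigma>}"
  then obtain r where r: "r < e" "sup_near n r \<tau> \<sigma>" by blast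
  show "\<exists>d>0. \<forall>\<rho>\<in>singular_simplex_set n (top_of_set W). sup_near n d \<rho> \<tau> \<longrightarrow>
      \<rho> \<in> {\<tau> \<in> singular_simplex_set n (top_of_set W). \<exists>r<e. sup_near n r \<tau> \<sigma>}"
  proof (rule exI[of _ "(e - r)/2"], safe)
    fix \<rho> assume near: "sup_near n ((e - r)/2) \<rho> \<tau>"
    have "sup_near n ((r + e)/2) \<rho> \<sigma>"
      unfolding sup_near_def
    proof
      fix t assume "t \<in> standard_simplex n"
      then have "dist (\<rho> t) (\<tau> t) < (e - r)/2" "dist (\<tau> t) (\<sigma> t) < r"
        using near r(2) unfolding sup_near_def by auto
      moreover have "(e - r)/2 + r = (r + e)/2" by (simp add: field_simps)
      ultimately show "dist (\<rho> t) (\<sigma> t) < (r + e)/2"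
        using dist_triangle[of "\<rho> t" "\<sigma> t" "\<tau> t"] by linarith
    qed
    then show "\<exists>r<e. sup_near n r \<rho> \<sigma>" using r(1) by (intro exI[of _ "(r + e)/2"]) simp
  qed (use r(1) in simp)
qed auto

text \<open>The necessity half of Ascoli: finitely many uniform balls of radius \<open>e/3\<close>
  cover \<open>K\<close>, and the smallest of the moduli of their centres serves all of
  \<open>K\<close>.\<close>

lemma compactin_imp_equicont:
  fixes W :: "'a::metric_space set"
  assumes K: "compactin (compact_open_top n (top_of_set W)) K"
  shows "equicont n K"
  unfolding equicont_def
proof (intro allI impI)
  fix e :: real assume e: "e > 0"
  let ?S = "singular_simplex_set n (top_of_set W)"
  have KS: "K \<subseteq> ?S" using compactin_subset_topspace[OF K] by simp
  define U where "U \<sigma> = {\<tau> \<in> ?S. \<exists>r<e/3. sup_near n r \<tau> \<sigma>}" for \<sigma>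
  have mem: "\<sigma> \<in> U \<sigma>" if "\<sigma> \<in> K" for \<sigma>
    using that KS e unfolding U_def sup_near_def by (auto intro!: exI[of _ "e/4"])
  have "\<exists>F. finite F \<and> F \<subseteq> U ` K \<and> K \<subseteq> \<Union>F"
  proof -
    have "\<forall>V\<in>U ` K. openin (compact_open_top n (top_of_set W)) V"
      using KS openin_sup_ball[of _ n W "e/3"] unfolding U_def by auto
    moreover have "K \<subseteq> \<Union>(U ` K)" using mem by blast
    ultimately show ?thesis using K unfolding compactin_def by blast
  qed
  then obtain F0 where F0: "finite F0" "F0 \<subseteq> U ` K" "K \<subseteq> \<Union>F0" by blast
  then obtain F where F: "finite F" "F \<subseteq> K" "F0 = U ` F" by (metis finite_subset_image)
  have "\<exists>d>0. \<forall>s\<in>standard_simplex n. \<forall>t\<in>standard_simplex n. coord_near d s t \<longrightarrow> dist (\<sigma> s) (\<sigma> t) < e/3"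
    if "\<sigma> \<in> F" for \<sigma>
  proof -
    have "\<sigma> \<in> ?S" using that F KS by blast
    then have "equicont n {\<sigma>}" by (simp add: singular_simplex_top_of_set)
    then have "\<forall>e>0. \<exists>d>0. \<forall>s\<in>standard_simplex n. \<forall>t\<in>standard_simplex n. coord_near d s t \<longrightarrow> dist (\<sigma> s) (\<sigma> t) < e"
      unfolding equicont_def by simp
    from spec[OF this, of "e/3"] show ?thesis using e by simp
  qed
  then obtain d where d: "\<And>\<sigma>. \<sigma> \<in> F \<Longrightarrow> d \<sigma> > 0"
    "\<And>\<sigma> s t. \<sigma> \<in> F \<Longrightarrow> s\<in>standard_simplex n \<Longrightarrow> t\<in>standard_simplex n \<Longrightarrow> coord_near (d \<sigma>) s t
       \<Longrightarrow> dist (\<sigma> s) (\<sigma> t) < e/3"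
    by metis
  \<comment> \<open>The 1 keeps the minimum meaningful when there are no centres.\<close>
  define d0 where "d0 = Min (insert 1 (d ` F))"
  have d0: "d0 > 0" "\<And>\<sigma>. \<sigma> \<in> F \<Longrightarrow> d0 \<le> d \<sigma>"
    unfolding d0_def using F(1) d(1) by auto
  show "\<exists>d>0. \<forall>f\<in>K. \<forall>s\<in>standard_simplex n. \<forall>t\<in>standard_simplex n.
        coord_near d s t \<longrightarrow> dist (f s) (f t) < e"
  proof (intro exI[of _ d0] conjI ballI impI d0)
    fix f s t assume f: "f \<in> K" and st: "s \<in> standard_simplex n" "t \<in> standard_simplex n" "coord_near d0 s t"
    then obtain \<sigma> where \<sigma>: "\<sigma> \<in> F" "f \<in> U \<sigma>" using F0 F by blast
    then obtain r where r: "r < e/3" "sup_near n r f \<sigma>" unfolding U_def by blast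
    have "coord_near (d \<sigma>) s t" using st(3) d0(2)[OF \<sigma>(1)] by (rule coord_near_mono)
    then have "dist (\<sigma> s) (\<sigma> t) < e/3" using d(2) \<sigma> st by blast
    moreover have "dist (f s) (\<sigma> s) < e/3" "dist (f t) (\<sigma> t) < e/3"
      using r st unfolding sup_near_def by force+
    ultimately show "dist (f s) (f t) < e"
      using dist_triangle[of "f s" "f t" "\<sigma> s"] dist_triangle2[of "\<sigma> s" "f t" "\<sigma> t"] by linarith
  qed
qed

text \<open>The sufficiency half of Ascoli: all maps with a common modulus form a set that is
  compact for pointwise convergence by Tychonoff, and on such a set pointwise and uniform
  convergence agree.\<close>

lemma equicont_imp_subset_compactin:
  fixes W :: "'a::metric_space set"
  assumes W: "compact W" and FS: "F \<subseteq> singular_simplex_set n (top_of_set W)" and F: "equicont n F"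
  obtains K where "compactin (compact_open_top n (top_of_set W)) K" "F \<subseteq> K"
proof -
  let ?S = "singular_simplex_set n (top_of_set W)" and ?D = "standard_simplex n"
  have "\<forall>m::nat. \<exists>d>0. \<forall>f\<in>F. \<forall>s\<in>?D. \<forall>t\<in>?D. coord_near d s t \<longrightarrow> dist (f s) (f t) < inverse (Suc m)"
    using F unfolding equicont_def by simp
  then obtain d where d: "\<And>m::nat. d m > 0"
    "\<And>m f s t. f \<in> F \<Longrightarrow> s \<in> ?D \<Longrightarrow> t \<in> ?D \<Longrightarrow> coord_near (d m) s t \<Longrightarrow> dist (f s) (f t) < inverse (Suc m)"
    by metis
  \<comment> \<open>The strict estimates of \<open>F\<close> are relaxed to non-strict ones, which
    are closed conditions on pairs of values.\<close>
  define K where "K = {f \<in> ?D \<rightarrow>\<^sub>E W. \<forall>m. \<forall>s\<in>?D. \<forall>t\<in>?D. coord_near (d m) s t \<longrightarrow> dist (f s) (f t) \<le> inverse (Suc m)}"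
  let ?P = "product_topology (\<lambda>_. euclidean :: 'a topology) ?D"
  have Keq: "equicont n K"
    unfolding equicont_def
  proof (intro allI impI)
    fix e :: real assume "e > 0"
    then obtain m where m: "inverse (Suc m) < e" using reals_Archimedean by blast
    then show "\<exists>d>0. \<forall>f\<in>K. \<forall>s\<in>?D. \<forall>t\<in>?D. coord_near d s t \<longrightarrow> dist (f s) (f t) < e"
      using d(1)[of m] unfolding K_def by (intro exI[of _ "d m"]) force
  qed
  have KS: "K \<subseteq> ?S"
    using Keq unfolding singular_simplex_top_of_set
    by (auto simp: K_def PiE_def intro: equicont_subset)
  have Fsub: "F \<subseteq> K"
  proof
    fix f assume f: "f \<in> F"
    then have "f \<in> ?D \<rightarrow>\<^sub>E W" using FS unfolding singular_simplex_top_of_set by (auto simp: PiE_def singular_simplex_top_of_set)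
    then show "f \<in> K" unfolding K_def using d(2)[OF f] by (auto intro: less_imp_le)
  qed
  have Kc: "compactin ?P K"
  proof (rule closed_compactin)
    show "compactin ?P (?D \<rightarrow>\<^sub>E W)" using W by (simp add: compactin_PiE)
    show "K \<subseteq> ?D \<rightarrow>\<^sub>E W" unfolding K_def by blast
    have c1: "closedin ?P (?D \<rightarrow>\<^sub>E W)" using compact_imp_closed[OF W] by (simp add: closedin_product_topology)
    have c2: "closedin ?P {f \<in> topspace ?P. dist (f s) (f t) \<in> {..c}}" if "s \<in> ?D" "t \<in> ?D" for s t c
    proof (rule closedin_continuous_map_preimage)
      have "continuous_map (prod_topology euclidean euclidean) euclideanreal (\<lambda>(x::'a, y). dist x y)"
        by (simp add: case_prod_unfold continuous_on_dist continuous_on_fst continuous_on_snd)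
      moreover have "continuous_map ?P (prod_topology euclidean euclidean) (\<lambda>f. (f s, f t))"
        using that by (intro continuous_map_pairedI continuous_map_product_projection)
      ultimately have "continuous_map ?P euclideanreal ((\<lambda>(x::'a, y). dist x y) \<circ> (\<lambda>f. (f s, f t)))"
        using continuous_map_compose by blast
      then show "continuous_map ?P euclideanreal (\<lambda>f. dist (f s) (f t))" by (simp add: o_def)
    qed auto
    have "K = (\<Inter>C\<in>insert (?D \<rightarrow>\<^sub>E W) ((\<lambda>(m,s,t). {f \<in> topspace ?P. dist (f s) (f t) \<in> {..inverse (Suc m)}})
        ` {(m,s,t). s \<in> ?D \<and> t \<in> ?D \<and> coord_near (d m) s t}). C)"
      unfolding K_def by (auto simp: PiE_def)
    also have "closedin ?P \<dots>"
      using c1 c2 by (intro closedin_Inter) auto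
    finally show "closedin ?P K" .
  qed
  \<comment> \<open>Closeness on a finite net forces uniform closeness, because both maps vary by
    less than \<open>e/3\<close> between a point and the net.\<close>
  have "continuous_map (subtopology ?P K) (compact_open_top n (top_of_set W)) id"
    unfolding continuous_map_def
  proof (intro conjI allI impI)
    show "id \<in> topspace (subtopology ?P K) \<rightarrow> topspace (compact_open_top n (top_of_set W))"
      using KS by auto
    fix U assume U: "openin (compact_open_top n (top_of_set W)) U"
    have "{x \<in> topspace (subtopology ?P K). id x \<in> U} = K \<inter> U"
      using compactin_subset_topspace[OF Kc] by auto
    moreover have "openin (subtopology ?P K) (K \<inter> U)"
    proof (subst openin_subopen, intro ballI)
      fix \<sigma> assume \<sigma>: "\<sigma> \<in> K \<inter> U"
      then obtain e where e: "e > 0" "\<And>\<tau>. \<tau> \<in> ?S \<Longrightarrow> sup_near n e \<tau> \<sigma> \<Longrightarrow> \<tau> \<in> U"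
        using U unfolding openin_compact_open_iff by blast
      obtain c where c: "c > 0"
        "\<And>f s t. f \<in> K \<Longrightarrow> s \<in> ?D \<Longrightarrow> t \<in> ?D \<Longrightarrow> coord_near c s t \<Longrightarrow> dist (f s) (f t) < e/3"
        by (rule equicontD[OF Keq, of "e/3"]) (use e(1) in \<open>auto intro: that\<close>)
      obtain N where N: "finite N" "N \<subseteq> ?D" "\<And>s. s \<in> ?D \<Longrightarrow> \<exists>b\<in>N. coord_near c s b"
        using coord_net[OF c(1)] by metis
      define V where "V = topspace ?P \<inter> (\<Inter>b\<in>N. {f \<in> topspace ?P. f b \<in> ball (\<sigma> b) (e/3)})"
      have "openin ?P {f \<in> topspace ?P. f b \<in> ball (\<sigma> b) (e/3)}" if "b \<in> N" for b
        using that N(2) by (intro openin_continuous_map_preimage[OF continuous_map_product_projection]) auto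
      then have V: "openin ?P V" unfolding V_def
        using N(1) by (intro openin_Int_Inter) (auto simp del: topspace_product_topology)
      have "\<sigma> \<in> V" using \<sigma> compactin_subset_topspace[OF Kc] e(1) unfolding V_def by auto
      moreover have "\<tau> \<in> U" if "\<tau> \<in> V \<inter> K" for \<tau>
      proof (rule e(2))
        show "\<tau> \<in> ?S" using that KS by blast
        show "sup_near n e \<tau> \<sigma>"
          unfolding sup_near_def
        proof
          fix s assume s: "s \<in> ?D"
          then obtain b where b: "b \<in> N" "coord_near c s b" using N(3) by blast
          have "dist (\<tau> s) (\<tau> b) < e/3" "dist (\<sigma> s) (\<sigma> b) < e/3"
            using c(2) that \<sigma> s b N(2) by blast+
          moreover have "dist (\<sigma> b) (\<tau> b) < e/3" using that b(1) unfolding V_def by auto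
          ultimately show "dist (\<tau> s) (\<sigma> s) < e"
            using dist_triangle[of "\<tau> s" "\<sigma> s" "\<tau> b"] dist_triangle2[of "\<tau> b" "\<sigma> s" "\<sigma> b"]
            by (simp add: dist_commute)
        qed
      qed
      ultimately show "\<exists>T. openin (subtopology ?P K) T \<and> \<sigma> \<in> T \<and> T \<subseteq> K \<inter> U"
        using \<sigma> V by (intro exI[of _ "V \<inter> K"]) (auto simp: openin_subtopology)
    qed
    ultimately show "openin (subtopology ?P K) {x \<in> topspace (subtopology ?P K). id x \<in> U}" by simp
  qed
  moreover have "compactin (subtopology ?P K) K" using Kc by (simp add: compactin_subtopology)
  ultimately have "compactin (compact_open_top n (top_of_set W)) (id ` K)"
    by (rule image_compactin[rotated])
  then show ?thesis using that Fsub by simp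
qed

subsection \<open>Signed measures\<close>

locale signed_measure =
  fixes M :: "'a measure" and \<mu> :: "'a set \<Rightarrow> real"
  assumes empty [simp]: "\<mu> {} = 0"
    and sums: "\<And>A :: nat \<Rightarrow> 'a set. range A \<subseteq> sets M \<Longrightarrow> disjoint_family A \<Longrightarrow>
      (\<lambda>n. \<mu> (A n)) sums \<mu> (\<Union>n. A n)"
begin

lemma Un:
  assumes "A \<in> sets M" "B \<in> sets M" "A \<inter> B = {}"
  shows "\<mu> (A \<union> B) = \<mu> A + \<mu> B"
proof -
  have "(\<lambda>n. \<mu> (binaryset A B n)) sums \<mu> (\<Union>n. binaryset A B n)"
    using assms by (intro sums) (auto simp: range_binaryset_eq disjoint_family_on_def binaryset_def)
  moreover have "(\<lambda>n. \<mu> (binaryset A B n)) sums (\<mu> A + \<mu> B)"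
    by (rule binaryset_sums) simp
  ultimately show ?thesis using sums_unique2 by (metis UN_binaryset_eq)
qed

lemma split:
  assumes "A \<in> sets M" "B \<in> sets M"
  shows "\<mu> A = \<mu> (A \<inter> B) + \<mu> (A - B)"
  using Un[of "A \<inter> B" "A - B"] assms by (simp add: Int_Diff_disjoint Int_Diff_Un)

lemma finite_UN:
  assumes "finite I" "\<And>i. i \<in> I \<Longrightarrow> A i \<in> sets M" "disjoint_family_on A I"
  shows "\<mu> (\<Union>i\<in>I. A i) = (\<Sum>i\<in>I. \<mu> (A i))"
  using assms
proof (induction I rule: finite_induct)
  case (insert i I)
  have "\<mu> (A i \<union> (\<Union>i\<in>I. A i)) = \<mu> (A i) + \<mu> (\<Union>i\<in>I. A i)"
    using insert.prems insert.hyps by (intro Un) (auto simp: disjoint_family_on_def)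
  moreover have "disjoint_family_on A I" using insert.prems by (auto simp: disjoint_family_on_def)
  ultimately show ?case using insert by simp
qed simp

text \<open>A linear relation between indicators on \<open>C\<close> passes to the measure.
  Splitting \<open>C\<close> along \<open>B k\<close> lowers the constant to \<open>d - c k\<close>
  on one piece and keeps it on the other; with no sets left, the constant is 0 unless
  \<open>C\<close> is empty.\<close>

lemma combination:
  assumes "finite J" "C \<in> sets M" "\<And>j. j \<in> J \<Longrightarrow> B j \<in> sets M"
    and "\<And>x. x \<in> C \<Longrightarrow> (\<Sum>j\<in>J. c j * indicator (B j) x) = d"
  shows "(\<Sum>j\<in>J. c j * \<mu> (B j \<inter> C)) = d * \<mu> C"
  using assms
proof (induction J arbitrary: C d rule: finite_induct)
  case empty
  then show ?case by (cases "C = {}") auto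
next
  case (insert k J)
  have Bk: "B k \<in> sets M" using insert.prems by auto
  have eq: "c k * indicator (B k) x + (\<Sum>j\<in>J. c j * indicator (B j) x) = d" if "x \<in> C" for x
    using insert.prems(3)[OF that] unfolding sum.insert[OF insert.hyps(1,2)] .
  have 1: "(\<Sum>j\<in>J. c j * \<mu> (B j \<inter> (C \<inter> B k))) = (d - c k) * \<mu> (C \<inter> B k)"
  proof (rule insert.IH)
    show "(\<Sum>j\<in>J. c j * indicator (B j) x) = d - c k" if "x \<in> C \<inter> B k" for x
      using eq[of x] that by simp
  qed (use insert.prems Bk in auto)
  have 2: "(\<Sum>j\<in>J. c j * \<mu> (B j \<inter> (C - B k))) = d * \<mu> (C - B k)"
  proof (rule insert.IH)
    show "(\<Sum>j\<in>J. c j * indicator (B j) x) = d" if "x \<in> C - B k" for x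
      using eq[of x] that by simp
  qed (use insert.prems Bk in auto)
  have "\<mu> (B j \<inter> C) = \<mu> (B j \<inter> (C \<inter> B k)) + \<mu> (B j \<inter> (C - B k))" if "j \<in> J" for j
    using split[of "B j \<inter> C" "B k"] insert.prems that by (simp add: Int_assoc Int_Diff)
  then have "(\<Sum>j\<in>insert k J. c j * \<mu> (B j \<inter> C)) =
     c k * \<mu> (C \<inter> B k) + ((\<Sum>j\<in>J. c j * \<mu> (B j \<inter> (C \<inter> B k))) + (\<Sum>j\<in>J. c j * \<mu> (B j \<inter> (C - B k))))"
    using insert.hyps by (simp add: sum.distrib distrib_left Int_commute)
  also have "\<dots> = d * (\<mu> (C \<inter> B k) + \<mu> (C - B k))"
    unfolding 1 2 by (simp add: algebra_simps)
  finally show ?case using split[OF insert.prems(1) Bk] by simp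
qed

section \<open>Integration of simple functions against a signed measure\<close>

definition sint :: "('a \<Rightarrow> real) \<Rightarrow> real" where
  "sint f = (\<Sum>v\<in>f ` space M. v * \<mu> (f -` {v} \<inter> space M))"

text \<open>Independence of the representation: on each level set of \<open>f\<close> the
  combination is constant, and every \<open>B j\<close> is the finite disjoint union of its traces
  on the level sets.\<close>

lemma sint_combination:
  assumes f: "simple_function M f" and J: "finite J" "\<And>j. j \<in> J \<Longrightarrow> B j \<in> sets M"
    and eq: "\<And>x. x \<in> space M \<Longrightarrow> f x = (\<Sum>j\<in>J. c j * indicator (B j) x)"
  shows "sint f = (\<Sum>j\<in>J. c j * \<mu> (B j))"
proof -
  have fin: "finite (f ` space M)" and ms: "\<And>v. f -` {v} \<inter> space M \<in> sets M"
    using f by (auto intro: simple_functionD)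
  have "sint f = (\<Sum>v\<in>f ` space M. \<Sum>j\<in>J. c j * \<mu> (B j \<inter> (f -` {v} \<inter> space M)))"
    unfolding sint_def
  proof (intro sum.cong refl)
    fix v
    have "(\<Sum>j\<in>J. c j * indicator (B j) x) = v" if "x \<in> f -` {v} \<inter> space M" for x
      using eq[of x] that by simp
    then show "v * \<mu> (f -` {v} \<inter> space M) = (\<Sum>j\<in>J. c j * \<mu> (B j \<inter> (f -` {v} \<inter> space M)))"
      by (intro combination[OF J(1) ms J(2), symmetric])
  qed
  also have "\<dots> = (\<Sum>j\<in>J. c j * (\<Sum>v\<in>f ` space M. \<mu> (B j \<inter> (f -` {v} \<inter> space M))))"
    by (subst sum.swap) (simp add: sum_distrib_left)
  also have "\<dots> = (\<Sum>j\<in>J. c j * \<mu> (B j))"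
  proof (intro sum.cong refl)
    fix j assume j: "j \<in> J"
    have "\<mu> (\<Union>v\<in>f ` space M. B j \<inter> (f -` {v} \<inter> space M)) =
        (\<Sum>v\<in>f ` space M. \<mu> (B j \<inter> (f -` {v} \<inter> space M)))"
    proof (rule finite_UN[OF fin])
      show "B j \<inter> (f -` {v} \<inter> space M) \<in> sets M" for v by (intro sets.Int J(2)[OF j] ms)
    qed (auto simp: disjoint_family_on_def)
    moreover have "(\<Union>v\<in>f ` space M. B j \<inter> (f -` {v} \<inter> space M)) = B j"
      using sets.sets_into_space[OF J(2)[OF j]] by auto
    ultimately show "c j * (\<Sum>v\<in>f ` space M. \<mu> (B j \<inter> (f -` {v} \<inter> space M))) = c j * \<mu> (B j)" by simp
  qed
  finally show ?thesis .
qed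

lemma sint_indicator:
  assumes "B \<in> sets M"
  shows "sint (indicator B) = \<mu> B"
  using sint_combination[of "indicator B" "{()}" "\<lambda>_. B" "\<lambda>_. 1"] assms by simp

lemma sum_levels:
  fixes h :: "'a \<Rightarrow> real"
  assumes "finite (h ` space M)" "x \<in> space M"
  shows "(\<Sum>v\<in>h ` space M. v * indicator (h -` {v} \<inter> space M) x) = h x"
proof -
  have "(\<Sum>v\<in>h ` space M. v * indicator (h -` {v} \<inter> space M) x) = (\<Sum>v\<in>h ` space M. if v = h x then v else 0)"
    using assms(2) by (intro sum.cong) (auto simp: indicator_def)
  also have "\<dots> = h x" using assms by (simp add: sum.delta)
  finally show ?thesis .
qed

lemma sint_cmult:
  assumes f: "simple_function M f"
  shows "sint (\<lambda>x. c * f x) = c * sint f"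
proof -
  have "sint (\<lambda>x. c * f x) = (\<Sum>v\<in>f ` space M. (c * v) * \<mu> (f -` {v} \<inter> space M))"
  proof (rule sint_combination)
    show "f -` {v} \<inter> space M \<in> sets M" for v using f by (rule simple_functionD)
    fix x assume x: "x \<in> space M"
    have "(\<Sum>v\<in>f ` space M. c * v * indicator (f -` {v} \<inter> space M) x) = (\<Sum>v\<in>f ` space M. c * (v * indicator (f -` {v} \<inter> space M) x))"
      by (intro sum.cong refl) (rule mult.assoc)
    also have "\<dots> = c * f x"
      unfolding sum_distrib_left[symmetric] sum_levels[OF simple_functionD(1)[OF f] x] ..
    finally show "c * f x = (\<Sum>v\<in>f ` space M. c * v * indicator (f -` {v} \<inter> space M) x)" ..
  qed (use f in \<open>auto intro: simple_functionD\<close>)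
  then show ?thesis by (simp add: sint_def sum_distrib_left mult.assoc)
qed

lemma sint_add:
  assumes f: "simple_function M f" and g: "simple_function M g"
  shows "sint (\<lambda>x. f x + g x) = sint f + sint g"
proof -
  \<comment> \<open>The disjoint sum keeps a value taken by both functions as two separate
    indices.\<close>
  let ?J = "f ` space M <+> g ` space M"
  let ?c = "\<lambda>j. case j of Inl v \<Rightarrow> v | Inr v \<Rightarrow> v"
  let ?B = "\<lambda>j. case j of Inl v \<Rightarrow> f -` {v} \<inter> space M | Inr v \<Rightarrow> g -` {v} \<inter> space M"
  have fin: "finite (f ` space M)" "finite (g ` space M)" using f g by (auto intro: simple_functionD)
  have "sint (\<lambda>x. f x + g x) = (\<Sum>j\<in>?J. ?c j * \<mu> (?B j))"
  proof (rule sint_combination)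
    show "finite ?J" using fin by simp
    show "?B j \<in> sets M" if "j \<in> ?J" for j
      using f g by (auto intro: simple_functionD split: sum.split)
    fix x assume x: "x \<in> space M"
    show "f x + g x = (\<Sum>j\<in>?J. ?c j * indicator (?B j) x)"
      unfolding sum.Plus[OF fin] o_def sum.case sum_levels[OF fin(1) x] sum_levels[OF fin(2) x] ..
  qed (use f g in auto)
  also have "\<dots> = sint f + sint g"
    using fin by (simp add: sum.Plus sint_def)
  finally show ?thesis .
qed

lemma sint_zero: "sint (\<lambda>x. 0) = 0"
  using sint_combination[of "\<lambda>x. 0" "{}"] by simp

lemma sint_sum:
  assumes "finite I" "\<And>i. i \<in> I \<Longrightarrow> simple_function M (f i)"
  shows "sint (\<lambda>x. \<Sum>i\<in>I. f i x) = (\<Sum>i\<in>I. sint (f i))"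
  using assms
  by (induction I rule: finite_induct) (simp_all add: sint_zero sint_add)

lemma sint_diff:
  assumes "simple_function M f" "simple_function M g"
  shows "sint (\<lambda>x. f x - g x) = sint f - sint g"
proof -
  have "simple_function M (\<lambda>x. -1 * g x)" using assms by (intro simple_function_mult) auto
  from sint_add[OF assms(1) this] show ?thesis using sint_cmult[OF assms(2), of "-1"] by simp
qed

text \<open>The level sets of \<open>f - g\<close> for nonzero values miss \<open>K\<close>, hence
  are null. This is how identities that hold only on the carrier are integrated.\<close>

lemma sint_cong_carrier:
  assumes f: "simple_function M f" and g: "simple_function M g"
    and null: "\<And>B. B \<in> sets M \<Longrightarrow> B \<inter> K = {} \<Longrightarrow> \<mu> B = 0"
    and eq: "\<And>x. x \<in> space M \<Longrightarrow> x \<in> K \<Longrightarrow> f x = g x"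
  shows "sint f = sint g"
proof -
  let ?h = "\<lambda>x. f x - g x"
  have h: "simple_function M ?h" using f g by simp
  have "v * \<mu> (?h -` {v} \<inter> space M) = 0" for v
  proof (cases "v = 0")
    case False
    then have "(?h -` {v} \<inter> space M) \<inter> K = {}" using eq by auto
    moreover have "?h -` {v} \<inter> space M \<in> sets M" using h by (auto intro: simple_functionD)
    ultimately show ?thesis using null by simp
  qed simp
  then have "sint ?h = 0" unfolding sint_def by (simp only: sum.neutral_const)
  then show ?thesis using sint_diff[OF f g] by simp
qed

end

text \<open>The shape of all integrands below: \<open>l\<close> runs over outer faces,
  \<open>B l\<close> collects the cones and \<open>D l i\<close> their corrections, with signs as
  coefficients.\<close>

lemma (in signed_measure) sint_indicator_combination:
  fixes c :: "'i \<Rightarrow> real" and d :: "'j \<Rightarrow> real"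
  assumes "finite I" "finite J" "\<And>l. l \<in> I \<Longrightarrow> B l \<in> sets M"
    and "\<And>l i. l \<in> I \<Longrightarrow> i \<in> J \<Longrightarrow> D l i \<in> sets M"
  defines "f \<equiv> \<lambda>x. \<Sum>l\<in>I. c l * (indicator (B l) x - (\<Sum>i\<in>J. d i * indicator (D l i) x))"
  shows "simple_function M f"
    and "sint f = (\<Sum>l\<in>I. c l * (\<mu> (B l) - (\<Sum>i\<in>J. d i * \<mu> (D l i))))"
proof -
  have D: "simple_function M (\<lambda>x. d i * indicator (D l i) x)" if "l \<in> I" "i \<in> J" for l i
    using assms(4)[OF that] by (intro simple_function_mult simple_function_const simple_function_indicator)
  have DS: "simple_function M (\<lambda>x. \<Sum>i\<in>J. d i * indicator (D l i) x)" if "l \<in> I" for l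
    using D that by (intro simple_function_sum)
  have B: "simple_function M (indicator (B l) :: _ \<Rightarrow> real)" if "l \<in> I" for l
    using assms(3)[OF that] by (rule simple_function_indicator)
  have BD: "simple_function M (\<lambda>x. indicator (B l) x - (\<Sum>i\<in>J. d i * indicator (D l i) x))" if "l \<in> I" for l
    using B[OF that] DS[OF that] by (rule simple_function_diff)
  have cBD: "simple_function M (\<lambda>x. c l * (indicator (B l) x - (\<Sum>i\<in>J. d i * indicator (D l i) x)))" if "l \<in> I" for l
    using BD[OF that] by (intro simple_function_mult simple_function_const)
  then show "simple_function M f" unfolding f_def by (intro simple_function_sum)
  have "sint f = (\<Sum>l\<in>I. sint (\<lambda>x. c l * (indicator (B l) x - (\<Sum>i\<in>J. d i * indicator (D l i) x))))"
    unfolding f_def using assms(1) cBD by (rule sint_sum)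
  also have "\<dots> = (\<Sum>l\<in>I. c l * (\<mu> (B l) - (\<Sum>i\<in>J. d i * \<mu> (D l i))))"
  proof (intro sum.cong refl)
    fix l assume l: "l \<in> I"
    have "sint (\<lambda>x. \<Sum>i\<in>J. d i * indicator (D l i) x) = (\<Sum>i\<in>J. sint (\<lambda>x. d i * indicator (D l i) x))"
      using assms(2) D[OF l] by (rule sint_sum)
    also have "\<dots> = (\<Sum>i\<in>J. d i * \<mu> (D l i))"
      using assms(4)[OF l] by (intro sum.cong refl) (simp add: sint_cmult sint_indicator)
    finally show "sint (\<lambda>x. c l * (indicator (B l) x - (\<Sum>i\<in>J. d i * indicator (D l i) x))) =
        c l * (\<mu> (B l) - (\<Sum>i\<in>J. d i * \<mu> (D l i)))"
      using sint_cmult[OF BD[OF l]] sint_diff[OF B[OF l] DS[OF l]] sint_indicator[OF assms(3)[OF l]] by simp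
  qed
  finally show "sint f = (\<Sum>l\<in>I. c l * (\<mu> (B l) - (\<Sum>i\<in>J. d i * \<mu> (D l i))))" .
qed

subsection \<open>Cones\<close>

text \<open>The linear join with apex \<open>a\<close> at vertex 0. At the apex itself
  \<open>\<tau>\<close> is evaluated at a point outside the simplex, but with weight 0.\<close>

definition rcone :: "real \<Rightarrow> ((nat \<Rightarrow> real) \<Rightarrow> real) \<Rightarrow> (nat \<Rightarrow> real) \<Rightarrow> real" where
  "rcone a \<tau> t = t 0 * a + (1 - t 0) * \<tau> (\<lambda>i. t (Suc i) / (1 - t 0))"

lemma tail_in_standard_simplex:
  assumes t: "t \<in> standard_simplex (Suc n)" and t0: "t 0 \<noteq> 1"
  shows "(\<lambda>i. t (Suc i) / (1 - t 0)) \<in> standard_simplex n"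
proof -
  have t1: "0 \<le> t i" "t i \<le> 1" for i using t unfolding standard_simplex_def by auto
  have pos: "0 < 1 - t 0" using t1[of 0] t0 by simp
  have "t 0 + (\<Sum>i\<le>n. t (Suc i)) = 1"
    using t unfolding standard_simplex_def by (simp add: sum.atMost_Suc_shift del: sum.atMost_Suc)
  then have s: "(\<Sum>i\<le>n. t (Suc i)) = 1 - t 0" by simp
  have z: "t (Suc i) = 0" if "i > n" for i using t that unfolding standard_simplex_def by auto
  have "t (Suc i) \<le> 1 - t 0" for i
  proof (cases "i \<le> n")
    case True
    then show ?thesis unfolding s[symmetric] by (intro member_le_sum t1) auto
  qed (use z[of i] pos in auto)
  then show ?thesis
    using pos z t1 s unfolding standard_simplex_def by (simp flip: sum_divide_distrib)
qed

lemma standard_simplex_le_1: "t \<in> standard_simplex n \<Longrightarrow> 0 \<le> t i \<and> t i \<le> 1"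
  unfolding standard_simplex_def by auto

lemma rcone_nonneg:
  assumes "t \<in> standard_simplex (Suc n)" "0 \<le> a" "\<And>s. s \<in> standard_simplex n \<Longrightarrow> 0 \<le> \<tau> s"
  shows "0 \<le> rcone a \<tau> t"
proof (cases "t 0 = 1")
  case False
  then show ?thesis
    unfolding rcone_def using tail_in_standard_simplex[OF assms(1)] assms standard_simplex_le_1[OF assms(1), of 0]
    by (intro add_nonneg_nonneg mult_nonneg_nonneg) auto
qed (use assms in \<open>simp add: rcone_def\<close>)

lemma rcone_diff:
  "rcone a \<tau> t - a = (1 - t 0) * (\<tau> (\<lambda>i. t (Suc i) / (1 - t 0)) - a)"
  by (simp add: rcone_def algebra_simps)

lemma rcone_bound:
  assumes t: "t \<in> standard_simplex (Suc n)" and D: "\<And>s. s \<in> standard_simplex n \<Longrightarrow> \<bar>\<tau> s - a\<bar> \<le> D"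
  shows "\<bar>rcone a \<tau> t - a\<bar> \<le> (1 - t 0) * D"
proof (cases "t 0 = 1")
  case False
  then show ?thesis
    unfolding rcone_diff abs_mult
    using D[OF tail_in_standard_simplex[OF t False]] standard_simplex_le_1[OF t, of 0]
    by (auto intro: mult_left_mono)
qed (simp add: rcone_def)

text \<open>Coning to a fixed apex does not increase uniform distances; this drives the
  measurability of cones.\<close>

lemma rcone_close:
  assumes t: "t \<in> standard_simplex (Suc n)" and e: "\<And>s. s \<in> standard_simplex n \<Longrightarrow> \<bar>\<tau> s - \<tau>' s\<bar> < e"
  shows "\<bar>rcone a \<tau> t - rcone a \<tau>' t\<bar> < e"
proof (cases "t 0 = 1")
  case True
  have "0 < e" using e nonempty_standard_simplex[of n] by force
  then show ?thesis using True by (simp add: rcone_def)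
next
  case False
  let ?u = "\<lambda>i. t (Suc i) / (1 - t 0)"
  have "rcone a \<tau> t - rcone a \<tau>' t = (1 - t 0) * (\<tau> ?u - \<tau>' ?u)"
    by (simp add: rcone_def algebra_simps)
  then have "\<bar>rcone a \<tau> t - rcone a \<tau>' t\<bar> = (1 - t 0) * \<bar>\<tau> ?u - \<tau>' ?u\<bar>"
    using standard_simplex_le_1[OF t, of 0] by (simp add: abs_mult)
  also have "\<dots> \<le> \<bar>\<tau> ?u - \<tau>' ?u\<bar>"
    using standard_simplex_le_1[OF t, of 0] by (intro mult_left_le_one_le) auto
  also have "\<dots> < e" by (rule e[OF tail_in_standard_simplex[OF t False]])
  finally show ?thesis .
qed

text \<open>Near the apex the cone is close to \<open>a\<close>; away from it, the projection to the base is Lipschitz.\<close>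

lemma equicont_rcone:
  assumes F: "equicont n (snd ` P)"
    and D: "\<And>a \<tau> t. (a, \<tau>) \<in> P \<Longrightarrow> t \<in> standard_simplex n \<Longrightarrow> \<bar>\<tau> t - a\<bar> \<le> D"
  shows "equicont (Suc n) ((\<lambda>(a, \<tau>). rcone a \<tau>) ` P)"
  unfolding equicont_def
proof (intro allI impI)
  fix e :: real assume e: "e > 0"
  define D' where "D' = max D 1"
  have D': "D' > 0" "D \<le> D'" unfolding D'_def by auto
  \<comment> \<open>If one of the points has \<open>1 - t 0\<close> at most \<open>r\<close>, the
    other has at most \<open>2 * r\<close>, so both cone values lie within
    \<open>2 * r * D' = e/4\<close> of the apex value.\<close>
  define r where "r = e / (8 * D')"
  have r: "r > 0" "r * D' = e / 8" using e D' by (simp_all add: r_def)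
  have e2: "e / 2 > 0" using e by simp
  obtain d1 where d1: "d1 > 0"
    "\<And>f s t. f \<in> snd ` P \<Longrightarrow> s \<in> standard_simplex n \<Longrightarrow> t \<in> standard_simplex n \<Longrightarrow>
       coord_near d1 s t \<Longrightarrow> dist (f s) (f t) < e / 2"
    by (rule equicontD[OF F e2]) (rule that)
  \<comment> \<open>The first bound transfers closeness to the apex between the two points; the
    second makes \<open>2 * d / r \<le> d1\<close>, where \<open>2 / r\<close> is the Lipschitz
    constant of the projection to the base away from the apex.\<close>
  define d where "d = min r (r * d1 / 2)"
  have d: "d > 0" "d \<le> r" "2 * d / r \<le> d1" using r d1 by (auto simp: d_def field_simps min_def)
  show "\<exists>d>0. \<forall>f\<in>(\<lambda>(a, \<tau>). rcone a \<tau>) ` P. \<forall>s\<in>standard_simplex (Suc n). \<forall>t\<in>standard_simplex (Suc n).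
          coord_near d s t \<longrightarrow> dist (f s) (f t) < e"
  proof (intro exI[of _ d] conjI d ballI impI)
    fix f s t assume f: "f \<in> (\<lambda>(a, \<tau>). rcone a \<tau>) ` P"
      and s: "s \<in> standard_simplex (Suc n)" and t: "t \<in> standard_simplex (Suc n)" and near: "coord_near d s t"
    obtain a \<tau> where P: "(a, \<tau>) \<in> P" "f = rcone a \<tau>" using f by auto
    have D2: "\<bar>\<tau> u - a\<bar> \<le> D'" if "u \<in> standard_simplex n" for u using D[OF P(1) that] D'(2) by simp
    have n0: "\<bar>s i - t i\<bar> < d" for i using near by (simp add: coord_near_def)
    have s01: "0 \<le> s 0" "s 0 \<le> 1" "0 \<le> t 0" "t 0 \<le> 1"
      using standard_simplex_le_1[OF s] standard_simplex_le_1[OF t] by auto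
    have bs: "\<bar>rcone a \<tau> s - a\<bar> \<le> (1 - s 0) * D'" and bt: "\<bar>rcone a \<tau> t - a\<bar> \<le> (1 - t 0) * D'"
      using rcone_bound[OF s D2] rcone_bound[OF t D2] by auto
    have contract: "\<bar>w * z\<bar> \<le> \<bar>z\<bar>" if "0 \<le> w" "w \<le> 1" for w z :: real
      using that by (simp add: abs_mult mult_left_le_one_le)
    have add2: "\<bar>x + y\<bar> < 2 * d" if "\<bar>x\<bar> < d" "\<bar>y\<bar> < d" for x y :: real using that by linarith
    show "dist (f s) (f t) < e"
    proof (cases "1 - s 0 \<le> r \<or> 1 - t 0 \<le> r")
      case True
      then have "1 - s 0 \<le> 2 * r" "1 - t 0 \<le> 2 * r" using n0[of 0] d(2) by linarith+
      then have "(1 - s 0) * D' \<le> 2 * r * D'" "(1 - t 0) * D' \<le> 2 * r * D'"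
        using D'(1) by (intro mult_right_mono; simp)+
      then have "\<bar>rcone a \<tau> s - rcone a \<tau> t\<bar> \<le> e / 2" using bs bt r(2) by linarith
      then show ?thesis using e P(2) by (simp add: dist_real_def)
    next
      case False
      let ?u = "\<lambda>i. s (Suc i) / (1 - s 0)" and ?v = "\<lambda>i. t (Suc i) / (1 - t 0)"
      have ss: "1 - s 0 > r" "1 - t 0 > r" using False by auto
      have u: "?u \<in> standard_simplex n" and v: "?v \<in> standard_simplex n"
        using tail_in_standard_simplex[OF s] tail_in_standard_simplex[OF t] ss r(1) by auto
      have "\<bar>?u i - ?v i\<bar> < d1" for i
      proof -
        have v1: "0 \<le> ?v i" "?v i \<le> 1" using standard_simplex_le_1[OF v, of i] by auto
        have "?u i - ?v i = ((s (Suc i) - t (Suc i)) + ?v i * (s 0 - t 0)) / (1 - s 0)"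
          using ss r(1) by (simp add: field_simps)
        then have "\<bar>?u i - ?v i\<bar> = \<bar>(s (Suc i) - t (Suc i)) + ?v i * (s 0 - t 0)\<bar> / (1 - s 0)"
          using ss r(1) by simp
        also have "\<dots> < 2 * d / (1 - s 0)"
        proof (rule divide_strict_right_mono)
          have "\<bar>?v i * (s 0 - t 0)\<bar> < d" by (rule le_less_trans[OF contract[OF v1] n0])
          then show "\<bar>(s (Suc i) - t (Suc i)) + ?v i * (s 0 - t 0)\<bar> < 2 * d"
            by (rule add2[OF n0])
        qed (use ss r(1) in linarith)
        also have "\<dots> \<le> 2 * d / r" using ss r(1) d(1) by (intro divide_left_mono) auto
        also have "\<dots> \<le> d1" by (rule d)
        finally show ?thesis .
      qed
      then have "dist (\<tau> ?u) (\<tau> ?v) < e / 2"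
        using d1(2)[OF _ u v, of \<tau>] P(1) by (force simp: coord_near_def)
      then have 1: "\<bar>(1 - s 0) * (\<tau> ?u - \<tau> ?v)\<bar> < e / 2"
        using contract[of "1 - s 0" "\<tau> ?u - \<tau> ?v"] s01 by (simp add: dist_real_def)
      have "\<bar>(t 0 - s 0) * (\<tau> ?v - a)\<bar> \<le> d * D'"
        unfolding abs_mult using n0[of 0] D2[OF v] d(1) by (intro mult_mono) auto
      also have "\<dots> \<le> r * D'" using d(2) D'(1) by (intro mult_right_mono) auto
      finally have 2: "\<bar>(t 0 - s 0) * (\<tau> ?v - a)\<bar> \<le> e / 8" using r(2) by simp
      \<comment> \<open>The first summand changes the base point at a fixed height, the second
        changes the height over a fixed base point.\<close>
      have "rcone a \<tau> s - rcone a \<tau> t = (1 - s 0) * (\<tau> ?u - \<tau> ?v) + (t 0 - s 0) * (\<tau> ?v - a)"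
        by (simp add: rcone_def algebra_simps)
      then show ?thesis using 1 2 e P(2) by (simp add: dist_real_def)
    qed
  qed
qed

text \<open>The segment between two points is cut into \<open>Suc m\<close> steps shorter than the
  modulus for 1. The number of steps depends on the modulus alone, which makes the bound uniform
  over a family that may itself be unbounded.\<close>

lemma equicont_bounded_spread:
  fixes F :: "((nat \<Rightarrow> real) \<Rightarrow> real) set"
  assumes F: "equicont n F"
  obtains m :: nat where
    "\<And>f s t. f \<in> F \<Longrightarrow> s \<in> standard_simplex n \<Longrightarrow> t \<in> standard_simplex n \<Longrightarrow> \<bar>f s - f t\<bar> \<le> real m"
proof -
  obtain d where d: "d > 0"
    "\<And>f s t. f \<in> F \<Longrightarrow> s \<in> standard_simplex n \<Longrightarrow> t \<in> standard_simplex n \<Longrightarrow>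
       coord_near d s t \<Longrightarrow> dist (f s) (f t) < 1"
    by (rule equicontD[OF F zero_less_one]) (rule that)
  obtain m where m: "inverse (real (Suc m)) < d" using reals_Archimedean[OF d(1)] by blast
  have "\<bar>f s - f t\<bar> \<le> real (Suc m)"
    if f: "f \<in> F" and s: "s \<in> standard_simplex n" and t: "t \<in> standard_simplex n" for f s t
  proof -
    define q where "q k = (\<lambda>i. (1 - real k / Suc m) * s i + (real k / Suc m) * t i)" for k :: nat
    have q: "q k \<in> standard_simplex n" if "k \<le> Suc m" for k
      unfolding q_def by (rule convex_standard_simplex[OF s t]) (use that in \<open>auto simp: field_simps\<close>)
    have near: "coord_near d (q (Suc k)) (q k)" for k
      unfolding coord_near_def
    proof
      fix i
      have "\<bar>t i - s i\<bar> \<le> 1"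
        using standard_simplex_le_1[OF s, of i] standard_simplex_le_1[OF t, of i] by linarith
      moreover have "q (Suc k) i - q k i = inverse (real (Suc m)) * (t i - s i)"
      proof -
        have "real (Suc k) / Suc m = real k / Suc m + inverse (real (Suc m))"
          by (simp add: inverse_eq_divide add_divide_distrib)
        then show ?thesis unfolding q_def by (simp only:) (simp only: algebra_simps)
      qed
      ultimately have "\<bar>q (Suc k) i - q k i\<bar> \<le> inverse (real (Suc m)) * 1"
        by (simp only: abs_mult) (intro mult_mono, auto)
      then show "\<bar>q (Suc k) i - q k i\<bar> < d" using m by simp
    qed
    have "\<bar>f (q k) - f (q 0)\<bar> \<le> real k" if "k \<le> Suc m" for k
      using that
    proof (induction k)
      case (Suc k)
      have "dist (f (q (Suc k))) (f (q k)) < 1" using d(2)[OF f q q near] Suc.prems by simp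
      then show ?case using Suc by (auto simp: dist_real_def)
    qed simp
    from this[of "Suc m"] have "\<bar>f (q (Suc m)) - f (q 0)\<bar> \<le> real (Suc m)" by simp
    moreover have "q 0 = s" "q (Suc m) = t" unfolding q_def by simp_all
    ultimately show ?thesis by (simp add: abs_minus_commute)
  qed
  then show ?thesis by (rule that)
qed

subsection \<open>Faces\<close>

lemma singular_face_singular_face:
  assumes "k < i" "i \<le> Suc m" "m \<ge> 1"
  shows "singular_face m k (singular_face (Suc m) i \<sigma>) = singular_face m (i - 1) (singular_face (Suc m) k \<sigma>)"
proof
  fix x :: "nat \<Rightarrow> real"
  have "simplical_face i (simplical_face k x) = simplical_face k (simplical_face (i - 1) x)"
    using assms(1) by (auto simp: simplical_face_def fun_eq_iff)
  then show "singular_face m k (singular_face (Suc m) i \<sigma>) x = singular_face m (i - 1) (singular_face (Suc m) k \<sigma>) x"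
    using assms by (auto simp: singular_face_def simplical_face_in_standard_simplex)
qed

text \<open>\<open>\<partial>\<partial> = 0\<close>, tested against an arbitrary function
  \<open>G\<close>.\<close>

lemma sum_faces_faces_eq_0:
  fixes G :: "_ \<Rightarrow> real"
  assumes "m \<ge> 1"
  shows "(\<Sum>i\<le>Suc m. \<Sum>k\<le>m. (-1) ^ (i + k) * G (singular_face m k (singular_face (Suc m) i \<sigma>))) = 0"
proof -
  define f where "f = (\<lambda>(i, k). (-1) ^ (i + k) * G (singular_face m k (singular_face (Suc m) i \<sigma>)))"
  define A where "A = {(i, k). i \<le> Suc m \<and> k \<le> m \<and> k < i}"
  define B where "B = {(i, k). i \<le> Suc m \<and> k \<le> m \<and> i \<le> k}"
  have fin: "finite ({..Suc m} \<times> {..m})" by simp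
  have AB: "A \<inter> B = {}" "A \<union> B = {..Suc m} \<times> {..m}" by (auto simp: A_def B_def)
  have finAB: "finite A" "finite B" using fin AB(2) by (metis finite_Un)+
  have "sum f A = sum (\<lambda>x. - f x) B"
  \<comment> \<open>The double face with \<open>k < i\<close> cancels against the one taken in the
    order \<open>(k, i - 1)\<close>, whose sign is opposite.\<close>
  proof (rule sum.reindex_bij_witness[where i = "\<lambda>(k, j). (Suc j, k)" and j = "\<lambda>(i, k). (k, i - 1)"])
    fix x assume "x \<in> A"
    then obtain i k where x: "x = (i, k)" "i \<le> Suc m" "k < i" by (auto simp: A_def)
    then obtain j where i: "i = Suc j" by (cases i) auto
    show "- f (case x of (i, k) \<Rightarrow> (k, i - 1)) = f x"
      using singular_face_singular_face[OF x(3,2) assms, of \<sigma>] by (simp add: x f_def i add.commute)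
  qed (auto simp: A_def B_def)
  then have "sum f ({..Suc m} \<times> {..m}) = 0"
    using sum.union_disjoint[OF finAB AB(1), of f] AB(2) by (simp add: sum_negf)
  then show ?thesis by (simp add: sum.cartesian_product f_def)
qed

subsection \<open>Images of the half-line\<close>

text \<open>\<open>lift\<close> is the substitute for continuity of the inverse of \<open>p\<close>:
  closeness in \<open>W\<close> says nothing about parameters, but a connected set of small diameter
  has a small set of parameters. Uniform continuity of \<open>p\<close> makes the way back preserve
  equicontinuity, and compactness of \<open>W\<close> makes Ascoli applicable.\<close>

locale half_line_image =
  fixes p :: "real \<Rightarrow> 'a::metric_space" and W :: "'a set"
  assumes W_eq: "W = p ` {0..}" and inj: "inj_on p {0..}"
    and uc: "uniformly_continuous_on {0..} p" and compact_W: "compact W"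
    and lift: "\<And>e. e > 0 \<Longrightarrow> \<exists>d>0. \<forall>T\<subseteq>{0..}. connected (p ` T) \<longrightarrow>
      (\<forall>s\<in>T. \<forall>u\<in>T. dist (p s) (p u) < d) \<longrightarrow> (\<forall>s\<in>T. \<forall>u\<in>T. dist s u < e)"
begin

abbreviation X :: "'a topology" where "X \<equiv> top_of_set W"
abbreviation S :: "nat \<Rightarrow> ((nat \<Rightarrow> real) \<Rightarrow> 'a) set" where "S n \<equiv> singular_simplex_set n X"

definition g :: "'a \<Rightarrow> real" where "g = inv_into {0..} p"

lemma g_p [simp]: "x \<ge> 0 \<Longrightarrow> g (p x) = x"
  unfolding g_def using inj by simp

lemma g_nonneg: "w \<in> W \<Longrightarrow> g w \<ge> 0"
  unfolding W_eq by auto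

lemma p_g [simp]: "w \<in> W \<Longrightarrow> p (g w) = w"
  unfolding W_eq by auto

lemma continuous_on_p: "continuous_on {0..} p"
  by (rule uniformly_continuous_imp_continuous[OF uc])

lemma S_iff: "\<sigma> \<in> S n \<longleftrightarrow> \<sigma> \<in> extensional (standard_simplex n) \<and>
    \<sigma> ` standard_simplex n \<subseteq> W \<and> equicont n {\<sigma>}"
  by (simp add: singular_simplex_top_of_set)

lemma S_in_W: "\<sigma> \<in> S n \<Longrightarrow> t \<in> standard_simplex n \<Longrightarrow> \<sigma> t \<in> W"
  unfolding S_iff by auto

lemma S_continuous_on: "\<sigma> \<in> S n \<Longrightarrow> continuous_on (standard_simplex n) \<sigma>"
  by (simp add: singular_simplex_def euclidean_product_topology continuous_map_in_subtopology)

lemma face_in_S: "\<sigma> \<in> S (Suc n) \<Longrightarrow> i \<le> Suc n \<Longrightarrow> singular_face (Suc n) i \<sigma> \<in> S n"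
  using singular_simplex_singular_face[of "Suc n" X \<sigma> i] by simp

text \<open>A simplex maps the straight segment between two near points to a connected set of small
  diameter, to which \<open>lift\<close> applies. The modulus obtained is common to the whole
  family.\<close>

lemma equicont_lift:
  assumes FS: "F \<subseteq> S n" and F: "equicont n F"
  shows "equicont n ((\<lambda>\<sigma>. g \<circ> \<sigma>) ` F)"
  unfolding equicont_def
proof (intro allI impI)
  fix e :: real assume "e > 0"
  then obtain d where d: "d > 0" "\<And>T. T \<subseteq> {0..} \<Longrightarrow> connected (p ` T) \<Longrightarrow>
      (\<forall>s\<in>T. \<forall>u\<in>T. dist (p s) (p u) < d) \<Longrightarrow> (\<forall>s\<in>T. \<forall>u\<in>T. dist s u < e)"
    using lift[of e] by metis
  obtain d' where d': "d' > 0"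
    "\<And>f s t. f \<in> F \<Longrightarrow> s \<in> standard_simplex n \<Longrightarrow> t \<in> standard_simplex n \<Longrightarrow>
       coord_near d' s t \<Longrightarrow> dist (f s) (f t) < d"
    by (rule equicontD[OF F d(1)]) (rule that)
  have "dist (g (\<sigma> s)) (g (\<sigma> t)) < e"
    if \<sigma>: "\<sigma> \<in> F" and s: "s \<in> standard_simplex n" and t: "t \<in> standard_simplex n"
      and near: "coord_near d' s t" for \<sigma> s t
  proof -
    define q where "q = (\<lambda>u i. (1 - u) * s i + u * t i :: real)"
    have q: "q u \<in> standard_simplex n" if "u \<in> {0..1}" for u
      unfolding q_def using convex_standard_simplex[OF s t] that by simp
    have qn: "coord_near d' (q u) (q v)" if "u \<in> {0..1}" "v \<in> {0..1}" for u v
      unfolding coord_near_def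
    proof
      fix i
      have "q u i - q v i = (v - u) * (s i - t i)" by (simp add: q_def algebra_simps)
      then have "\<bar>q u i - q v i\<bar> = \<bar>v - u\<bar> * \<bar>s i - t i\<bar>" by (simp add: abs_mult)
      also have "\<dots> \<le> \<bar>s i - t i\<bar>" using that by (intro mult_left_le_one_le) auto
      also have "\<dots> < d'" using near by (simp add: coord_near_def)
      finally show "\<bar>q u i - q v i\<bar> < d'" .
    qed
    have \<sigma>S: "\<sigma> \<in> S n" using \<sigma> FS by blast
    have qW: "\<sigma> (q u) \<in> W" if "u \<in> {0..1}" for u by (rule S_in_W[OF \<sigma>S q[OF that]])
    define T where "T = (\<lambda>u. g (\<sigma> (q u))) ` {0..1}"
    have "continuous_on {0..1} q"
      unfolding q_def by (intro continuous_on_coordinatewise_then_product continuous_intros)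
    moreover have "continuous_on (q ` {0..1}) \<sigma>"
      by (rule continuous_on_subset[OF S_continuous_on[OF \<sigma>S]]) (use q in blast)
    ultimately have "continuous_on {0..1} (\<lambda>u. \<sigma> (q u))"
      using continuous_on_compose2[of "q ` {0..1}" \<sigma> "{0..1}" q] by blast
    then have "connected ((\<lambda>u. \<sigma> (q u)) ` {0..1})" by (rule connected_continuous_image) simp
    moreover have pT: "p ` T = (\<lambda>u. \<sigma> (q u)) ` {0..1}"
      unfolding T_def image_image using qW by (intro image_cong) auto
    ultimately have "connected (p ` T)" by simp
    moreover have "T \<subseteq> {0..}" unfolding T_def using g_nonneg qW by auto
    moreover have "\<forall>s\<in>T. \<forall>u\<in>T. dist (p s) (p u) < d"
      unfolding T_def using d'(2)[OF \<sigma> q q qn] qW by auto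
    ultimately have "\<forall>s\<in>T. \<forall>u\<in>T. dist s u < e" using d(2) by blast
    moreover have "g (\<sigma> s) \<in> T" unfolding T_def by (rule image_eqI[of _ _ 0]) (auto simp: q_def)
    moreover have "g (\<sigma> t) \<in> T" unfolding T_def by (rule image_eqI[of _ _ 1]) (auto simp: q_def)
    ultimately show ?thesis by blast
  qed
  then show "\<exists>d>0. \<forall>f\<in>(\<lambda>\<sigma>. g \<circ> \<sigma>) ` F. \<forall>s\<in>standard_simplex n. \<forall>t\<in>standard_simplex n.
          coord_near d s t \<longrightarrow> dist (f s) (f t) < e"
    using d'(1) by (intro exI[of _ d']) auto
qed

section \<open>Cones in the image of the half-line\<close>

definition wcone :: "nat \<Rightarrow> real \<Rightarrow> ((nat \<Rightarrow> real) \<Rightarrow> 'a) \<Rightarrow> (nat \<Rightarrow> real) \<Rightarrow> 'a" where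
  "wcone n a \<sigma> = restrict (\<lambda>t. p (rcone a (g \<circ> \<sigma>) t)) (standard_simplex (Suc n))"

lemma rcone_lift_nonneg:
  assumes "\<sigma> \<in> S n" "a \<ge> 0" "t \<in> standard_simplex (Suc n)"
  shows "rcone a (g \<circ> \<sigma>) t \<ge> 0"
  using assms(3,2) by (rule rcone_nonneg) (use g_nonneg S_in_W[OF assms(1)] in auto)

lemma wcone_in_W:
  assumes "\<sigma> \<in> S n" "a \<ge> 0" "t \<in> standard_simplex (Suc n)"
  shows "wcone n a \<sigma> t \<in> W"
  using rcone_lift_nonneg[OF assms] assms(3) unfolding W_eq wcone_def by auto

lemma g_wcone:
  assumes "\<sigma> \<in> S n" "a \<ge> 0" "t \<in> standard_simplex (Suc n)"
  shows "g (wcone n a \<sigma> t) = rcone a (g \<circ> \<sigma>) t"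
  using rcone_lift_nonneg[OF assms] assms(3) by (simp add: wcone_def)

text \<open>The apexes may be unbounded; only their distance to the bases is controlled by
  \<open>D\<close>. This is what permits apexes that move along with the simplices.\<close>

lemma equicont_wcone:
  assumes PS: "\<And>a \<sigma>. (a, \<sigma>) \<in> P \<Longrightarrow> a \<ge> 0 \<and> \<sigma> \<in> S n" and P: "equicont n (snd ` P)"
    and D: "\<And>a \<sigma> t. (a, \<sigma>) \<in> P \<Longrightarrow> t \<in> standard_simplex n \<Longrightarrow> \<bar>g (\<sigma> t) - a\<bar> \<le> D"
  shows "equicont (Suc n) ((\<lambda>(a, \<sigma>). wcone n a \<sigma>) ` P)"
proof -
  let ?Q = "(\<lambda>(a, \<sigma>). (a, g \<circ> \<sigma>)) ` P"
  have "equicont n ((\<lambda>\<sigma>. g \<circ> \<sigma>) ` snd ` P)"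
    using PS by (intro equicont_lift P) auto
  moreover have "snd ` ?Q = (\<lambda>\<sigma>. g \<circ> \<sigma>) ` snd ` P" by force
  ultimately have "equicont n (snd ` ?Q)" by simp
  then have "equicont (Suc n) ((\<lambda>(a, \<tau>). rcone a \<tau>) ` ?Q)"
    by (rule equicont_rcone[where D = D]) (use D in auto)
  then have "equicont (Suc n) ((\<lambda>f. p \<circ> f) ` (\<lambda>(a, \<tau>). rcone a \<tau>) ` ?Q)"
  proof (rule equicont_uniformly_continuous[OF _ uc])
    fix f t assume f: "f \<in> (\<lambda>(a, \<tau>). rcone a \<tau>) ` ?Q" and t: "t \<in> standard_simplex (Suc n)"
    then obtain a \<sigma> where "(a, \<sigma>) \<in> P" "f = rcone a (g \<circ> \<sigma>)" by auto
    then show "f t \<in> {0..}" using rcone_lift_nonneg[OF _ _ t] PS by simp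
  qed
  then show ?thesis
  proof (rule equicont_cong)
    fix f assume "f \<in> (\<lambda>(a, \<sigma>). wcone n a \<sigma>) ` P"
    then obtain a \<sigma> where P: "(a, \<sigma>) \<in> P" "f = wcone n a \<sigma>" by auto
    have "p \<circ> rcone a (g \<circ> \<sigma>) \<in> (\<lambda>f. p \<circ> f) ` (\<lambda>(a, \<tau>). rcone a \<tau>) ` ?Q"
    proof (intro imageI)
      have "(a, g \<circ> \<sigma>) \<in> ?Q" using P(1) by (rule rev_image_eqI) simp
      then show "rcone a (g \<circ> \<sigma>) \<in> (\<lambda>(a, \<tau>). rcone a \<tau>) ` ?Q" by (rule rev_image_eqI) simp
    qed
    moreover have "\<forall>t\<in>standard_simplex (Suc n). f t = (p \<circ> rcone a (g \<circ> \<sigma>)) t"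
      using P(2) by (simp add: wcone_def)
    ultimately show "\<exists>f'\<in>(\<lambda>f. p \<circ> f) ` (\<lambda>(a, \<tau>). rcone a \<tau>) ` ?Q. \<forall>t\<in>standard_simplex (Suc n). f t = f' t"
      by (intro bexI[of _ "p \<circ> rcone a (g \<circ> \<sigma>)"])
  qed
qed

text \<open>The lift of a single simplex is bounded, so any fixed apex is at bounded distance from
  it.\<close>

lemma wcone_in_S:
  assumes \<sigma>: "\<sigma> \<in> S n" and a: "a \<ge> 0"
  shows "wcone n a \<sigma> \<in> S (Suc n)"
proof -
  have "equicont n {\<sigma>}" using \<sigma> S_iff by blast
  then have "equicont n ((\<lambda>\<sigma>. g \<circ> \<sigma>) ` {\<sigma>})" using \<sigma> by (intro equicont_lift) auto
  then obtain m :: nat where m: "\<And>f s t. f \<in> (\<lambda>\<sigma>. g \<circ> \<sigma>) ` {\<sigma>} \<Longrightarrow> s \<in> standard_simplex n \<Longrightarrow>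
      t \<in> standard_simplex n \<Longrightarrow> \<bar>f s - f t\<bar> \<le> real m"
    by (rule equicont_bounded_spread) (rule that)
  obtain v where v: "v \<in> standard_simplex n" using nonempty_standard_simplex by blast
  have b: "\<bar>g (\<sigma> t) - a\<bar> \<le> real m + \<bar>g (\<sigma> v) - a\<bar>" if "t \<in> standard_simplex n" for t
    using m[OF _ that v, of "g \<circ> \<sigma>"] by auto
  have "equicont (Suc n) ((\<lambda>(a, \<sigma>). wcone n a \<sigma>) ` {(a, \<sigma>)})"
    by (rule equicont_wcone[where D = "real m + \<bar>g (\<sigma> v) - a\<bar>"])
       (use a \<sigma> b \<open>equicont n {\<sigma>}\<close> in auto)
  then show ?thesis
    using wcone_in_W[OF \<sigma> a] unfolding S_iff by (auto simp: wcone_def)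
qed

lemma face_0_wcone:
  assumes \<sigma>: "\<sigma> \<in> S n"
  shows "singular_face (Suc n) 0 (wcone n a \<sigma>) = \<sigma>"
proof
  fix t
  show "singular_face (Suc n) 0 (wcone n a \<sigma>) t = \<sigma> t"
  proof (cases "t \<in> standard_simplex n")
    case True
    have "simplical_face 0 t \<in> standard_simplex (Suc n)"
      using simplical_face_in_standard_simplex[of "Suc n" 0 t] True by simp
    moreover have "rcone a (g \<circ> \<sigma>) (simplical_face 0 t) = g (\<sigma> t)"
      by (simp add: rcone_def simplical_face_def)
    ultimately show ?thesis using True S_in_W[OF \<sigma> True] by (simp add: singular_face_def wcone_def)
  next
    case False
    then show ?thesis using \<sigma> unfolding S_iff by (auto simp: singular_face_def extensional_def)
  qed
qed

lemma face_Suc_wcone: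
  assumes "k \<le> Suc n"
  shows "singular_face (Suc (Suc n)) (Suc k) (wcone (Suc n) a \<sigma>) = wcone n a (singular_face (Suc n) k \<sigma>)"
proof
  fix t :: "nat \<Rightarrow> real"
  show "singular_face (Suc (Suc n)) (Suc k) (wcone (Suc n) a \<sigma>) t = wcone n a (singular_face (Suc n) k \<sigma>) t"
  proof (cases "t \<in> standard_simplex (Suc n)")
    case True
    let ?f = "simplical_face (Suc k) t"
    have f: "?f \<in> standard_simplex (Suc (Suc n))"
      using simplical_face_in_standard_simplex[of "Suc (Suc n)" "Suc k" t] True assms by simp
    have f0: "?f 0 = t 0" by (simp add: simplical_face_def)
    have tail: "(\<lambda>i. ?f (Suc i) / (1 - t 0)) = simplical_face k (\<lambda>i. t (Suc i) / (1 - t 0))"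
      by (auto simp: simplical_face_def fun_eq_iff)
    have "rcone a (g \<circ> \<sigma>) ?f = rcone a (g \<circ> singular_face (Suc n) k \<sigma>) t"
    proof (cases "t 0 = 1")
      case False
      then have "(\<lambda>i. t (Suc i) / (1 - t 0)) \<in> standard_simplex n"
        by (rule tail_in_standard_simplex[OF True])
      then show ?thesis unfolding rcone_def f0 tail by (simp add: singular_face_def)
    qed (simp add: rcone_def f0)
    then show ?thesis using True f by (simp add: singular_face_def wcone_def)
  qed (simp add: singular_face_def wcone_def)
qed

text \<open>In the cone over a point, the face opposite to the base vertex is the apex, not a cone
  over a face. This exception is the source of the leftover edges in degree one.\<close>

lemma face_1_wcone_0:
  "singular_face (Suc 0) (Suc 0) (wcone 0 a \<sigma>) = restrict (\<lambda>_. p a) (standard_simplex 0)"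
proof
  fix t :: "nat \<Rightarrow> real"
  show "singular_face (Suc 0) (Suc 0) (wcone 0 a \<sigma>) t = restrict (\<lambda>_. p a) (standard_simplex 0) t"
  proof (cases "t \<in> standard_simplex 0")
    case True
    then have "t 0 = 1" by (simp add: standard_simplex_def)
    moreover have "simplical_face (Suc 0) t \<in> standard_simplex (Suc 0)"
      using simplical_face_in_standard_simplex[of "Suc 0" "Suc 0" t] True by simp
    moreover have "simplical_face (Suc 0) t 0 = t 0" by (simp add: simplical_face_def)
    ultimately show ?thesis using True by (simp add: singular_face_def wcone_def rcone_def)
  qed (simp add: singular_face_def)
qed

subsection \<open>Measurability\<close>

definition simplex_borel :: "nat \<Rightarrow> ((nat \<Rightarrow> real) \<Rightarrow> 'a) measure" where
  "simplex_borel n = sigma (S n) {U. openin (compact_open_top n X) U}"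

lemma opens_subset: "{U. openin (compact_open_top n X) U} \<subseteq> Pow (S n)"
  using openin_subset[of "compact_open_top n X"] by auto

lemma space_simplex_borel [simp]: "space (simplex_borel n) = S n"
  unfolding simplex_borel_def by (rule space_measure_of[OF opens_subset])

lemma sets_simplex_borel: "sets (simplex_borel n) = MT_borel n X"
  unfolding simplex_borel_def MT_borel_def by (rule sets_measure_of[OF opens_subset])

lemma open_in_sets_simplex_borel: "openin (compact_open_top n X) U \<Longrightarrow> U \<in> sets (simplex_borel n)"
  unfolding sets_simplex_borel MT_borel_def by auto

lemma closed_in_sets_simplex_borel:
  assumes "C \<subseteq> S n" "openin (compact_open_top n X) (S n - C)"
  shows "C \<in> sets (simplex_borel n)"
proof -
  have "space (simplex_borel n) - (S n - C) \<in> sets (simplex_borel n)" by (rule sets.compl_sets[OF open_in_sets_simplex_borel[OF assms(2)]])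
  moreover have "space (simplex_borel n) - (S n - C) = C" using assms(1) by auto
  ultimately show ?thesis by simp
qed

lemma measurable_simplex_borel:
  assumes "\<And>\<sigma>. \<sigma> \<in> space M \<Longrightarrow> f \<sigma> \<in> S n"
    and "\<And>U. openin (compact_open_top n X) U \<Longrightarrow> f -` U \<inter> space M \<in> sets M"
  shows "f \<in> measurable M (simplex_borel n)"
  unfolding simplex_borel_def by (rule measurable_measure_of) (use assms opens_subset in auto)

lemma measurable_face:
  assumes "i \<le> Suc n"
  shows "singular_face (Suc n) i \<in> measurable (simplex_borel (Suc n)) (simplex_borel n)"
proof (rule measurable_simplex_borel)
  fix U assume U: "openin (compact_open_top n X) U"
  have "openin (compact_open_top (Suc n) X) (singular_face (Suc n) i -` U \<inter> S (Suc n))"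
    unfolding openin_compact_open_iff
  proof (intro conjI ballI)
    fix \<sigma> assume \<sigma>: "\<sigma> \<in> singular_face (Suc n) i -` U \<inter> S (Suc n)"
    then obtain e where e: "e > 0" "\<And>\<tau>. \<tau> \<in> S n \<Longrightarrow> sup_near n e \<tau> (singular_face (Suc n) i \<sigma>) \<Longrightarrow> \<tau> \<in> U"
      using U unfolding openin_compact_open_iff by blast
    have "singular_face (Suc n) i \<tau> \<in> U" if "\<tau> \<in> S (Suc n)" "sup_near (Suc n) e \<tau> \<sigma>" for \<tau>
    proof (rule e(2)[OF face_in_S[OF that(1) assms]])
      show "sup_near n e (singular_face (Suc n) i \<tau>) (singular_face (Suc n) i \<sigma>)"
        using that(2) simplical_face_in_standard_simplex[of "Suc n" i] assms
        by (simp add: sup_near_def singular_face_def)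
    qed
    then show "\<exists>e>0. \<forall>\<tau>\<in>S (Suc n). sup_near (Suc n) e \<tau> \<sigma> \<longrightarrow> \<tau> \<in> singular_face (Suc n) i -` U \<inter> S (Suc n)"
      using e(1) by (intro exI[of _ e]) auto
  qed auto
  then show "singular_face (Suc n) i -` U \<inter> space (simplex_borel (Suc n)) \<in> sets (simplex_borel (Suc n))"
    using open_in_sets_simplex_borel by simp
qed (use face_in_S[OF _ assms] in simp)

text \<open>The lift is lower semicontinuous: the points with parameter at most \<open>c\<close>
  form the compact, hence closed, set parametrised by \<open>{0..c}\<close>.\<close>

lemma openin_lift_greater:
  assumes t: "t \<in> standard_simplex n"
  shows "openin (compact_open_top n X) {\<sigma> \<in> S n. g (\<sigma> t) > c}"
  unfolding openin_compact_open_iff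
proof (intro conjI ballI)
  fix \<sigma> assume \<sigma>: "\<sigma> \<in> {\<sigma> \<in> S n. g (\<sigma> t) > c}"
  have "closed (p ` {0..c})"
    by (intro compact_imp_closed compact_continuous_image continuous_on_subset[OF continuous_on_p]) auto
  moreover have "\<sigma> t \<notin> p ` {0..c}" using \<sigma> by auto
  ultimately obtain e where e: "e > 0" "ball (\<sigma> t) e \<subseteq> - p ` {0..c}"
    using openE[of "- p ` {0..c}" "\<sigma> t"] by (auto simp: closed_def)
  have "g (\<tau> t) > c" if "\<tau> \<in> S n" "sup_near n e \<tau> \<sigma>" for \<tau>
  proof (rule ccontr)
    assume "\<not> g (\<tau> t) > c"
    then have "\<tau> t \<in> p ` {0..c}"
      using S_in_W[OF that(1) t] g_nonneg by (intro image_eqI[of _ _ "g (\<tau> t)"]) auto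
    moreover have "\<tau> t \<in> ball (\<sigma> t) e" using that(2) t by (simp add: sup_near_def dist_commute)
    ultimately show False using e(2) by auto
  qed
  then show "\<exists>e>0. \<forall>\<tau>\<in>S n. sup_near n e \<tau> \<sigma> \<longrightarrow> \<tau> \<in> {\<sigma> \<in> S n. g (\<sigma> t) > c}"
    using e(1) by blast
qed auto

lemma lift_le_in_sets:
  assumes "t \<in> standard_simplex n"
  shows "{\<sigma> \<in> S n. g (\<sigma> t) \<le> c} \<in> sets (simplex_borel n)"
proof (rule closed_in_sets_simplex_borel)
  have "S n - {\<sigma> \<in> S n. g (\<sigma> t) \<le> c} = {\<sigma> \<in> S n. g (\<sigma> t) > c}" by auto
  then show "openin (compact_open_top n X) (S n - {\<sigma> \<in> S n. g (\<sigma> t) \<le> c})"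
    using openin_lift_greater[OF assms] by simp
qed auto

text \<open>These closed sets exhaust \<open>S n\<close> as \<open>c\<close> runs through the
  naturals, since the lift of each simplex is bounded; on each of them taking the lift is
  continuous.\<close>

definition lift_bounded :: "nat \<Rightarrow> real \<Rightarrow> ((nat \<Rightarrow> real) \<Rightarrow> 'a) set" where
  "lift_bounded n c = {\<sigma> \<in> S n. \<forall>t\<in>standard_simplex n. g (\<sigma> t) \<le> c}"

lemma lift_bounded_in_sets: "lift_bounded n c \<in> sets (simplex_borel n)"
proof (rule closed_in_sets_simplex_borel)
  have "S n - lift_bounded n c = (\<Union>t\<in>standard_simplex n. {\<sigma> \<in> S n. g (\<sigma> t) > c})"
    by (auto simp: lift_bounded_def not_le)
  then show "openin (compact_open_top n X) (S n - lift_bounded n c)"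
    using openin_lift_greater by auto
qed (auto simp: lift_bounded_def)

lemma S_eq_Union_lift_bounded: "S n = (\<Union>c::nat. lift_bounded n (real c))"
proof
  show "S n \<subseteq> (\<Union>c::nat. lift_bounded n (real c))"
  proof
    fix \<sigma> assume \<sigma>: "\<sigma> \<in> S n"
    then have "equicont n ((\<lambda>\<sigma>. g \<circ> \<sigma>) ` {\<sigma>})" using S_iff by (intro equicont_lift) auto
    then obtain m :: nat where m: "\<And>f s t. f \<in> (\<lambda>\<sigma>. g \<circ> \<sigma>) ` {\<sigma>} \<Longrightarrow> s \<in> standard_simplex n \<Longrightarrow>
        t \<in> standard_simplex n \<Longrightarrow> \<bar>f s - f t\<bar> \<le> real m"
      by (rule equicont_bounded_spread) (rule that)
    obtain v where v: "v \<in> standard_simplex n" using nonempty_standard_simplex by blast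
    have "g (\<sigma> t) \<le> real (m + nat \<lceil>g (\<sigma> v)\<rceil>)" if "t \<in> standard_simplex n" for t
      using m[OF _ that v, of "g \<circ> \<sigma>"] by simp linarith
    then show "\<sigma> \<in> (\<Union>c::nat. lift_bounded n (real c))" using \<sigma> unfolding lift_bounded_def by blast
  qed
qed (auto simp: lift_bounded_def)

text \<open>The inverse of \<open>p\<close> is discontinuous, but its restriction to each compact set
  \<open>p ` {0..c}\<close> is continuous.\<close>

lemma measurable_wcone:
  assumes a: "a \<ge> 0"
  shows "wcone n a \<in> measurable (simplex_borel n) (simplex_borel (Suc n))"
proof (rule measurable_simplex_borel)
  fix U assume U: "openin (compact_open_top (Suc n) X) U"
  \<comment> \<open>It suffices that the preimage is relatively open in each closed piece, because
    countably many pieces cover the space.\<close>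
  have "\<exists>V. openin (compact_open_top n X) V \<and> wcone n a -` U \<inter> lift_bounded n c = lift_bounded n c \<inter> V" for c
  proof -
    have "\<exists>d>0. \<forall>\<tau>\<in>lift_bounded n c. sup_near n d \<tau> \<sigma> \<longrightarrow> wcone n a \<tau> \<in> U"
      if \<sigma>: "\<sigma> \<in> lift_bounded n c" "wcone n a \<sigma> \<in> U" for \<sigma>
    proof -
      have \<sigma>S: "\<sigma> \<in> S n" using \<sigma> by (simp add: lift_bounded_def)
      obtain e where e: "e > 0" "\<And>\<tau>. \<tau> \<in> S (Suc n) \<Longrightarrow> sup_near (Suc n) e \<tau> (wcone n a \<sigma>) \<Longrightarrow> \<tau> \<in> U"
        using U \<sigma>(2) unfolding openin_compact_open_iff by blast
      obtain e1 where e1: "e1 > 0" "\<And>x y. x \<ge> 0 \<Longrightarrow> y \<ge> 0 \<Longrightarrow> dist x y < e1 \<Longrightarrow> dist (p x) (p y) < e"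
        using uc e(1) unfolding uniformly_continuous_on_def by (metis atLeast_iff)
      have "continuous_on (p ` {0..c}) g"
        by (rule continuous_on_inv) (auto intro: continuous_on_subset[OF continuous_on_p])
      then have "uniformly_continuous_on (p ` {0..c}) g"
        by (rule compact_uniformly_continuous)
           (intro compact_continuous_image continuous_on_subset[OF continuous_on_p]; auto)
      then obtain d where d: "d > 0" "\<And>x y. x \<in> p ` {0..c} \<Longrightarrow> y \<in> p ` {0..c} \<Longrightarrow> dist x y < d \<Longrightarrow> dist (g x) (g y) < e1"
        using e1(1) unfolding uniformly_continuous_on_def by metis
      have inp: "\<rho> t \<in> p ` {0..c}" if "\<rho> \<in> lift_bounded n c" "t \<in> standard_simplex n" for \<rho> t
        using that S_in_W[of \<rho> n t] g_nonneg[of "\<rho> t"]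
        by (intro image_eqI[of _ _ "g (\<rho> t)"]) (auto simp: lift_bounded_def)
      have "wcone n a \<tau> \<in> U" if \<tau>: "\<tau> \<in> lift_bounded n c" "sup_near n d \<tau> \<sigma>" for \<tau>
      proof (rule e(2))
        have \<tau>S: "\<tau> \<in> S n" using \<tau> by (simp add: lift_bounded_def)
        show "wcone n a \<tau> \<in> S (Suc n)" by (rule wcone_in_S[OF \<tau>S a])
        show "sup_near (Suc n) e (wcone n a \<tau>) (wcone n a \<sigma>)"
          unfolding sup_near_def
        proof
          fix t assume t: "t \<in> standard_simplex (Suc n)"
          have "\<bar>rcone a (g \<circ> \<tau>) t - rcone a (g \<circ> \<sigma>) t\<bar> < e1"
          proof (rule rcone_close[OF t])
            fix s assume s: "s \<in> standard_simplex n"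
            show "\<bar>(g \<circ> \<tau>) s - (g \<circ> \<sigma>) s\<bar> < e1"
              using d(2)[OF inp[OF \<tau>(1) s] inp[OF \<sigma>(1) s]] \<tau>(2) s by (simp add: sup_near_def dist_real_def)
          qed
          then show "dist (wcone n a \<tau> t) (wcone n a \<sigma> t) < e"
            using e1(2)[OF rcone_lift_nonneg[OF \<tau>S a t] rcone_lift_nonneg[OF \<sigma>S a t]] t
            by (simp add: wcone_def dist_real_def)
        qed
      qed
      then show ?thesis using d(1) by blast
    qed
    then obtain d where d: "\<And>\<sigma>. \<sigma> \<in> wcone n a -` U \<inter> lift_bounded n c \<Longrightarrow> d \<sigma> > 0"
      "\<And>\<sigma> \<tau>. \<sigma> \<in> wcone n a -` U \<inter> lift_bounded n c \<Longrightarrow> \<tau> \<in> lift_bounded n c \<Longrightarrow> sup_near n (d \<sigma>) \<tau> \<sigma> \<Longrightarrow> wcone n a \<tau> \<in> U"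
      by (metis IntE vimageE)
    \<comment> \<open>The radii depend on \<open>\<sigma>\<close>; the balls are open in all of
      \<open>S n\<close>, and their union cuts the preimage out of the piece.\<close>
    define V where "V = (\<Union>\<sigma>\<in>wcone n a -` U \<inter> lift_bounded n c. {\<tau> \<in> S n. \<exists>r<d \<sigma>. sup_near n r \<tau> \<sigma>})"
    have "openin (compact_open_top n X) V"
      unfolding V_def using openin_sup_ball[of _ n W] by (intro openin_Union ballI) (auto simp: lift_bounded_def)
    moreover have "wcone n a -` U \<inter> lift_bounded n c \<subseteq> lift_bounded n c \<inter> V"
    proof
      fix \<sigma> assume \<sigma>: "\<sigma> \<in> wcone n a -` U \<inter> lift_bounded n c"
      then have "sup_near n (d \<sigma> / 2) \<sigma> \<sigma>" "d \<sigma> / 2 < d \<sigma>" using d(1)[OF \<sigma>] by (auto simp: sup_near_def)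
      moreover have "\<sigma> \<in> S n" using \<sigma> by (simp add: lift_bounded_def)
      ultimately have "\<sigma> \<in> {\<tau> \<in> S n. \<exists>r<d \<sigma>. sup_near n r \<tau> \<sigma>}" by blast
      then show "\<sigma> \<in> lift_bounded n c \<inter> V" using \<sigma> unfolding V_def by blast
    qed
    moreover have "lift_bounded n c \<inter> V \<subseteq> wcone n a -` U \<inter> lift_bounded n c"
    proof
      fix \<tau> assume \<tau>: "\<tau> \<in> lift_bounded n c \<inter> V"
      then obtain \<sigma> r where \<sigma>: "\<sigma> \<in> wcone n a -` U \<inter> lift_bounded n c" "r < d \<sigma>" "sup_near n r \<tau> \<sigma>"
        unfolding V_def by blast
      have "sup_near n (d \<sigma>) \<tau> \<sigma>" using \<sigma>(2,3) unfolding sup_near_def by force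
      then show "\<tau> \<in> wcone n a -` U \<inter> lift_bounded n c" using d(2)[OF \<sigma>(1)] \<tau> by blast
    qed
    ultimately show ?thesis by blast
  qed
  then have "wcone n a -` U \<inter> lift_bounded n c \<in> sets (simplex_borel n)" for c
    by (metis lift_bounded_in_sets open_in_sets_simplex_borel sets.Int)
  then have "(\<Union>c::nat. wcone n a -` U \<inter> lift_bounded n (real c)) \<in> sets (simplex_borel n)"
    by (intro sets.countable_nat_UN) blast
  moreover have "(\<Union>c::nat. wcone n a -` U \<inter> lift_bounded n (real c)) = wcone n a -` U \<inter> space (simplex_borel n)"
    using S_eq_Union_lift_bounded[of n] by auto
  ultimately show "wcone n a -` U \<inter> space (simplex_borel n) \<in> sets (simplex_borel n)" by simp
qed (use wcone_in_S a in simp)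

subsection \<open>Levels\<close>

definition vert :: "nat \<Rightarrow> nat \<Rightarrow> real" where "vert i = (\<lambda>j. if j = i then 1 else 0)"

lemma vert_in_standard_simplex: "i \<le> n \<Longrightarrow> vert i \<in> standard_simplex n"
  by (simp add: vert_def)

text \<open>The ceiling makes the condition of having level at most \<open>k\<close> the closed
  condition that the parameter is at most \<open>M * k\<close>, so levels are Borel
  functions.\<close>

definition vlev :: "real \<Rightarrow> ((nat \<Rightarrow> real) \<Rightarrow> 'a) \<Rightarrow> nat \<Rightarrow> nat" where
  "vlev M \<sigma> i = nat \<lceil>g (\<sigma> (vert i)) / M\<rceil>"

definition lev :: "real \<Rightarrow> nat \<Rightarrow> ((nat \<Rightarrow> real) \<Rightarrow> 'a) \<Rightarrow> nat" where
  "lev M n \<sigma> = Min (vlev M \<sigma> ` {..n})"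

lemma lev_le_iff: "lev M n \<sigma> \<le> k \<longleftrightarrow> (\<exists>i\<le>n. vlev M \<sigma> i \<le> k)"
  unfolding lev_def by (subst Min_le_iff) auto

lemma le_lev_iff: "k \<le> lev M n \<sigma> \<longleftrightarrow> (\<forall>i\<le>n. k \<le> vlev M \<sigma> i)"
  unfolding lev_def by (subst Min_ge_iff) auto

lemma lev_attained: "\<exists>i\<le>n. lev M n \<sigma> = vlev M \<sigma> i"
proof -
  have "Min (vlev M \<sigma> ` {..n}) \<in> vlev M \<sigma> ` {..n}" by (rule Min_in) auto
  then show ?thesis unfolding lev_def by blast
qed

lemma vlev_face:
  assumes "i \<le> Suc n" "j \<le> n"
  shows "vlev M (singular_face (Suc n) i \<sigma>) j = vlev M \<sigma> (if j < i then j else Suc j)"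
proof -
  have "simplical_face i (vert j) = vert (if j < i then j else Suc j)"
    by (auto simp: simplical_face_def vert_def fun_eq_iff)
  then show ?thesis
    using vert_in_standard_simplex[OF assms(2)] by (simp add: vlev_def singular_face_def)
qed

lemma measurable_lev:
  assumes M: "M > 0"
  shows "lev M n \<in> measurable (simplex_borel n) (count_space UNIV)"
proof -
  have le: "{\<sigma> \<in> S n. lev M n \<sigma> \<le> k} \<in> sets (simplex_borel n)" for k
  proof -
    have "{\<sigma> \<in> S n. lev M n \<sigma> \<le> k} = (\<Union>i\<in>{..n}. {\<sigma> \<in> S n. g (\<sigma> (vert i)) \<le> M * real k})"
      using M by (auto simp: lev_le_iff vlev_def nat_le_iff ceiling_le_iff field_simps)
    also have "\<dots> \<in> sets (simplex_borel n)"
      using lift_le_in_sets[OF vert_in_standard_simplex] by (intro sets.finite_UN) auto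
    finally show ?thesis .
  qed
  have "lev M n -` {k} \<inter> space (simplex_borel n) \<in> sets (simplex_borel n)" for k
  proof (cases k)
    case 0
    have "lev M n -` {k} \<inter> space (simplex_borel n) = {\<sigma> \<in> S n. lev M n \<sigma> \<le> 0}" unfolding 0 by auto
    then show ?thesis using le[of 0] by (simp only:)
  next
    case (Suc j)
    have "lev M n -` {k} \<inter> space (simplex_borel n) = {\<sigma> \<in> S n. lev M n \<sigma> \<le> k} - {\<sigma> \<in> S n. lev M n \<sigma> \<le> j}"
      unfolding Suc by auto
    then show ?thesis using sets.Diff[OF le[of k] le[of j]] by (simp only:)
  qed
  then show ?thesis by (auto simp: measurable_count_space_eq2_countable)
qed

text \<open>The property of the simplices in the carrier, for suitable \<open>M\<close>, under which
  levels are controlled.\<close>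

definition spread :: "real \<Rightarrow> nat \<Rightarrow> ((nat \<Rightarrow> real) \<Rightarrow> 'a) \<Rightarrow> bool" where
  "spread M n \<sigma> \<longleftrightarrow> \<sigma> \<in> S n \<and>
     (\<forall>s\<in>standard_simplex n. \<forall>t\<in>standard_simplex n. \<bar>g (\<sigma> s) - g (\<sigma> t)\<bar> \<le> M)"

lemma spread_face:
  assumes "spread M (Suc n) \<sigma>" "i \<le> Suc n"
  shows "spread M n (singular_face (Suc n) i \<sigma>)"
  using assms face_in_S[of \<sigma> n i] simplical_face_in_standard_simplex[of "Suc n" i]
  by (auto simp: spread_def singular_face_def)

lemma vlev_close:
  assumes "M > 0" "spread M n \<sigma>" "i \<le> n" "j \<le> n"
  shows "vlev M \<sigma> i \<le> Suc (vlev M \<sigma> j)"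
proof -
  have "g (\<sigma> (vert i)) \<le> g (\<sigma> (vert j)) + M"
    using assms vert_in_standard_simplex unfolding spread_def by (smt (verit))
  then have "g (\<sigma> (vert i)) / M \<le> g (\<sigma> (vert j)) / M + 1"
    using assms(1) by (simp add: field_simps)
  then have "\<lceil>g (\<sigma> (vert i)) / M\<rceil> \<le> \<lceil>g (\<sigma> (vert j)) / M\<rceil> + 1"
    by linarith
  then show ?thesis unfolding vlev_def by linarith
qed

text \<open>One \<open>M\<close> is the diameter of the simplex, the other the rounding of the
  vertex that realises the level.\<close>

lemma lev_close:
  assumes M: "M > 0" and \<sigma>: "spread M n \<sigma>" and t: "t \<in> standard_simplex n"
  shows "\<bar>g (\<sigma> t) - M * real (lev M n \<sigma>)\<bar> \<le> 2 * M"
proof -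
  obtain i where i: "i \<le> n" "lev M n \<sigma> = vlev M \<sigma> i" using lev_attained by blast
  let ?x = "g (\<sigma> (vert i))"
  have "?x \<ge> 0" using \<sigma> i(1) S_in_W[OF _ vert_in_standard_simplex] g_nonneg unfolding spread_def by blast
  then have "0 \<le> ?x / M" using M by simp
  then have "?x / M \<le> real (vlev M \<sigma> i)" "real (vlev M \<sigma> i) < ?x / M + 1"
    unfolding vlev_def by linarith+
  then have "?x \<le> M * real (vlev M \<sigma> i)" "M * real (vlev M \<sigma> i) < ?x + M"
    using M by (simp_all add: field_simps)
  moreover have "\<bar>g (\<sigma> t) - ?x\<bar> \<le> M"
    using \<sigma> t vert_in_standard_simplex[OF i(1)] unfolding spread_def by blast
  ultimately show ?thesis unfolding i(2) by linarith
qed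

text \<open>Omitting a vertex can only raise the minimum, and no vertex lies more than one level
  above the lowest.\<close>

lemma lev_face:
  assumes M: "M > 0" and \<sigma>: "spread M (Suc n) \<sigma>" and i: "i \<le> Suc n"
  shows "lev M n (singular_face (Suc n) i \<sigma>) = lev M (Suc n) \<sigma> \<or>
         lev M n (singular_face (Suc n) i \<sigma>) = Suc (lev M (Suc n) \<sigma>)"
proof -
  have "lev M (Suc n) \<sigma> \<le> lev M n (singular_face (Suc n) i \<sigma>)"
    unfolding le_lev_iff[of _ M n]
  proof (intro allI impI)
    fix j assume j: "j \<le> n"
    show "lev M (Suc n) \<sigma> \<le> vlev M (singular_face (Suc n) i \<sigma>) j"
      unfolding vlev_face[OF i j] lev_le_iff using j by (intro exI[of _ "if j < i then j else Suc j"]) auto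
  qed
  moreover have "lev M n (singular_face (Suc n) i \<sigma>) \<le> Suc (lev M (Suc n) \<sigma>)"
  proof -
    obtain k where k: "k \<le> Suc n" "lev M (Suc n) \<sigma> = vlev M \<sigma> k" using lev_attained by blast
    show ?thesis
      unfolding lev_le_iff[of M n] k(2)
      using vlev_face[OF i, of 0 M \<sigma>] vlev_close[OF M \<sigma> _ k(1)] by (intro exI[of _ 0]) auto
  qed
  ultimately show ?thesis by linarith
qed

text \<open>If a face has level c + 1, its vertices have level at least c + 1, and at most c + 1 by
  comparison with the vertex of level c. All of them are thus on level c + 1, and so are the faces
  of the face.\<close>

lemma lev_face_face:
  assumes M: "M > 0" and \<sigma>: "spread M (Suc (Suc n)) \<sigma>" and i: "i \<le> Suc (Suc n)" and k: "k \<le> Suc n"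
    and up: "lev M (Suc n) (singular_face (Suc (Suc n)) i \<sigma>) = Suc (lev M (Suc (Suc n)) \<sigma>)"
  shows "lev M n (singular_face (Suc n) k (singular_face (Suc (Suc n)) i \<sigma>)) =
         lev M (Suc n) (singular_face (Suc (Suc n)) i \<sigma>)"
proof -
  let ?\<tau> = "singular_face (Suc (Suc n)) i \<sigma>"
  obtain l where l: "l \<le> Suc (Suc n)" "lev M (Suc (Suc n)) \<sigma> = vlev M \<sigma> l" using lev_attained by blast
  have const: "vlev M ?\<tau> j = lev M (Suc n) ?\<tau>" if j: "j \<le> Suc n" for j
  proof -
    have "lev M (Suc n) ?\<tau> \<le> vlev M ?\<tau> j" unfolding lev_le_iff using j by blast
    moreover have "vlev M ?\<tau> j \<le> Suc (vlev M \<sigma> l)"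
      unfolding vlev_face[OF i j] using j by (intro vlev_close[OF M \<sigma> _ l(1)]) auto
    ultimately show ?thesis using up l(2) by simp
  qed
  obtain j where j: "j \<le> n" "lev M n (singular_face (Suc n) k ?\<tau>) = vlev M (singular_face (Suc n) k ?\<tau>) j"
    using lev_attained by blast
  show ?thesis unfolding j(2) vlev_face[OF k j(1)] using j(1) by (intro const) auto
qed

subsection \<open>The chain contraction\<close>

definition base_cone :: "real \<Rightarrow> nat \<Rightarrow> ((nat \<Rightarrow> real) \<Rightarrow> 'a) \<Rightarrow> (nat \<Rightarrow> real) \<Rightarrow> 'a" where
  "base_cone M n \<sigma> = wcone n (M * real (lev M n \<sigma>)) \<sigma>"

text \<open>The join of \<open>\<tau>\<close> with the edge between the apex of its own level and
  the one below. It is applied to faces whose level exceeds that of the simplex, so the level is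
  positive and the subtraction is exact.\<close>

definition double_cone :: "real \<Rightarrow> nat \<Rightarrow> ((nat \<Rightarrow> real) \<Rightarrow> 'a) \<Rightarrow> (nat \<Rightarrow> real) \<Rightarrow> 'a" where
  "double_cone M n \<tau> = wcone (Suc n) (M * real (lev M n \<tau> - 1)) (wcone n (M * real (lev M n \<tau>)) \<tau>)"

lemma base_cone_in_S: "M > 0 \<Longrightarrow> \<sigma> \<in> S n \<Longrightarrow> base_cone M n \<sigma> \<in> S (Suc n)"
  unfolding base_cone_def by (intro wcone_in_S) auto

lemma double_cone_in_S: "M > 0 \<Longrightarrow> \<tau> \<in> S n \<Longrightarrow> double_cone M n \<tau> \<in> S (Suc (Suc n))"
  unfolding double_cone_def by (intro wcone_in_S) auto

text \<open>The apex takes countably many values, and the cone is Borel for each of them.\<close>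

lemma measurable_base_cone: "M > 0 \<Longrightarrow> base_cone M n \<in> measurable (simplex_borel n) (simplex_borel (Suc n))"
  unfolding base_cone_def
  by (rule measurable_compose_countable[where f = "\<lambda>k. wcone n (M * real k)"])
     (auto intro: measurable_wcone measurable_lev)

lemma measurable_double_cone: "M > 0 \<Longrightarrow> double_cone M n \<in> measurable (simplex_borel n) (simplex_borel (Suc (Suc n)))"
  unfolding double_cone_def
  by (rule measurable_compose_countable[where
        f = "\<lambda>k \<tau>. wcone (Suc n) (M * real (k - 1)) (wcone n (M * real k) \<tau>)"])
     (auto intro: measurable_compose[OF measurable_wcone measurable_wcone] measurable_lev)

text \<open>The boundary of a cone is the base minus the cone over the boundary of the base.\<close>

lemma sum_faces_wcone:
  fixes a :: "_ \<Rightarrow> real"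
  assumes "\<sigma> \<in> S (Suc m)"
  shows "(\<Sum>l\<le>Suc (Suc m). (-1) ^ l * a (singular_face (Suc (Suc m)) l (wcone (Suc m) b \<sigma>))) =
    a \<sigma> - (\<Sum>l\<le>Suc m. (-1) ^ l * a (wcone m b (singular_face (Suc m) l \<sigma>)))"
  unfolding sum.atMost_Suc_shift[of _ "Suc m"]
  using face_0_wcone[OF assms] by (simp add: face_Suc_wcone sum_negf del: sum.atMost_Suc)

text \<open>The boundary of \<open>base_cone\<close> contains the cones over the faces to the apex
  of level c, which is the wrong apex for a face of level c + 1. The boundary of
  \<open>double_cone\<close> supplies the right one. What remains is the cone to level c over
  \<open>\<tau> i\<close> minus the boundary of its own cone; it is left unevaluated because it is
  different in degree one.\<close>

lemma boundary_cones:
  fixes a :: "_ \<Rightarrow> real"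
  assumes M: "M > 0" and \<sigma>: "spread M (Suc m) \<sigma>"
  defines "\<tau> \<equiv> \<lambda>i. singular_face (Suc m) i \<sigma>"
  defines "\<delta> \<equiv> \<lambda>i. of_bool (lev M m (\<tau> i) = Suc (lev M (Suc m) \<sigma>)) :: real"
  defines "b \<equiv> \<lambda>i x. a (wcone m (M * real (lev M m (\<tau> i) - 1)) x)"
  shows "(\<Sum>l\<le>Suc (Suc m). (-1) ^ l * (a (singular_face (Suc (Suc m)) l (base_cone M (Suc m) \<sigma>)) -
        (\<Sum>i\<le>Suc m. (-1) ^ i * (\<delta> i * a (singular_face (Suc (Suc m)) l (double_cone M m (\<tau> i))))))) =
    a \<sigma> - (\<Sum>i\<le>Suc m. (-1) ^ i * (a (base_cone M m (\<tau> i)) + \<delta> i * (b i (\<tau> i) -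
        (\<Sum>l\<le>Suc m. (-1) ^ l * b i (singular_face (Suc m) l (wcone m (M * real (lev M m (\<tau> i))) (\<tau> i)))))))"
    (is "?L = a \<sigma> - (\<Sum>i\<le>Suc m. (-1) ^ i * (a (base_cone M m (\<tau> i)) + \<delta> i * (b i (\<tau> i) - ?R i)))")
proof -
  let ?f = "singular_face (Suc (Suc m))"
  let ?c = "M * real (lev M (Suc m) \<sigma>)"
  have \<sigma>S: "\<sigma> \<in> S (Suc m)" using \<sigma> by (simp add: spread_def)
  have \<tau>S: "\<tau> i \<in> S m" if "i \<le> Suc m" for i unfolding \<tau>_def by (rule face_in_S[OF \<sigma>S that])
  have h: "(\<Sum>l\<le>Suc (Suc m). (-1) ^ l * a (?f l (base_cone M (Suc m) \<sigma>))) =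
      a \<sigma> - (\<Sum>i\<le>Suc m. (-1) ^ i * a (wcone m ?c (\<tau> i)))"
    unfolding base_cone_def \<tau>_def by (rule sum_faces_wcone[OF \<sigma>S])
  have w: "(\<Sum>l\<le>Suc (Suc m). (-1) ^ l * a (?f l (double_cone M m (\<tau> i)))) =
      a (wcone m (M * real (lev M m (\<tau> i))) (\<tau> i)) - ?R i" if "i \<le> Suc m" for i
    unfolding double_cone_def b_def using M by (intro sum_faces_wcone wcone_in_S \<tau>S that) auto
  have "?L = (\<Sum>l\<le>Suc (Suc m). (-1) ^ l * a (?f l (base_cone M (Suc m) \<sigma>))) -
      (\<Sum>l\<le>Suc (Suc m). \<Sum>i\<le>Suc m. (-1) ^ i * \<delta> i * ((-1) ^ l * a (?f l (double_cone M m (\<tau> i)))))"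
    by (simp only: right_diff_distrib sum_subtractf sum_distrib_left mult.assoc mult.left_commute)
  also have "(\<Sum>l\<le>Suc (Suc m). \<Sum>i\<le>Suc m. (-1) ^ i * \<delta> i * ((-1) ^ l * a (?f l (double_cone M m (\<tau> i))))) =
      (\<Sum>i\<le>Suc m. (-1) ^ i * \<delta> i * (\<Sum>l\<le>Suc (Suc m). (-1) ^ l * a (?f l (double_cone M m (\<tau> i)))))"
    unfolding sum_distrib_left by (rule sum.swap)
  also have "\<dots> = (\<Sum>i\<le>Suc m. (-1) ^ i * \<delta> i * (a (wcone m (M * real (lev M m (\<tau> i))) (\<tau> i)) - ?R i))"
    by (intro sum.cong refl) (simp only: w atMost_iff)
  finally have "?L = a \<sigma> - (\<Sum>i\<le>Suc m. (-1) ^ i * (a (wcone m ?c (\<tau> i)) +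
      \<delta> i * (a (wcone m (M * real (lev M m (\<tau> i))) (\<tau> i)) - ?R i)))"
    unfolding h by (simp only: distrib_left sum.distrib mult.assoc diff_diff_add)
  also have "\<dots> = a \<sigma> - (\<Sum>i\<le>Suc m. (-1) ^ i * (a (base_cone M m (\<tau> i)) + \<delta> i * (b i (\<tau> i) - ?R i)))"
  proof (intro arg_cong[of _ _ "\<lambda>x. a \<sigma> - x"] sum.cong refl arg_cong[of _ _ "\<lambda>x. (-1) ^ _ * x"])
    fix i assume "i \<in> {..Suc m}"
    then have "lev M m (\<tau> i) = lev M (Suc m) \<sigma> \<or> lev M m (\<tau> i) = Suc (lev M (Suc m) \<sigma>)"
      unfolding \<tau>_def by (intro lev_face[OF M \<sigma>]) simp
    then show "a (wcone m ?c (\<tau> i)) + \<delta> i * (a (wcone m (M * real (lev M m (\<tau> i))) (\<tau> i)) - ?R i) =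
        a (base_cone M m (\<tau> i)) + \<delta> i * (b i (\<tau> i) - ?R i)"
      by (auto simp: \<delta>_def b_def base_cone_def)
  qed
  finally show ?thesis .
qed

text \<open>Writing \<open>\<theta> \<sigma>\<close> for the alternating sum of the faces of level \<open>lev \<sigma> + 1\<close>,
  \<open>\<theta>\<close> is the commutator of the boundary with multiplication by the level, whence
  \<open>\<partial>\<theta> + \<theta>\<partial> = 0\<close> and \<open>P = base_cone - double_cone \<theta>\<close> satisfies \<open>\<partial>P + P\<partial> = id\<close>. The chains are
  evaluated against an arbitrary function \<open>a\<close>, later the indicator of a Borel set.\<close>

lemma boundary_contraction:
  fixes a :: "_ \<Rightarrow> real"
  assumes M: "M > 0" and \<sigma>: "spread M (Suc (Suc m)) \<sigma>"
  defines "\<tau> \<equiv> \<lambda>i. singular_face (Suc (Suc m)) i \<sigma>"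
  defines "\<rho> \<equiv> \<lambda>i k. singular_face (Suc m) k (\<tau> i)"
  shows "(\<Sum>l\<le>Suc (Suc (Suc m)). (-1) ^ l * (a (singular_face (Suc (Suc (Suc m))) l (base_cone M (Suc (Suc m)) \<sigma>)) -
        (\<Sum>i\<le>Suc (Suc m). (-1) ^ i * (of_bool (lev M (Suc m) (\<tau> i) = Suc (lev M (Suc (Suc m)) \<sigma>)) *
           a (singular_face (Suc (Suc (Suc m))) l (double_cone M (Suc m) (\<tau> i))))))) =
    a \<sigma> - (\<Sum>i\<le>Suc (Suc m). (-1) ^ i * (a (base_cone M (Suc m) (\<tau> i)) -
        (\<Sum>k\<le>Suc m. (-1) ^ k * (of_bool (lev M m (\<rho> i k) = Suc (lev M (Suc m) (\<tau> i))) * a (double_cone M m (\<rho> i k))))))"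
    (is "?L = a \<sigma> - (\<Sum>i\<le>Suc (Suc m). (-1) ^ i * (_ - ?Q i))")
proof -
  let ?c = "real (lev M (Suc (Suc m)) \<sigma>)"
  let ?\<delta> = "\<lambda>i. of_bool (lev M (Suc m) (\<tau> i) = Suc (lev M (Suc (Suc m)) \<sigma>)) :: real"
  let ?b = "\<lambda>i x. a (wcone (Suc m) (M * real (lev M (Suc m) (\<tau> i) - 1)) x)"
  let ?R = "\<lambda>i. (\<Sum>l\<le>Suc (Suc m). (-1) ^ l * ?b i (singular_face (Suc (Suc m)) l
               (wcone (Suc m) (M * real (lev M (Suc m) (\<tau> i))) (\<tau> i))))"
  let ?f = "\<lambda>\<rho>. a (double_cone M m \<rho>)"
  have \<tau>: "spread M (Suc m) (\<tau> i)" if "i \<le> Suc (Suc m)" for i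
    unfolding \<tau>_def by (rule spread_face[OF \<sigma> that])
  \<comment> \<open>As a difference of levels the jump indicator becomes additive along iterated
    faces.\<close>
  have \<delta>: "?\<delta> i = real (lev M (Suc m) (\<tau> i)) - ?c" if "i \<le> Suc (Suc m)" for i
    using lev_face[OF M \<sigma> that] unfolding \<tau>_def by auto
  have \<delta>2: "of_bool (lev M m (\<rho> i k) = Suc (lev M (Suc m) (\<tau> i))) = real (lev M m (\<rho> i k)) - real (lev M (Suc m) (\<tau> i))"
    if "i \<le> Suc (Suc m)" "k \<le> Suc m" for i k
    using lev_face[OF M \<tau>[OF that(1)] that(2)] unfolding \<rho>_def by auto
  have "?L = a \<sigma> - (\<Sum>i\<le>Suc (Suc m). (-1) ^ i * (a (base_cone M (Suc m) (\<tau> i)) + ?\<delta> i * (?b i (\<tau> i) - ?R i)))"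
    unfolding \<tau>_def by (rule boundary_cones[OF M \<sigma>])
  also have "\<dots> = a \<sigma> - (\<Sum>i\<le>Suc (Suc m). (-1) ^ i * (a (base_cone M (Suc m) (\<tau> i)) +
      ?\<delta> i * (\<Sum>k\<le>Suc m. (-1) ^ k * ?f (\<rho> i k))))"
  proof (intro arg_cong[of _ _ "\<lambda>x. a \<sigma> - x"] sum.cong refl arg_cong[of _ _ "\<lambda>x. (-1) ^ _ * (_ + x)"])
    fix i assume "i \<in> {..Suc (Suc m)}"
    then have i: "i \<le> Suc (Suc m)" by simp
    have \<tau>S: "\<tau> i \<in> S (Suc m)" using \<tau>[OF i] by (simp add: spread_def)
    show "?\<delta> i * (?b i (\<tau> i) - ?R i) = ?\<delta> i * (\<Sum>k\<le>Suc m. (-1) ^ k * ?f (\<rho> i k))"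
    proof (cases "lev M (Suc m) (\<tau> i) = Suc (lev M (Suc (Suc m)) \<sigma>)")
      case True
      \<comment> \<open>Faces of a face that has jumped keep its level, so the iterated cones over
        them use the apexes prescribed by \<open>double_cone\<close>.\<close>
      have "lev M m (\<rho> i k) = lev M (Suc m) (\<tau> i)" if "k \<le> Suc m" for k
        using lev_face_face[OF M \<sigma> i that] True unfolding \<rho>_def \<tau>_def by simp
      then have "(\<Sum>k\<le>Suc m. (-1) ^ k * ?b i (wcone m (M * real (lev M (Suc m) (\<tau> i))) (\<rho> i k))) =
          (\<Sum>k\<le>Suc m. (-1) ^ k * ?f (\<rho> i k))"
        by (intro sum.cong refl) (simp add: double_cone_def)
      then show ?thesis
        unfolding sum_faces_wcone[OF \<tau>S, of "?b i"] \<rho>_def by simp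
    qed simp
  qed
  also have "\<dots> = a \<sigma> - (\<Sum>i\<le>Suc (Suc m). (-1) ^ i * (a (base_cone M (Suc m) (\<tau> i)) - ?Q i))"
  proof -
    have "(\<Sum>i\<le>Suc (Suc m). (-1) ^ i * (a (base_cone M (Suc m) (\<tau> i)) + ?\<delta> i * (\<Sum>k\<le>Suc m. (-1) ^ k * ?f (\<rho> i k)))) -
        (\<Sum>i\<le>Suc (Suc m). (-1) ^ i * (a (base_cone M (Suc m) (\<tau> i)) - ?Q i)) =
        (\<Sum>i\<le>Suc (Suc m). (-1) ^ i * (?\<delta> i * (\<Sum>k\<le>Suc m. (-1) ^ k * ?f (\<rho> i k)) + ?Q i))"
      unfolding sum_subtractf[symmetric] by (intro sum.cong refl) (simp only: algebra_simps)
    \<comment> \<open>The two jumps telescope: level of \<open>\<rho> i k\<close> minus level of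
      \<open>\<tau> i\<close>, plus level of \<open>\<tau> i\<close> minus that of
      \<open>\<sigma>\<close>. The weight then depends on the double face alone, and
      \<open>\<partial>\<partial> = 0\<close> applies.\<close>
    also have "\<dots> = (\<Sum>i\<le>Suc (Suc m). \<Sum>k\<le>Suc m. (-1) ^ (i + k) *
        ((real (lev M m (\<rho> i k)) - ?c) * ?f (\<rho> i k)))"
    proof (intro sum.cong refl)
      fix i assume "i \<in> {..Suc (Suc m)}"
      then have i: "i \<le> Suc (Suc m)" by simp
      have "?\<delta> i * (\<Sum>k\<le>Suc m. (-1) ^ k * ?f (\<rho> i k)) + ?Q i =
        (\<Sum>k\<le>Suc m. (-1) ^ k * ((real (lev M m (\<rho> i k)) - ?c) * ?f (\<rho> i k)))"
        unfolding sum_distrib_left sum.distrib[symmetric]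
        by (intro sum.cong refl) (simp add: \<delta>[OF i] \<delta>2[OF i] algebra_simps del: of_bool_eq_iff)
      then show "(-1) ^ i * (?\<delta> i * (\<Sum>k\<le>Suc m. (-1) ^ k * ?f (\<rho> i k)) + ?Q i) =
        (\<Sum>k\<le>Suc m. (-1) ^ (i + k) * ((real (lev M m (\<rho> i k)) - ?c) * ?f (\<rho> i k)))"
        by (simp only: sum_distrib_left power_add mult.assoc)
    qed
    also have "\<dots> = 0"
      unfolding \<rho>_def \<tau>_def
      using sum_faces_faces_eq_0[of "Suc m" "\<lambda>\<rho>. (real (lev M m \<rho>) - ?c) * ?f \<rho>" \<sigma>] by simp
    finally show ?thesis by simp
  qed
  finally show ?thesis .
qed

text \<open>The double cone with its base removed: in dimension 0 the apex of level \<open>k\<close>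
  takes the place of the face that is missing.\<close>

definition edge :: "real \<Rightarrow> nat \<Rightarrow> (nat \<Rightarrow> real) \<Rightarrow> 'a" where
  "edge M k = wcone 0 (M * real (k - 1)) (restrict (\<lambda>_. p (M * real k)) (standard_simplex 0))"

text \<open>In degree one the contraction leaves the edge of the ray across which the simplex jumps.\<close>

lemma boundary_contraction_1:
  fixes a :: "_ \<Rightarrow> real"
  assumes M: "M > 0" and \<sigma>: "spread M (Suc 0) \<sigma>"
  defines "\<tau> \<equiv> \<lambda>i. singular_face (Suc 0) i \<sigma>"
  defines "\<delta> \<equiv> \<lambda>i. of_bool (lev M 0 (\<tau> i) = Suc (lev M (Suc 0) \<sigma>)) :: real"
  shows "(\<Sum>l\<le>Suc (Suc 0). (-1) ^ l * (a (singular_face (Suc (Suc 0)) l (base_cone M (Suc 0) \<sigma>)) -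
        (\<Sum>i\<le>Suc 0. (-1) ^ i * (\<delta> i * a (singular_face (Suc (Suc 0)) l (double_cone M 0 (\<tau> i))))))) =
    a \<sigma> - (\<Sum>i\<le>Suc 0. (-1) ^ i * (a (base_cone M 0 (\<tau> i)) + \<delta> i * a (edge M (lev M 0 (\<tau> i)))))"
proof -
  have \<tau>S: "\<tau> i \<in> S 0" if "i \<le> Suc 0" for i
    using \<sigma> that unfolding \<tau>_def spread_def by (intro face_in_S) auto
  \<comment> \<open>The faces of the cone over the point \<open>\<tau> i\<close> are
    \<open>\<tau> i\<close> and the apex. The term of \<open>\<tau> i\<close> cancels, and the cone
    over the apex remains, which is the edge.\<close>
  show ?thesis
    unfolding \<tau>_def \<delta>_def boundary_cones[OF M \<sigma>]
    using face_0_wcone[OF \<tau>S] by (simp add: face_1_wcone_0 edge_def \<tau>_def)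
qed

subsection \<open>Filling a cycle\<close>

lemma signed_measure_chain: "\<mu> \<in> MT_chains n X \<Longrightarrow> signed_measure (simplex_borel n) \<mu>"
  by unfold_locales (auto simp: MT_chains_def sets_simplex_borel)

definition upface :: "real \<Rightarrow> nat \<Rightarrow> nat \<Rightarrow> ((nat \<Rightarrow> real) \<Rightarrow> 'a) set" where
  "upface M n i = {\<sigma> \<in> S (Suc n). lev M n (singular_face (Suc n) i \<sigma>) = Suc (lev M (Suc n) \<sigma>)}"

lemma upface_in_sets:
  assumes "M > 0" "i \<le> Suc n"
  shows "upface M n i \<in> sets (simplex_borel (Suc n))"
proof -
  let ?l = "\<lambda>\<sigma>. lev M n (singular_face (Suc n) i \<sigma>)"
  have l: "?l \<in> measurable (simplex_borel (Suc n)) (count_space UNIV)"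
    by (rule measurable_compose[OF measurable_face[OF assms(2)] measurable_lev[OF assms(1)]])
  have "(?l -` {Suc k} \<inter> space (simplex_borel (Suc n))) \<inter> (lev M (Suc n) -` {k} \<inter> space (simplex_borel (Suc n))) \<in> sets (simplex_borel (Suc n))" for k
    by (intro sets.Int measurable_sets[OF l] measurable_sets[OF measurable_lev[OF assms(1)]]) simp_all
  then have "(\<Union>k. (?l -` {Suc k} \<inter> space (simplex_borel (Suc n))) \<inter> (lev M (Suc n) -` {k} \<inter> space (simplex_borel (Suc n)))) \<in> sets (simplex_borel (Suc n))"
    by (intro sets.countable_nat_UN) blast
  also have "(\<Union>k. (?l -` {Suc k} \<inter> space (simplex_borel (Suc n))) \<inter> (lev M (Suc n) -` {k} \<inter> space (simplex_borel (Suc n)))) = upface M n i"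
    unfolding upface_def by auto
  finally show ?thesis .
qed

lemma base_cone_preimage_in_sets:
  assumes "M > 0" "A \<in> sets (simplex_borel (Suc n))"
  shows "{\<sigma> \<in> S n. base_cone M n \<sigma> \<in> A} \<in> sets (simplex_borel n)"
proof -
  have "base_cone M n -` A \<inter> space (simplex_borel n) \<in> sets (simplex_borel n)"
    by (rule measurable_sets[OF measurable_base_cone[OF assms(1)] assms(2)])
  also have "base_cone M n -` A \<inter> space (simplex_borel n) = {\<sigma> \<in> S n. base_cone M n \<sigma> \<in> A}" by auto
  finally show ?thesis .
qed

lemma double_cone_preimage_in_sets:
  assumes "M > 0" "i \<le> Suc n" "A \<in> sets (simplex_borel (Suc (Suc n)))"
  shows "{\<sigma> \<in> upface M n i. double_cone M n (singular_face (Suc n) i \<sigma>) \<in> A} \<in> sets (simplex_borel (Suc n))"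
proof -
  let ?w = "\<lambda>\<sigma>. double_cone M n (singular_face (Suc n) i \<sigma>)"
  have "?w \<in> measurable (simplex_borel (Suc n)) (simplex_borel (Suc (Suc n)))"
    by (rule measurable_compose[OF measurable_face[OF assms(2)] measurable_double_cone[OF assms(1)]])
  then have "upface M n i \<inter> (?w -` A \<inter> space (simplex_borel (Suc n))) \<in> sets (simplex_borel (Suc n))"
    using assms(3) by (intro sets.Int upface_in_sets assms(1,2) measurable_sets)
  also have "upface M n i \<inter> (?w -` A \<inter> space (simplex_borel (Suc n))) = {\<sigma> \<in> upface M n i. ?w \<sigma> \<in> A}"
    by (auto simp: upface_def)
  finally show ?thesis .
qed

lemma face_preimage_in_sets:
  assumes "i \<le> Suc n" "A \<in> sets (simplex_borel n)"
  shows "{\<sigma> \<in> S (Suc n). singular_face (Suc n) i \<sigma> \<in> A} \<in> sets (simplex_borel (Suc n))"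
proof -
  have "singular_face (Suc n) i -` A \<inter> space (simplex_borel (Suc n)) \<in> sets (simplex_borel (Suc n))"
    by (rule measurable_sets[OF measurable_face[OF assms(1)] assms(2)])
  also have "singular_face (Suc n) i -` A \<inter> space (simplex_borel (Suc n)) = {\<sigma> \<in> S (Suc n). singular_face (Suc n) i \<sigma> \<in> A}" by auto
  finally show ?thesis .
qed

text \<open>The image of \<open>\<mu>\<close> under the contraction. Restricting the preimages to
  \<open>upface\<close> realises the coefficient that is 1 on faces that jump and 0 on the
  others.\<close>

definition filling :: "real \<Rightarrow> nat \<Rightarrow> (((nat \<Rightarrow> real) \<Rightarrow> 'a) set \<Rightarrow> real) \<Rightarrow> ((nat \<Rightarrow> real) \<Rightarrow> 'a) set \<Rightarrow> real" where
  "filling M n \<mu> A = \<mu> {\<sigma> \<in> S (Suc n). base_cone M (Suc n) \<sigma> \<in> A} -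
     (\<Sum>i\<le>Suc n. (-1) ^ i * \<mu> {\<sigma> \<in> upface M n i. double_cone M n (singular_face (Suc n) i \<sigma>) \<in> A})"

section \<open>Compact carriers for the filling\<close>

lemma equicont_base_cone:
  assumes M: "M > 0" and F: "equicont n F" "\<And>\<sigma>. \<sigma> \<in> F \<Longrightarrow> spread M n \<sigma>"
  shows "equicont (Suc n) (base_cone M n ` F)"
proof -
  let ?P = "(\<lambda>\<sigma>. (M * real (lev M n \<sigma>), \<sigma>)) ` F"
  have "equicont (Suc n) ((\<lambda>(a, \<sigma>). wcone n a \<sigma>) ` ?P)"
  proof (rule equicont_wcone[where D = "2 * M"])
    show "equicont n (snd ` ?P)" using F(1) by (simp add: image_image)
    show "\<bar>g (\<sigma> t) - a\<bar> \<le> 2 * M" if "(a, \<sigma>) \<in> ?P" "t \<in> standard_simplex n" for a \<sigma> t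
      using that lev_close[OF M F(2)] by auto
  qed (use M F(2) in \<open>auto simp: spread_def\<close>)
  then show ?thesis by (simp add: image_image base_cone_def)
qed

text \<open>The first cone stays within \<open>2 * M\<close> of its apex, and the second apex is at
  most \<open>M\<close> away from that one, whence the distance bound \<open>3 * M\<close>.\<close>

lemma equicont_double_cone:
  assumes M: "M > 0" and F: "equicont n F" "\<And>\<sigma>. \<sigma> \<in> F \<Longrightarrow> spread M n \<sigma>"
  shows "equicont (Suc (Suc n)) (double_cone M n ` F)"
proof -
  let ?P = "(\<lambda>\<sigma>. (M * real (lev M n \<sigma> - 1), base_cone M n \<sigma>)) ` F"
  have "equicont (Suc (Suc n)) ((\<lambda>(a, \<sigma>). wcone (Suc n) a \<sigma>) ` ?P)"
  proof (rule equicont_wcone[where D = "3 * M"])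
    show "equicont (Suc n) (snd ` ?P)" using equicont_base_cone[OF assms] by (simp add: image_image)
    show "a \<ge> 0 \<and> \<sigma> \<in> S (Suc n)" if "(a, \<sigma>) \<in> ?P" for a \<sigma>
    proof -
      obtain \<tau> where "\<tau> \<in> F" "a = M * real (lev M n \<tau> - 1)" "\<sigma> = base_cone M n \<tau>" using \<open>(a, \<sigma>) \<in> ?P\<close> by auto
      then show ?thesis using M base_cone_in_S[OF M, of \<tau> n] F(2)[of \<tau>] by (simp add: spread_def)
    qed
    show "\<bar>g (\<rho> t) - a\<bar> \<le> 3 * M" if P: "(a, \<rho>) \<in> ?P" and t: "t \<in> standard_simplex (Suc n)" for a \<rho> t
    proof -
      obtain \<sigma> where \<sigma>: "\<sigma> \<in> F" "a = M * real (lev M n \<sigma> - 1)" "\<rho> = base_cone M n \<sigma>" using P by auto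
      have \<sigma>S: "\<sigma> \<in> S n" using F(2)[OF \<sigma>(1)] by (simp add: spread_def)
      let ?b = "M * real (lev M n \<sigma>)"
      have b: "?b \<ge> 0" using M by simp
      have "g (\<rho> t) = rcone ?b (g \<circ> \<sigma>) t"
        unfolding \<sigma>(3) base_cone_def by (rule g_wcone[OF \<sigma>S b t])
      moreover have "\<bar>rcone ?b (g \<circ> \<sigma>) t - ?b\<bar> \<le> (1 - t 0) * (2 * M)"
        by (rule rcone_bound[OF t]) (use lev_close[OF M F(2)[OF \<sigma>(1)]] in simp)
      moreover have "(1 - t 0) * (2 * M) \<le> 2 * M"
        using standard_simplex_le_1[OF t, of 0] M by (simp add: mult_left_le_one_le)
      moreover have "\<bar>?b - a\<bar> \<le> M"
        using M unfolding \<sigma>(2) by (cases "lev M n \<sigma>") (auto simp: algebra_simps)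
      ultimately show ?thesis by linarith
    qed
  qed
  then show ?thesis by (simp add: image_image double_cone_def base_cone_def)
qed

text \<open>The simplices produced from the carrier \<open>K\<close> form a finite union of
  equicontinuous families, so Ascoli encloses them in a compact set; a Borel set missing it has
  preimages missing \<open>K\<close>.\<close>

lemma filling_in_chains:
  assumes \<mu>: "\<mu> \<in> MT_chains (Suc n) X" and M: "M > 0"
    and K: "compactin (compact_open_top (Suc n) X) K" "\<And>A. A \<in> MT_borel (Suc n) X \<Longrightarrow> A \<subseteq> S (Suc n) - K \<Longrightarrow> \<mu> A = 0"
    and KM: "\<And>\<sigma>. \<sigma> \<in> K \<Longrightarrow> spread M (Suc n) \<sigma>"
  shows "filling M n \<mu> \<in> MT_chains (Suc (Suc n)) X"
proof -
  interpret \<mu>: signed_measure "simplex_borel (Suc n)" \<mu> by (rule signed_measure_chain[OF \<mu>])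
  let ?H = "\<lambda>A. {\<sigma> \<in> S (Suc n). base_cone M (Suc n) \<sigma> \<in> A}"
  let ?W = "\<lambda>i A. {\<sigma> \<in> upface M n i. double_cone M n (singular_face (Suc n) i \<sigma>) \<in> A}"
  have sums: "(\<lambda>k. filling M n \<mu> (A k)) sums filling M n \<mu> (\<Union>k. A k)"
    if A: "range A \<subseteq> MT_borel (Suc (Suc n)) X" and disj: "disjoint_family A" for A
  proof -
    have A': "A k \<in> sets (simplex_borel (Suc (Suc n)))" for k using A by (auto simp: sets_simplex_borel)
    have "(\<lambda>k. \<mu> (?H (A k))) sums \<mu> (\<Union>k. ?H (A k))"
      using disj base_cone_preimage_in_sets[OF M A'] by (intro \<mu>.sums) (auto simp: disjoint_family_on_def)
    moreover have "(\<Union>k. ?H (A k)) = ?H (\<Union>k. A k)" by auto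
    moreover have "(\<lambda>k. \<mu> (?W i (A k))) sums \<mu> (?W i (\<Union>k. A k))" if i: "i \<le> Suc n" for i
    proof -
      have "(\<lambda>k. \<mu> (?W i (A k))) sums \<mu> (\<Union>k. ?W i (A k))"
        using disj double_cone_preimage_in_sets[OF M i A'] by (intro \<mu>.sums) (auto simp: disjoint_family_on_def)
      moreover have "(\<Union>k. ?W i (A k)) = ?W i (\<Union>k. A k)" by auto
      ultimately show ?thesis by simp
    qed
    ultimately show ?thesis
      unfolding filling_def by (intro sums_diff sums_sum sums_mult) auto
  qed
  have Keq: "equicont (Suc n) K" by (rule compactin_imp_equicont[OF K(1)])
  have KS: "K \<subseteq> S (Suc n)" using compactin_subset_topspace[OF K(1)] by simp
  let ?G = "base_cone M (Suc n) ` K \<union> (\<Union>i\<le>Suc n. double_cone M n ` singular_face (Suc n) i ` K)"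
  have "equicont (Suc (Suc n)) (\<Union>i\<le>j. double_cone M n ` singular_face (Suc n) i ` K)" if "j \<le> Suc n" for j
    using that
  proof (induction j)
    case 0
    then show ?case using spread_face[OF KM, of _ 0]
      by (simp, intro equicont_double_cone M equicont_singular_face Keq) auto
  next
    case (Suc j)
    have "equicont (Suc (Suc n)) (double_cone M n ` singular_face (Suc n) (Suc j) ` K)"
      using spread_face[OF KM, of _ "Suc j"] Suc.prems
      by (intro equicont_double_cone M equicont_singular_face Keq) auto
    then show ?case unfolding atMost_Suc UN_insert using Suc by (intro equicont_Un) auto
  qed
  then have "equicont (Suc (Suc n)) ?G"
    by (intro equicont_Un equicont_base_cone M Keq KM) auto
  moreover have "?G \<subseteq> S (Suc (Suc n))"
  proof -
    have "double_cone M n (singular_face (Suc n) i \<sigma>) \<in> S (Suc (Suc n))" if "i \<le> Suc n" "\<sigma> \<in> K" for i \<sigma>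
      using that KS by (intro double_cone_in_S M face_in_S) auto
    moreover have "base_cone M (Suc n) \<sigma> \<in> S (Suc (Suc n))" if "\<sigma> \<in> K" for \<sigma>
      using that KS by (intro base_cone_in_S M) auto
    ultimately show ?thesis by blast
  qed
  ultimately obtain K' where K': "compactin (compact_open_top (Suc (Suc n)) X) K'" "?G \<subseteq> K'"
    using equicont_imp_subset_compactin[OF compact_W, of ?G "Suc (Suc n)"] by blast
  have "filling M n \<mu> A = 0"
    if A: "A \<in> MT_borel (Suc (Suc n)) X" and AK: "A \<subseteq> S (Suc (Suc n)) - K'" for A
  proof -
    have A': "A \<in> sets (simplex_borel (Suc (Suc n)))" using A by (simp add: sets_simplex_borel)
    have out: "x \<notin> A" if "x \<in> ?G" for x using that K'(2) AK by blast
    have "\<mu> (?H A) = 0"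
    proof (rule K(2))
      show "?H A \<in> MT_borel (Suc n) X" using base_cone_preimage_in_sets[OF M A'] by (simp only: sets_simplex_borel)
      show "?H A \<subseteq> S (Suc n) - K" using out by blast
    qed
    moreover have "\<mu> (?W i A) = 0" if i: "i \<le> Suc n" for i
    proof (rule K(2))
      show "?W i A \<in> MT_borel (Suc n) X" using double_cone_preimage_in_sets[OF M i A'] by (simp only: sets_simplex_borel)
      have "upface M n i \<subseteq> S (Suc n)" by (auto simp: upface_def)
      then show "?W i A \<subseteq> S (Suc n) - K" using out i by blast
    qed
    ultimately show ?thesis by (simp add: filling_def del: sum.atMost_Suc)
  qed
  moreover have "filling M n \<mu> {} = 0" by (simp add: filling_def)
  ultimately show ?thesis unfolding MT_chains_def using sums K'(1) by blast
qed

text \<open>The mass of the jumps to level \<open>k\<close>, counted with sign, is the mass of \<open>\<partial>\<mu>\<close> on the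
  points of level at least \<open>k\<close>.\<close>

lemma jumps_cancel:
  assumes \<mu>: "\<mu> \<in> MT_chains (Suc 0) X" and M: "M > 0"
    and K: "\<And>A. A \<in> MT_borel (Suc 0) X \<Longrightarrow> A \<subseteq> S (Suc 0) - K \<Longrightarrow> \<mu> A = 0"
    and KM: "\<And>\<sigma>. \<sigma> \<in> K \<Longrightarrow> spread M (Suc 0) \<sigma>"
    and cycle: "\<And>A. A \<in> MT_borel 0 X \<Longrightarrow> MT_boundary (Suc 0) X \<mu> A = 0"
  defines "Z \<equiv> \<lambda>i J. {\<sigma> \<in> upface M 0 i. lev M 0 (singular_face (Suc 0) i \<sigma>) \<in> J}"
  shows "\<mu> (Z 0 J) = \<mu> (Z 1 J)"
proof -
  interpret \<mu>: signed_measure "simplex_borel (Suc 0)" \<mu> by (rule signed_measure_chain[OF \<mu>])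
  let ?f = "singular_face (Suc 0)"
  have face_lev: "(\<lambda>\<sigma>. lev M 0 (?f i \<sigma>)) \<in> measurable (simplex_borel (Suc 0)) (count_space UNIV)" if "i \<le> Suc 0" for i
    by (rule measurable_compose[OF measurable_face[OF that] measurable_lev[OF M]])
  have lsets: "{\<sigma> \<in> S (Suc 0). lev M 0 (?f i \<sigma>) \<in> J} \<in> sets (simplex_borel (Suc 0))" if "i \<le> Suc 0" for i J
  proof -
    have "(\<lambda>\<sigma>. lev M 0 (?f i \<sigma>)) -` J \<inter> space (simplex_borel (Suc 0)) \<in> sets (simplex_borel (Suc 0))"
      by (rule measurable_sets[OF face_lev[OF that]]) simp
    also have "(\<lambda>\<sigma>. lev M 0 (?f i \<sigma>)) -` J \<inter> space (simplex_borel (Suc 0)) = {\<sigma> \<in> S (Suc 0). lev M 0 (?f i \<sigma>) \<in> J}" by auto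
    finally show ?thesis .
  qed
  have Zsets: "Z i J \<in> sets (simplex_borel (Suc 0))" if "i \<le> Suc 0" for i J
  proof -
    have "Z i J = upface M 0 i \<inter> {\<sigma> \<in> S (Suc 0). lev M 0 (?f i \<sigma>) \<in> J}"
      by (auto simp: Z_def upface_def)
    then show ?thesis using upface_in_sets[OF M that] lsets[OF that, of J] by simp
  qed
  have levels: "\<mu> (Z 0 {k}) = \<mu> (Z 1 {k})" for k
  proof -
    let ?U = "\<lambda>i. {\<sigma> \<in> S (Suc 0). lev M 0 (?f i \<sigma>) \<in> {k..}}"
    have ind: "simple_function (simplex_borel (Suc 0)) (indicator B :: _ \<Rightarrow> real)" if "B \<in> sets (simplex_borel (Suc 0))" for B
      using that by (rule simple_function_indicator)
    note i01 = le0[of "Suc 0"] le_refl[of "Suc 0"]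
    have sf: "simple_function (simplex_borel (Suc 0)) (\<lambda>\<sigma>. indicator (Z 0 {k}) \<sigma> - indicator (Z 1 {k}) \<sigma> :: real)"
      "simple_function (simplex_borel (Suc 0)) (\<lambda>\<sigma>. indicator (?U 0) \<sigma> - indicator (?U 1) \<sigma> :: real)"
      using Zsets[OF i01(1), of "{k}"] Zsets[OF i01(2), of "{k}"] lsets[OF i01(1), of "{k..}"] lsets[OF i01(2), of "{k..}"]
      unfolding One_nat_def by (auto intro!: simple_function_diff ind)
    have "\<mu> (Z 0 {k}) - \<mu> (Z 1 {k}) = \<mu>.sint (\<lambda>\<sigma>. indicator (Z 0 {k}) \<sigma> - indicator (Z 1 {k}) \<sigma>)"
      using Zsets[OF i01(1), of "{k}"] Zsets[OF i01(2), of "{k}"]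
      by (simp add: \<mu>.sint_diff \<mu>.sint_indicator)
    also have "\<dots> = \<mu>.sint (\<lambda>\<sigma>. indicator (?U 0) \<sigma> - indicator (?U 1) \<sigma>)"
    proof (rule \<mu>.sint_cong_carrier[OF sf, where K = K])
      show "\<mu> B = 0" if "B \<in> sets (simplex_borel (Suc 0))" "B \<inter> K = {}" for B
        using that sets.sets_into_space[OF that(1)] by (intro K) (auto simp: sets_simplex_borel)
      fix \<sigma> assume \<sigma>: "\<sigma> \<in> space (simplex_borel (Suc 0))" "\<sigma> \<in> K"
      have \<sigma>S: "\<sigma> \<in> S (Suc 0)" using \<sigma>(1) by simp
      have v: "lev M 0 \<rho> = vlev M \<rho> 0" for \<rho> by (simp add: lev_def)
      have l0: "lev M 0 (?f 0 \<sigma>) = vlev M \<sigma> 1" and l1: "lev M 0 (?f 1 \<sigma>) = vlev M \<sigma> 0"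
        unfolding v by (simp_all add: vlev_face)
      have l: "lev M (Suc 0) \<sigma> = min (vlev M \<sigma> 1) (vlev M \<sigma> 0)"
        by (simp add: lev_def atMost_Suc)
      have close: "vlev M \<sigma> 0 \<le> Suc (vlev M \<sigma> 1)" "vlev M \<sigma> 1 \<le> Suc (vlev M \<sigma> 0)"
        using vlev_close[OF M KM[OF \<sigma>(2)]] by auto
      have Z: "\<sigma> \<in> Z i {k} \<longleftrightarrow> lev M 0 (?f i \<sigma>) = Suc (lev M (Suc 0) \<sigma>) \<and> lev M 0 (?f i \<sigma>) = k" for i
        using \<sigma>S by (auto simp: Z_def upface_def)
      have U: "\<sigma> \<in> ?U i \<longleftrightarrow> k \<le> lev M 0 (?f i \<sigma>)" for i using \<sigma>S by auto
      \<comment> \<open>On the carrier the endpoint levels differ by at most one, so exactly one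
        endpoint has level at least \<open>k\<close> precisely when the edge jumps between levels
        \<open>k - 1\<close> and \<open>k\<close>.\<close>
      show "indicator (Z 0 {k}) \<sigma> - indicator (Z 1 {k}) \<sigma> = (indicator (?U 0) \<sigma> - indicator (?U 1) \<sigma> :: real)"
        unfolding indicator_def Z U l0 l1 l using close by (auto simp: min_def)
    qed
    also have "\<dots> = \<mu> (?U 0) - \<mu> (?U 1)"
      using lsets[OF i01(1), of "{k..}"] lsets[OF i01(2), of "{k..}"] ind
      unfolding One_nat_def by (subst \<mu>.sint_diff) (auto simp: \<mu>.sint_indicator)
    also have "\<dots> = 0"
    proof -
      \<comment> \<open>An unbounded tail of the half-line, tested as a single Borel set. Countable
        additivity gives it a finite measure; for infinite chains of edges running along the whole
        ray this step would fail.\<close>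
      let ?V = "{\<rho> \<in> S 0. lev M 0 \<rho> \<in> {k..}}"
      have "lev M 0 -` {k..} \<inter> space (simplex_borel 0) \<in> sets (simplex_borel 0)"
        by (rule measurable_sets[OF measurable_lev[OF M]]) simp
      also have "lev M 0 -` {k..} \<inter> space (simplex_borel 0) = ?V" by auto
      finally have "MT_boundary (Suc 0) X \<mu> ?V = 0" using cycle by (simp add: sets_simplex_borel)
      moreover have "{\<sigma> \<in> S (Suc 0). ?f i \<sigma> \<in> ?V} = ?U i" if "i \<le> Suc 0" for i
        using face_in_S[OF _ that] by auto
      ultimately show ?thesis by (simp add: MT_boundary_def)
    qed
    finally show ?thesis by simp
  qed
  \<comment> \<open>Arbitrary sets of levels are needed because the edges lying in a given Borel set
    may have any levels; countable additivity assembles them from single ones.\<close>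
  have "(\<lambda>k. \<mu> (Z i ({k} \<inter> J))) sums \<mu> (Z i J)" if "i \<le> Suc 0" for i
  proof -
    have "(\<lambda>k. \<mu> (Z i ({k} \<inter> J))) sums \<mu> (\<Union>k. Z i ({k} \<inter> J))"
    proof (rule \<mu>.sums)
      show "range (\<lambda>k. Z i ({k} \<inter> J)) \<subseteq> sets (simplex_borel (Suc 0))" using Zsets[OF that] by blast
    qed (auto simp: disjoint_family_on_def Z_def)
    moreover have "(\<Union>k. Z i ({k} \<inter> J)) = Z i J" by (auto simp: Z_def)
    ultimately show ?thesis by simp
  qed
  from this[of 0] this[of 1] have "(\<lambda>k. \<mu> (Z 0 ({k} \<inter> J))) sums \<mu> (Z 0 J)" "(\<lambda>k. \<mu> (Z 1 ({k} \<inter> J))) sums \<mu> (Z 1 J)"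
    by auto
  moreover have "\<mu> (Z 0 ({k} \<inter> J)) = \<mu> (Z 1 ({k} \<inter> J))" for k
    using levels[of k] by (cases "k \<in> J") (auto simp: Z_def)
  ultimately show ?thesis using sums_unique2 by simp
qed

text \<open>Evaluated on \<open>A\<close>, the boundary of the filling is the integral of a simple
  function. On the carrier the contraction formula, tested against the indicator of
  \<open>A\<close>, replaces it by that indicator minus a pullback along faces; the integral of the
  pullback is an evaluation of \<open>\<partial>\<mu>\<close>, hence 0, up to edges in degree
  one.\<close>

lemma boundary_filling:
  assumes \<mu>: "\<mu> \<in> MT_chains (Suc n) X" and M: "M > 0"
    and K: "\<And>A. A \<in> MT_borel (Suc n) X \<Longrightarrow> A \<subseteq> S (Suc n) - K \<Longrightarrow> \<mu> A = 0"
    and KM: "\<And>\<sigma>. \<sigma> \<in> K \<Longrightarrow> spread M (Suc n) \<sigma>"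
    and cycle: "\<And>A. A \<in> MT_borel n X \<Longrightarrow> MT_boundary (Suc n) X \<mu> A = 0"
    and A: "A \<in> MT_borel (Suc n) X"
  shows "MT_boundary (Suc (Suc n)) X (filling M n \<mu>) A = \<mu> A"
proof -
  interpret \<mu>: signed_measure "simplex_borel (Suc n)" \<mu> by (rule signed_measure_chain[OF \<mu>])
  let ?N = "simplex_borel (Suc n)" and ?f = "singular_face (Suc n)" and ?F = "singular_face (Suc (Suc n))"
  have A': "A \<in> sets ?N" using A by (simp add: sets_simplex_borel)
  define B where "B l = {\<rho> \<in> S (Suc (Suc n)). ?F l \<rho> \<in> A}" for l
  have B: "B l \<in> sets (simplex_borel (Suc (Suc n)))" if "l \<le> Suc (Suc n)" for l
    unfolding B_def by (rule face_preimage_in_sets[OF that A'])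
  define H where "H l = {\<sigma> \<in> S (Suc n). base_cone M (Suc n) \<sigma> \<in> B l}" for l
  define W where "W l i = {\<sigma> \<in> upface M n i. double_cone M n (?f i \<sigma>) \<in> B l}" for l i
  have H: "H l \<in> sets ?N" if "l \<le> Suc (Suc n)" for l
    unfolding H_def by (rule base_cone_preimage_in_sets[OF M B[OF that]])
  have W: "W l i \<in> sets ?N" if "l \<le> Suc (Suc n)" "i \<le> Suc n" for l i
    unfolding W_def by (rule double_cone_preimage_in_sets[OF M that(2) B[OF that(1)]])
  define \<phi> :: "((nat \<Rightarrow> real) \<Rightarrow> 'a) \<Rightarrow> real" where
    "\<phi> = (\<lambda>\<sigma>. \<Sum>l\<in>{..Suc (Suc n)}. (-1) ^ l * (indicator (H l) \<sigma> - (\<Sum>i\<in>{..Suc n}. (-1) ^ i * indicator (W l i) \<sigma>)))"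
  have \<phi>: "simple_function ?N \<phi>" "MT_boundary (Suc (Suc n)) X (filling M n \<mu>) A = \<mu>.sint \<phi>"
  proof -
    note c = \<mu>.sint_indicator_combination[of "{..Suc (Suc n)}" "{..Suc n}" H W "\<lambda>l. (-1) ^ l" "\<lambda>i. (-1) ^ i"]
    show "simple_function ?N \<phi>" unfolding \<phi>_def by (rule c(1)) (use H W in auto)
    have "\<mu>.sint \<phi> = (\<Sum>l\<in>{..Suc (Suc n)}. (-1) ^ l * (\<mu> (H l) - (\<Sum>i\<in>{..Suc n}. (-1) ^ i * \<mu> (W l i))))"
      unfolding \<phi>_def by (rule c(2)) (use H W in auto)
    then show "MT_boundary (Suc (Suc n)) X (filling M n \<mu>) A = \<mu>.sint \<phi>"
      unfolding MT_boundary_def filling_def H_def W_def B_def by simp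
  qed
  have null: "\<mu> B = 0" if "B \<in> sets ?N" "B \<inter> K = {}" for B
    using that sets.sets_into_space[OF that(1)] by (intro K) (auto simp: sets_simplex_borel)
  have indA: "simple_function ?N (indicator A :: _ \<Rightarrow> real)" "\<mu>.sint (indicator A) = \<mu> A"
    using A' by (auto intro: simple_function_indicator \<mu>.sint_indicator)
  let ?a = "indicator A :: _ \<Rightarrow> real"
  have \<phi>_eq: "\<phi> \<sigma> = (\<Sum>l\<le>Suc (Suc n). (-1) ^ l * (?a (?F l (base_cone M (Suc n) \<sigma>)) -
        (\<Sum>i\<le>Suc n. (-1) ^ i * (of_bool (lev M n (?f i \<sigma>) = Suc (lev M (Suc n) \<sigma>)) * ?a (?F l (double_cone M n (?f i \<sigma>)))))))"
    if "\<sigma> \<in> S (Suc n)" for \<sigma>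
  proof -
    have 1: "indicator (H l) \<sigma> = ?a (?F l (base_cone M (Suc n) \<sigma>))" for l
      using that base_cone_in_S[OF M that] by (simp add: H_def B_def indicator_def)
    have 2: "indicator (W l i) \<sigma> = of_bool (lev M n (?f i \<sigma>) = Suc (lev M (Suc n) \<sigma>)) * ?a (?F l (double_cone M n (?f i \<sigma>)))"
      if "i \<le> Suc n" for l i
      using \<open>\<sigma> \<in> S (Suc n)\<close> double_cone_in_S[OF M face_in_S[OF \<open>\<sigma> \<in> S (Suc n)\<close> that]]
      by (simp add: W_def B_def upface_def indicator_def)
    show ?thesis unfolding \<phi>_def by (intro sum.cong refl) (simp add: 1 2 del: sum.atMost_Suc)
  qed
  have "\<mu>.sint \<phi> = \<mu> A"
  proof (cases n)
    case 0
    define C where "C i = {\<sigma> \<in> S (Suc 0). ?f i \<sigma> \<in> {\<rho> \<in> S 0. base_cone M 0 \<rho> \<in> A}}" for i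
    \<comment> \<open>An edge is determined by its level, so pulling \<open>A\<close> back along
      edges gives a condition on levels only.\<close>
    define D where "D i = {\<sigma> \<in> upface M 0 i. lev M 0 (?f i \<sigma>) \<in> {k. edge M k \<in> A}}" for i
    have C: "C i \<in> sets ?N" if "i \<le> Suc 0" for i
      using face_preimage_in_sets[OF that base_cone_preimage_in_sets[OF M, of A 0]] A' unfolding C_def 0 by simp
    have D: "D i \<in> sets ?N" if i: "i \<le> Suc 0" for i
    proof -
      have "(\<lambda>\<sigma>. lev M 0 (?f i \<sigma>)) \<in> measurable ?N (count_space UNIV)"
        unfolding 0 by (rule measurable_compose[OF measurable_face[OF i] measurable_lev[OF M]])
      then have "upface M 0 i \<inter> ((\<lambda>\<sigma>. lev M 0 (?f i \<sigma>)) -` {k. edge M k \<in> A} \<inter> space ?N) \<in> sets ?N"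
        using upface_in_sets[OF M i] 0 by (intro sets.Int measurable_sets) auto
      also have "upface M 0 i \<inter> ((\<lambda>\<sigma>. lev M 0 (?f i \<sigma>)) -` {k. edge M k \<in> A} \<inter> space ?N) = D i"
        using 0 by (auto simp: D_def upface_def)
      finally show ?thesis .
    qed
    \<comment> \<open>The one-element sum with coefficient -1 casts a plus sign into the common
      shape of the integrands.\<close>
    define \<psi> :: "((nat \<Rightarrow> real) \<Rightarrow> 'a) \<Rightarrow> real" where
      "\<psi> = (\<lambda>\<sigma>. \<Sum>i\<in>{..Suc 0}. (-1) ^ i * (indicator (C i) \<sigma> - (\<Sum>j\<in>{()}. (-1) * indicator (D i) \<sigma>)))"
    note c = \<mu>.sint_indicator_combination[of "{..Suc 0}" "{()}" C "\<lambda>i _. D i" "\<lambda>l. (-1) ^ l" "\<lambda>i. -1"]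
    have \<psi>: "simple_function ?N \<psi>" unfolding \<psi>_def by (rule c(1)) (use C D in auto)
    have \<psi>0: "\<mu>.sint \<psi> = (\<Sum>i\<in>{..Suc 0}. (-1) ^ i * (\<mu> (C i) - (\<Sum>j\<in>{()}. (-1) * \<mu> (D i))))"
      unfolding \<psi>_def by (rule c(2)) (use C D in auto)
    have "\<mu>.sint \<phi> = \<mu>.sint (\<lambda>\<sigma>. ?a \<sigma> - \<psi> \<sigma>)"
    proof (rule \<mu>.sint_cong_carrier[OF \<phi>(1) simple_function_diff[OF indA(1) \<psi>] null])
      fix \<sigma> assume \<sigma>: "\<sigma> \<in> space ?N" "\<sigma> \<in> K"
      then have \<sigma>S: "\<sigma> \<in> S (Suc n)" by simp
      have 1: "indicator (C i) \<sigma> = ?a (base_cone M 0 (?f i \<sigma>))" if "i \<le> Suc 0" for i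
        using \<sigma>S face_in_S[of \<sigma> 0 i] that by (simp add: C_def indicator_def 0)
      have 2: "indicator (D i) \<sigma> = of_bool (lev M 0 (?f i \<sigma>) = Suc (lev M (Suc 0) \<sigma>)) * ?a (edge M (lev M 0 (?f i \<sigma>)))" for i
        using \<sigma>S by (auto simp: D_def upface_def indicator_def 0)
      have "\<psi> \<sigma> = (\<Sum>i\<le>Suc 0. (-1) ^ i * (?a (base_cone M 0 (?f i \<sigma>)) +
          of_bool (lev M 0 (?f i \<sigma>) = Suc (lev M (Suc 0) \<sigma>)) * ?a (edge M (lev M 0 (?f i \<sigma>)))))"
        unfolding \<psi>_def by (intro sum.cong refl) (simp add: 1 2 0 del: sum.atMost_Suc)
      then show "\<phi> \<sigma> = ?a \<sigma> - \<psi> \<sigma>"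
        unfolding \<phi>_eq[OF \<sigma>S] using boundary_contraction_1[OF M, of \<sigma> ?a] KM[OF \<sigma>(2)] unfolding 0 by simp
    qed
    also have "\<dots> = \<mu> A - \<mu>.sint \<psi>" using \<mu>.sint_diff[OF indA(1) \<psi>] indA(2) by simp
    also have "\<mu>.sint \<psi> = 0"
    proof -
      have "MT_boundary (Suc 0) X \<mu> {\<rho> \<in> S 0. base_cone M 0 \<rho> \<in> A} = 0"
        using cycle[unfolded 0] base_cone_preimage_in_sets[OF M, of A 0] A' 0 by (simp add: sets_simplex_borel)
      then have "\<mu> (C 0) - \<mu> (C 1) = 0" unfolding C_def 0 by (simp add: MT_boundary_def)
      moreover have "\<mu> (D 0) = \<mu> (D 1)"
        unfolding D_def 0
        by (rule jumps_cancel[OF _ M, where K = K]) (use \<mu> K KM cycle 0 in auto)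
      ultimately show ?thesis unfolding \<psi>0 by simp
    qed
    finally show ?thesis by simp
  next
    case (Suc m)
    define HA where "HA = {\<tau> \<in> S n. base_cone M n \<tau> \<in> A}"
    define WA where "WA k = {\<tau> \<in> upface M m k. double_cone M m (singular_face (Suc m) k \<tau>) \<in> A}" for k
    have HA: "HA \<in> sets (simplex_borel n)" unfolding HA_def by (rule base_cone_preimage_in_sets[OF M A'])
    have WA: "WA k \<in> sets (simplex_borel n)" if "k \<le> n" for k
      using double_cone_preimage_in_sets[OF M, of k m A] that A' unfolding WA_def Suc by simp
    define C where "C i = {\<sigma> \<in> S (Suc n). ?f i \<sigma> \<in> HA}" for i
    define D where "D i k = {\<sigma> \<in> S (Suc n). ?f i \<sigma> \<in> WA k}" for i k
    have C: "C i \<in> sets ?N" if "i \<le> Suc n" for i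
      unfolding C_def by (rule face_preimage_in_sets[OF that HA])
    have D: "D i k \<in> sets ?N" if "i \<le> Suc n" "k \<le> n" for i k
      unfolding D_def by (rule face_preimage_in_sets[OF that(1) WA[OF that(2)]])
    define \<psi> :: "((nat \<Rightarrow> real) \<Rightarrow> 'a) \<Rightarrow> real" where
      "\<psi> = (\<lambda>\<sigma>. \<Sum>i\<in>{..Suc n}. (-1) ^ i * (indicator (C i) \<sigma> - (\<Sum>k\<in>{..n}. (-1) ^ k * indicator (D i k) \<sigma>)))"
    note c = \<mu>.sint_indicator_combination[of "{..Suc n}" "{..n}" C D "\<lambda>l. (-1) ^ l" "\<lambda>i. (-1) ^ i"]
    have \<psi>: "simple_function ?N \<psi>" unfolding \<psi>_def by (rule c(1)) (use C D in auto)
    have \<psi>0: "\<mu>.sint \<psi> = (\<Sum>i\<in>{..Suc n}. (-1) ^ i * (\<mu> (C i) - (\<Sum>k\<in>{..n}. (-1) ^ k * \<mu> (D i k))))"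
      unfolding \<psi>_def by (rule c(2)) (use C D in auto)
    have "\<mu>.sint \<phi> = \<mu>.sint (\<lambda>\<sigma>. ?a \<sigma> - \<psi> \<sigma>)"
    proof (rule \<mu>.sint_cong_carrier[OF \<phi>(1) simple_function_diff[OF indA(1) \<psi>] null])
      fix \<sigma> assume \<sigma>: "\<sigma> \<in> space ?N" "\<sigma> \<in> K"
      then have \<sigma>S: "\<sigma> \<in> S (Suc n)" by simp
      have 1: "indicator (C i) \<sigma> = ?a (base_cone M n (?f i \<sigma>))" if "i \<le> Suc n" for i
        using \<sigma>S face_in_S[OF \<sigma>S that] by (simp add: C_def HA_def indicator_def)
      have 2: "indicator (D i k) \<sigma> = of_bool (lev M m (singular_face (Suc m) k (?f i \<sigma>)) = Suc (lev M n (?f i \<sigma>))) *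
          ?a (double_cone M m (singular_face (Suc m) k (?f i \<sigma>)))" if "i \<le> Suc n" for i k
        using \<sigma>S face_in_S[OF \<sigma>S that] by (simp add: D_def WA_def upface_def indicator_def Suc)
      have "\<psi> \<sigma> = (\<Sum>i\<le>Suc n. (-1) ^ i * (?a (base_cone M n (?f i \<sigma>)) -
        (\<Sum>k\<le>n. (-1) ^ k * (of_bool (lev M m (singular_face (Suc m) k (?f i \<sigma>)) = Suc (lev M n (?f i \<sigma>))) *
          ?a (double_cone M m (singular_face (Suc m) k (?f i \<sigma>)))))))"
        unfolding \<psi>_def by (intro sum.cong refl) (simp add: 1 2 del: sum.atMost_Suc)
      then show "\<phi> \<sigma> = ?a \<sigma> - \<psi> \<sigma>"
        unfolding \<phi>_eq[OF \<sigma>S] using boundary_contraction[OF M, of m \<sigma> ?a] KM[OF \<sigma>(2)] unfolding Suc by (simp only:)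
    qed
    also have "\<dots> = \<mu> A - \<mu>.sint \<psi>" using \<mu>.sint_diff[OF indA(1) \<psi>] indA(2) by simp
    also have "\<mu>.sint \<psi> = 0"
    proof -
      have 1: "(\<Sum>i\<le>Suc n. (-1) ^ i * \<mu> (C i)) = 0"
        using cycle[of HA] HA unfolding C_def by (simp only: sets_simplex_borel MT_boundary_def)
      have 2: "(\<Sum>i\<le>Suc n. (-1) ^ i * \<mu> (D i k)) = 0" if "k \<le> n" for k
        using cycle[of "WA k"] WA[OF that] unfolding D_def by (simp only: sets_simplex_borel MT_boundary_def)
      have "\<mu>.sint \<psi> = (\<Sum>i\<le>Suc n. (-1) ^ i * \<mu> (C i)) - (\<Sum>i\<le>Suc n. \<Sum>k\<le>n. (-1) ^ k * ((-1) ^ i * \<mu> (D i k)))"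
        unfolding \<psi>0 by (simp only: right_diff_distrib sum_subtractf sum_distrib_left mult.left_commute)
      also have "(\<Sum>i\<le>Suc n. \<Sum>k\<le>n. (-1) ^ k * ((-1) ^ i * \<mu> (D i k))) =
          (\<Sum>k\<le>n. (-1) ^ k * (\<Sum>i\<le>Suc n. (-1) ^ i * \<mu> (D i k)))"
        unfolding sum_distrib_left by (rule sum.swap)
      also have "\<dots> = 0" by (intro sum.neutral ballI) (simp only: 2 atMost_iff mult_zero_right)
      finally show ?thesis using 1 by simp
    qed
    finally show ?thesis by simp
  qed
  then show ?thesis using \<phi>(2) by simp
qed

theorem MT_homology_trivial_Suc: "MT_homology_trivial (Suc n) X"
  unfolding MT_homology_trivial_def
proof (intro ballI impI)
  fix \<mu> assume \<mu>: "\<mu> \<in> MT_chains (Suc n) X" and cycle: "\<forall>A\<in>MT_borel (Suc n - 1) X. MT_boundary (Suc n) X \<mu> A = 0"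
  obtain K where K: "compactin (compact_open_top (Suc n) X) K"
    "\<And>A. A \<in> MT_borel (Suc n) X \<Longrightarrow> A \<subseteq> S (Suc n) - K \<Longrightarrow> \<mu> A = 0"
    using \<mu> unfolding MT_chains_def by blast
  have KS: "K \<subseteq> S (Suc n)" using compactin_subset_topspace[OF K(1)] by simp
  have "equicont (Suc n) ((\<lambda>\<sigma>. g \<circ> \<sigma>) ` K)"
    by (rule equicont_lift[OF KS compactin_imp_equicont[OF K(1)]])
  then obtain m :: nat where m: "\<And>f s t. f \<in> (\<lambda>\<sigma>. g \<circ> \<sigma>) ` K \<Longrightarrow> s \<in> standard_simplex (Suc n) \<Longrightarrow>
      t \<in> standard_simplex (Suc n) \<Longrightarrow> \<bar>f s - f t\<bar> \<le> real m"
    by (rule equicont_bounded_spread) (rule that)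
  \<comment> \<open>The successor makes \<open>M\<close> positive even if every lift in the carrier
    is constant.\<close>
  define M where "M = real (Suc m)"
  have M: "M > 0" by (simp add: M_def)
  have KM: "spread M (Suc n) \<sigma>" if "\<sigma> \<in> K" for \<sigma>
    using m[of "g \<circ> \<sigma>"] that KS unfolding spread_def M_def by fastforce
  show "\<exists>\<nu>\<in>MT_chains (Suc (Suc n)) X. \<forall>A\<in>MT_borel (Suc n) X. MT_boundary (Suc (Suc n)) X \<nu> A = \<mu> A"
  proof (intro bexI ballI)
    show "filling M n \<mu> \<in> MT_chains (Suc (Suc n)) X"
      by (rule filling_in_chains[OF \<mu> M K KM])
    show "MT_boundary (Suc (Suc n)) X (filling M n \<mu>) A = \<mu> A" if "A \<in> MT_borel (Suc n) X" for A
      by (rule boundary_filling[OF \<mu> M K(2) KM _ that]) (use cycle in auto)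
  qed
qed

end

subsection \<open>The Warsaw circle\<close>

text \<open>On the sine part the parameter is \<open>1 / x\<close> shifted so that the rightmost
  minimum, \<open>1 / x = 3 * pi / 2\<close>, comes at time 2. The oscillation then has constant
  period, which gives uniform continuity and the uniform lifting property.\<close>

definition warsaw_path :: "(real \<Rightarrow> real \<times> real) \<Rightarrow> real \<Rightarrow> real \<times> real" where
  "warsaw_path \<gamma> s =
     (if s \<le> 1 then (0, 1 - 2 * s)
      else if s \<le> 2 then \<gamma> (s - 1)
      else (1 / (s - 2 + 3 * pi / 2), sin (s - 2 + 3 * pi / 2)))"

text \<open>Two points do not suffice, since the sine agrees at points symmetric about an extremum.
  With three, the second difference \<open>2 * sin (s + h) * (1 - cos h)\<close> and the difference
  of the outer values \<open>2 * cos (s + h) * sin h\<close> would both be small, forcing sine and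
  cosine at \<open>s + h\<close> below \<open>1/2\<close> in absolute value.\<close>

lemma three_sines_apart:
  assumes h: "0 < h" "h \<le> (1::real)"
  defines "m \<equiv> min (1 - cos h) (sin h)"
  shows "m > 0"
    and "\<bar>sin s - sin (s + h)\<bar> \<ge> m / 3 \<or> \<bar>sin s - sin (s + 2 * h)\<bar> \<ge> m / 3"
proof -
  have pi: "h < pi" "h < 2 * pi" using h pi_gt3 by auto
  then have m: "m > 0" "m \<le> 1 - cos h" "m \<le> sin h"
    using sin_gt_zero[of h] cos_monotone_0_pi[of 0 h] h(1) by (auto simp: m_def)
  then show "m > 0" by simp
  show "\<bar>sin s - sin (s + h)\<bar> \<ge> m / 3 \<or> \<bar>sin s - sin (s + 2 * h)\<bar> \<ge> m / 3"
  proof (rule ccontr)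
    let ?S = "sin (s + h)" and ?C = "cos (s + h)"
    assume "\<not> ?thesis"
    then have d: "\<bar>sin s - ?S\<bar> < m / 3" "\<bar>sin s - sin (s + 2 * h)\<bar> < m / 3" by auto
    have e1: "sin (s + 2 * h) = ?S * cos h + ?C * sin h"
      using sin_add[of "s + h" h] by (simp add: add.assoc)
    have e2: "sin s = ?S * cos h - ?C * sin h"
      using sin_diff[of "s + h" h] by simp
    have "2 * (?S * (1 - cos h)) = (2 * ?S - sin s) - sin (s + 2 * h)"
      unfolding e1 e2 by (simp add: algebra_simps)
    then have "2 * \<bar>?S * (1 - cos h)\<bar> < m"
      using d by linarith
    then have "2 * (\<bar>?S\<bar> * (1 - cos h)) < m"
      using m by (simp add: abs_mult)
    moreover have "\<bar>?S\<bar> * m \<le> \<bar>?S\<bar> * (1 - cos h)" using m by (intro mult_left_mono) auto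
    ultimately have "(2 * \<bar>?S\<bar>) * m < 1 * m" by simp
    then have S: "\<bar>?S\<bar> < 1 / 2" using mult_less_cancel_right_pos[OF m(1), of "2 * \<bar>?S\<bar>" 1] by simp
    have "2 * (?C * sin h) = sin (s + 2 * h) - sin s"
      unfolding e1 e2 by simp
    then have "2 * \<bar>?C * sin h\<bar> < m / 3" using d by linarith
    then have "2 * (\<bar>?C\<bar> * sin h) < m / 3" using m by (simp add: abs_mult)
    moreover have "\<bar>?C\<bar> * m \<le> \<bar>?C\<bar> * sin h" using m by (intro mult_left_mono) auto
    ultimately have "(2 * \<bar>?C\<bar>) * m < 1 * m" using m(1) by linarith
    then have C: "\<bar>?C\<bar> < 1 / 2" using mult_less_cancel_right_pos[OF m(1), of "2 * \<bar>?C\<bar>" 1] by simp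
    have "\<bar>?S\<bar>\<^sup>2 < (1/2)\<^sup>2" "\<bar>?C\<bar>\<^sup>2 < (1/2)\<^sup>2"
      by (intro power_strict_mono S C; simp)+
    then show False using sin_cos_squared_add[of "s + h"] by (simp add: power_divide)
  qed
qed

text \<open>Multiplied by \<open>x\<close>, the equation of the curve becomes continuous and turns
  void at \<open>x = 0\<close>, where it admits the whole segment.\<close>

lemma compact_sine_tail:
  assumes "c > 0"
  shows "compact {(x, y). 0 \<le> x \<and> x \<le> c \<and> -1 \<le> y \<and> y \<le> (1::real) \<and> (x = (0::real) \<or> y = sin (1 / x))}"
proof -
  have cont: "continuous_on UNIV (\<lambda>x::real. x * sin (1 / x))"
  proof -
    have "isCont (\<lambda>x::real. x * sin (1 / x)) x" for x
    proof (cases "x = 0")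
      case True
      have "((\<lambda>x::real. x * sin (1 / x)) \<longlongrightarrow> 0) (at 0)"
      proof (rule Lim_null_comparison)
        show "\<forall>\<^sub>F x in at 0. norm (x * sin (1 / x)) \<le> \<bar>x\<bar>" 
          by (intro always_eventually allI) (simp add: abs_mult mult_left_le)
        show "((\<lambda>x::real. \<bar>x\<bar>) \<longlongrightarrow> 0) (at 0)" by (auto intro!: tendsto_eq_intros)
      qed
      then show ?thesis using True by (simp add: isCont_def)
    qed (auto intro!: continuous_intros)
    then show ?thesis by (simp add: continuous_at_imp_continuous_on)
  qed
  have "{(x, y). 0 \<le> x \<and> x \<le> c \<and> -1 \<le> y \<and> y \<le> 1 \<and> (x = 0 \<or> y = sin (1 / x))} =
    ({0..c} \<times> {-1..1}) \<inter> {z. fst z * snd z = fst z * sin (1 / fst z)}"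
    by auto
  moreover have "closed {z::real \<times> real. fst z * snd z = fst z * sin (1 / fst z)}"
    by (intro closed_Collect_eq continuous_intros continuous_on_compose2[OF cont]) auto
  ultimately show ?thesis by (simp add: compact_Int_closed compact_Times)
qed

section \<open>The parametrisation of the Warsaw circle\<close>

locale warsaw =
  fixes \<gamma> :: "real \<Rightarrow> real \<times> real"
  assumes arc: "arc \<gamma>"
    and start: "pathstart \<gamma> = (0, -1)"
    and finish: "pathfinish \<gamma> = (2 / (3 * pi), -1)"
    and meet: "path_image \<gamma> \<inter> (sine_part \<union> limit_segment) = {(0, -1), (2 / (3 * pi), -1)}"
begin

abbreviation "q \<equiv> warsaw_path \<gamma>"

lemma gamma_0: "\<gamma> 0 = (0, -1)" using start by (simp add: pathstart_def)
lemma gamma_1: "\<gamma> 1 = (2 / (3 * pi), -1)" using finish by (simp add: pathfinish_def)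

lemma sin_3pi_half: "sin (3 * pi / 2) = -1"
proof -
  have "sin (3 * pi / 2) = sin (pi / 2 + pi)" by (rule arg_cong[of _ _ sin]) simp
  then show ?thesis by (simp only: sin_periodic_pi) simp
qed

lemma q_segment: "s \<le> 1 \<Longrightarrow> q s = (0, 1 - 2 * s)"
  by (simp add: warsaw_path_def)

lemma q_arc: "1 \<le> s \<Longrightarrow> s \<le> 2 \<Longrightarrow> q s = \<gamma> (s - 1)"
  using gamma_0 by (cases "s = 1") (auto simp: warsaw_path_def)

lemma q_sine:
  assumes "2 \<le> s"
  shows "q s = (1 / (s - 2 + 3 * pi / 2), sin (s - 2 + 3 * pi / 2))"
  using assms gamma_1 sin_3pi_half by (cases "s = 2") (auto simp: warsaw_path_def)

lemma pos_arg: "2 \<le> s \<Longrightarrow> 1 < s - 2 + 3 * pi / 2"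
  using pi_gt3 by simp

lemma q_image_segment: "q ` {0..1} = limit_segment"
proof -
  have "(\<lambda>s. (0::real, 1 - 2 * s)) ` {0..1} = limit_segment"
    unfolding limit_segment_def
    by (auto simp: image_iff) (rule_tac x = "(1 - y) / 2" in bexI; simp add: field_simps)
  then show ?thesis by (simp add: q_segment)
qed

lemma q_image_arc: "q ` {1..2} = path_image \<gamma>"
proof -
  have "q ` {1..2} = \<gamma> ` (\<lambda>s. s - 1) ` {1..2}"
    unfolding image_image by (intro image_cong) (simp_all add: q_arc)
  also have "(\<lambda>s::real. s - 1) ` {1..2} = {0..1}"
    using image_add_atLeastAtMost[of "-1" 1 "2::real"] by simp
  finally show ?thesis by (simp add: path_image_def)
qed

lemma q_image_tail:
  assumes b: "2 \<le> b"
  shows "q ` {b..} = {(x, sin (1 / x)) | x. 0 < x \<and> x \<le> 1 / (b - 2 + 3 * pi / 2)}" (is "_ = ?R")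
proof
  show "q ` {b..} \<subseteq> ?R"
  proof
    fix z assume "z \<in> q ` {b..}"
    then obtain s where s: "s \<ge> b" "z = q s" by auto
    then have "z = (1 / (s - 2 + 3 * pi / 2), sin (1 / (1 / (s - 2 + 3 * pi / 2))))"
      using b q_sine[of s] by simp
    moreover have "0 < 1 / (s - 2 + 3 * pi / 2)" "1 / (s - 2 + 3 * pi / 2) \<le> 1 / (b - 2 + 3 * pi / 2)"
      using pos_arg[of s] pos_arg[of b] b s by (auto intro!: divide_left_mono mult_pos_pos)
    ultimately show "z \<in> ?R" by blast
  qed
  show "?R \<subseteq> q ` {b..}"
  proof
    fix z assume "z \<in> ?R"
    then obtain x where x: "z = (x, sin (1 / x))" "0 < x" "x \<le> 1 / (b - 2 + 3 * pi / 2)" by blast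
    let ?s = "1 / x + 2 - 3 * pi / 2"
    have "b - 2 + 3 * pi / 2 \<le> 1 / x" using x(2,3) pos_arg[OF b] by (simp add: field_simps)
    then have "?s \<ge> b" by linarith
    moreover have "q ?s = z" using q_sine[of ?s] calculation b x(1) by simp
    ultimately show "z \<in> q ` {b..}" by (metis atLeast_iff image_eqI)
  qed
qed

lemma q_image_sine: "q ` {2..} = sine_part"
  using q_image_tail[of 2] by (simp add: sine_part_def)

lemma q_image: "q ` {0..} = warsaw_circle \<gamma>"
proof -
  have "{0..} = {0..1} \<union> {1..2} \<union> {2::real..}" by auto
  then show ?thesis
    unfolding warsaw_circle_def by (simp only: image_Un q_image_segment q_image_arc q_image_sine) blast
qed

lemma inj_q: "inj_on q {0..}"
proof -
  \<comment> \<open>The arc meets the rest only at its ends. Its start belongs to time 1, so only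
    \<open>s = 2\<close> is left, and no other time reaches that point: the segment has abscissa 0,
    and the sine part has a smaller one after time 2.\<close>
  have arc_sep: False
    if s: "1 < s" "s \<le> 2" and u: "u \<in> {0..1} \<union> {2<..}" and eq: "q s = q u" for s u
  proof -
    have "q s \<in> path_image \<gamma>" using q_image_arc s by (metis atLeastAtMost_iff image_eqI less_imp_le)
    moreover have "q u \<in> sine_part \<union> limit_segment"
      using u q_image_sine q_image_segment by (metis Un_iff atLeast_iff greaterThan_iff image_eqI less_imp_le)
    ultimately have "q s \<in> {(0, -1), (2 / (3 * pi), -1)}" using meet eq by auto
    then have "\<gamma> (s - 1) = \<gamma> 0 \<or> \<gamma> (s - 1) = \<gamma> 1" using q_arc[of s] s gamma_0 gamma_1 by auto
    then have s2: "s = 2" using arc s unfolding arc_def inj_on_def by fastforce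
    then have qu: "q u = (2 / (3 * pi), -1)" using eq q_arc[of 2] gamma_1 by simp
    show False
    proof (cases "u \<le> 1")
      case True
      then show False using qu q_segment[of u] by simp
    next
      case False
      then have "u > 2" using u by auto
      then have "1 / (u - 2 + 3 * pi / 2) < 1 / (3 * pi / 2)" by (intro divide_strict_left_mono) (auto intro!: mult_pos_pos add_pos_pos)
      then show False using qu q_sine[of u] \<open>u > 2\<close> by simp
    qed
  qed
  have seg_sine: False if "s \<le> 1" "u > 2" "q s = q u" for s u
    using that q_segment[of s] q_sine[of u] pos_arg[of u] by auto
  have "s = u" if s: "s \<ge> 0" and u: "u \<ge> 0" and eq: "q s = q u" for s u
  proof -
    consider "s \<le> 1" | "1 < s" "s \<le> 2" | "s > 2" by linarith
    then show ?thesis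
    proof cases
      case 1
      consider "u \<le> 1" | "1 < u" "u \<le> 2" | "u > 2" by linarith
      then show ?thesis
      proof cases
        case 1
        then show ?thesis using eq \<open>s \<le> 1\<close> by (simp add: q_segment)
      next
        case 2
        then show ?thesis using arc_sep[of u s] eq \<open>s \<le> 1\<close> s by simp
      next
        case 3
        then show ?thesis using seg_sine[of s u] eq \<open>s \<le> 1\<close> by simp
      qed
    next
      case 2
      show ?thesis
      proof (cases "1 < u \<and> u \<le> 2")
        case True
        then have "\<gamma> (s - 1) = \<gamma> (u - 1)" using eq q_arc[of s] q_arc[of u] 2 by simp
        moreover have "inj_on \<gamma> {0..1}" using arc by (simp add: arc_def)
        ultimately have "s - 1 = u - 1" using 2 True by (intro inj_onD[of \<gamma> "{0..1}"]) auto
        then show ?thesis by simp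
      next
        case False
        then show ?thesis using arc_sep[of s u] eq 2 u by auto
      qed
    next
      case 3
      consider "u \<le> 1" | "1 < u" "u \<le> 2" | "u > 2" by linarith
      then show ?thesis
      proof cases
        case 1
        then show ?thesis using seg_sine[of u s] eq 3 by simp
      next
        case 2
        then show ?thesis using arc_sep[of u s] eq 3 by simp
      next
        case 3
        then show ?thesis
          using eq q_sine[of s] q_sine[of u] pos_arg[of s] pos_arg[of u] \<open>s > 2\<close> by simp
      qed
    qed
  qed
  then show ?thesis by (auto intro: inj_onI)
qed

section \<open>Uniform continuity and compactness\<close>

lemma sin_lipschitz: "\<bar>sin x - sin y\<bar> \<le> \<bar>x - (y::real)\<bar>"
proof -
  have "norm (sin x - sin y) \<le> 1 * norm (x - y)"
    by (rule field_differentiable_bound[of UNIV sin cos])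
       (auto intro!: derivative_eq_intros)
  then show ?thesis by simp
qed

text \<open>Both coordinates have Lipschitz constant 1 in the parameter, the first because the
  argument of the reciprocal exceeds 1.\<close>

lemma dist_q_sine:
  assumes "2 \<le> s" "2 \<le> u"
  shows "dist (q s) (q u) \<le> 2 * \<bar>s - u\<bar>"
proof -
  let ?s = "s - 2 + 3 * pi / 2" and ?u = "u - 2 + 3 * pi / 2"
  have p: "1 < ?s" "1 < ?u" using pos_arg assms by auto
  have "dist (q s) (q u) \<le> dist (1 / ?s) (1 / ?u) + dist (sin ?s) (sin ?u)"
    unfolding q_sine[OF assms(1)] q_sine[OF assms(2)] dist_Pair_Pair
    by (rule sqrt_sum_squares_le_sum) simp_all
  moreover have "dist (1 / ?s) (1 / ?u) \<le> \<bar>s - u\<bar>"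
  proof -
    have "1 / ?s - 1 / ?u = (u - s) / (?s * ?u)" using p by (simp add: field_simps)
    then have "\<bar>1 / ?s - 1 / ?u\<bar> = \<bar>u - s\<bar> / (?s * ?u)" using p by (simp add: abs_mult)
    also have "\<dots> \<le> \<bar>u - s\<bar> / 1" using less_1_mult[OF p] by (intro divide_left_mono) auto
    finally show ?thesis by (simp add: dist_real_def abs_minus_commute)
  qed
  moreover have "dist (sin ?s) (sin ?u) \<le> \<bar>s - u\<bar>" using sin_lipschitz[of ?s ?u] by (simp add: dist_real_def)
  ultimately have "dist (q s) (q u) \<le> \<bar>s - u\<bar> + \<bar>s - u\<bar>" by (meson add_mono order_trans)
  then show ?thesis by simp
qed

lemma continuous_on_q: "continuous_on {0..} q"
proof -
  have "continuous_on {0..1} q"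
    by (rule continuous_on_eq[of _ "\<lambda>s. (0, 1 - 2 * s)"]) (auto intro!: continuous_intros simp: q_segment)
  moreover have "continuous_on {1..2} q"
  proof (rule continuous_on_eq[of _ "\<lambda>s. \<gamma> (s - 1)"])
    show "continuous_on {1..2} (\<lambda>s. \<gamma> (s - 1))"
    proof (rule continuous_on_compose2[of "{0..1}" \<gamma>])
      show "continuous_on {0..1} \<gamma>" using arc by (simp add: arc_def path_def)
    qed (auto intro!: continuous_intros)
  qed (auto simp: q_arc)
  moreover have "continuous_on {2..} q"
    by (rule continuous_on_eq[of _ "\<lambda>s. (1 / (s - 2 + 3 * pi / 2), sin (s - 2 + 3 * pi / 2))"])
       (use pos_arg in \<open>fastforce intro!: continuous_intros simp: q_sine\<close>)+
  ultimately have "continuous_on (({0..1} \<union> {1..2}) \<union> {2..}) q"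
    by (intro continuous_on_closed_Un) auto
  moreover have "({0..1} \<union> {1..2}) \<union> {2..} = {0::real..}" by auto
  ultimately show ?thesis by simp
qed

lemma uc_q: "uniformly_continuous_on {0..} q"
  unfolding uniformly_continuous_on_def
proof (intro allI impI)
  fix e :: real assume e: "e > 0"
  \<comment> \<open>The compact interval overlaps the sine part, so two times less than 1 apart lie
    both in it or both on the sine part.\<close>
  have "uniformly_continuous_on {0..4} q"
    by (rule compact_uniformly_continuous) (auto intro: continuous_on_subset[OF continuous_on_q])
  then obtain d where d: "d > 0" "\<And>s u. s \<in> {0..4} \<Longrightarrow> u \<in> {0..4} \<Longrightarrow> dist s u < d \<Longrightarrow> dist (q s) (q u) < e"
    using e unfolding uniformly_continuous_on_def by metis
  have "dist (q s) (q u) < e" if "s \<ge> 0" "u \<ge> 0" "dist s u < min (min d 1) (e / 2)" for s u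
  proof (cases "s \<le> 4 \<and> u \<le> 4")
    case True
    then show ?thesis using d(2) that by auto
  next
    case False
    then have "2 \<le> s" "2 \<le> u" using that by (auto simp: dist_real_def)
    from dist_q_sine[OF this] show ?thesis using that by (simp add: dist_real_def)
  qed
  then show "\<exists>d>0. \<forall>s\<in>{0..}. \<forall>u\<in>{0..}. dist u s < d \<longrightarrow> dist (q u) (q s) < e"
    using e d(1) by (intro exI[of _ "min (min d 1) (e / 2)"]) auto
qed

lemma compact_tail_segment:
  assumes "2 \<le> b"
  shows "compact (q ` {b..} \<union> limit_segment)"
proof -
  let ?c = "1 / (b - 2 + 3 * pi / 2)"
  have "q ` {b..} \<union> limit_segment =
    {(x, y). 0 \<le> x \<and> x \<le> ?c \<and> -1 \<le> y \<and> y \<le> 1 \<and> (x = 0 \<or> y = sin (1 / x))}"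
    unfolding q_image_tail[OF assms] limit_segment_def using pos_arg[OF assms] by auto
  then show ?thesis using compact_sine_tail[of ?c] pos_arg[OF assms] by simp
qed

lemma compact_q_interval: "0 \<le> a \<Longrightarrow> compact (q ` {a..b})"
  by (intro compact_continuous_image continuous_on_subset[OF continuous_on_q]) auto

lemma compact_warsaw_circle: "compact (warsaw_circle \<gamma>)"
proof -
  have "warsaw_circle \<gamma> = (q ` {2..} \<union> limit_segment) \<union> q ` {1..2}"
    unfolding warsaw_circle_def q_image_sine q_image_arc by blast
  then show ?thesis using compact_tail_segment[of 2] compact_q_interval[of 1 2] by (simp add: compact_Un)
qed

text \<open>A hump without its ends is open in the circle, and its closure adds only the ends.\<close>

lemma connected_in_hump:
  assumes T: "T \<subseteq> {0..}" "connected (q ` T)" and ab: "2 \<le> a" "a < b"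
    and ends: "a \<notin> T" "b \<notin> T" and s: "s \<in> T" "a < s" "s < b"
  shows "T \<subseteq> {a<..<b}"
proof -
  define A where "A = q ` {a..b}"
  \<comment> \<open>The segment is added because the tail accumulates there, which makes
    \<open>B\<close> closed; since it already belongs to the image of \<open>{0..a}\<close>, the set
    itself does not grow.\<close>
  define B where "B = q ` {0..a} \<union> (q ` {b..} \<union> limit_segment)"
  have "closed A" "closed B"
    unfolding A_def B_def using ab
    by (intro compact_imp_closed closed_Un compact_q_interval compact_tail_segment; simp)+
  have "limit_segment \<subseteq> q ` {0..a}" unfolding q_image_segment[symmetric] using ab by (intro image_mono) auto
  then have B: "B = q ` ({0..a} \<union> {b..})" unfolding B_def by auto
  have inT: "u \<in> U" if "u \<in> T" "q u \<in> q ` U" "U \<subseteq> {0..}" for u U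
    using inj_q that T(1) by (meson inj_on_image_mem_iff subsetD)
  have "A \<inter> B \<inter> q ` T = {}"
  proof -
    have False if "u \<in> T" "q u \<in> A" "q u \<in> B" for u
    proof -
      have "u \<in> {a..b}" using inT[of u "{a..b}"] that ab unfolding A_def by auto
      moreover have "u \<in> {0..a} \<union> {b..}" using inT[of u "{0..a} \<union> {b..}"] that ab unfolding B by auto
      ultimately have "u = a \<or> u = b" by auto
      then show False using ends that(1) by auto
    qed
    then show ?thesis by blast
  qed
  moreover have "q ` T \<subseteq> A \<union> B"
    unfolding A_def B image_Un[symmetric] using T(1) ab by (intro image_mono) auto
  ultimately have "A \<inter> q ` T = {} \<or> B \<inter> q ` T = {}"
    by (rule connected_closedD[OF T(2) _ _ \<open>closed A\<close> \<open>closed B\<close>])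
  moreover have "q s \<in> A \<inter> q ` T" using s unfolding A_def by auto
  ultimately have BT: "B \<inter> q ` T = {}" by blast
  show ?thesis
  proof
    fix u assume u: "u \<in> T"
    then have "q u \<notin> B" using BT by blast
    then have "u \<notin> {0..a} \<union> {b..}" unfolding B by blast
    then show "u \<in> {a<..<b}" using T(1) u by auto
  qed
qed

text \<open>A set of diameter less than 1 cannot touch both heights -1 and 1. It therefore misses
  all maxima or all minima of the sine curve, and either kind cuts the tail into humps of bounded
  length.\<close>

lemma small_connected_bounded:
  assumes T: "T \<subseteq> {0..}" "connected (q ` T)" and diam: "\<And>s u. s \<in> T \<Longrightarrow> u \<in> T \<Longrightarrow> dist (q s) (q u) < 1"
  shows "\<exists>c. T \<subseteq> {0..c}"
proof -
  have avoid: "\<exists>c. T \<subseteq> {0..c}"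
    if a: "2 \<le> a0" and y: "\<And>j::nat. a0 + 2 * pi * j \<notin> T" for a0
  proof (cases "\<exists>s\<in>T. s > a0")
    case True
    then obtain s where s: "s \<in> T" "s > a0" by blast
    define j where "j = nat \<lfloor>(s - a0) / (2 * pi)\<rfloor>"
    have "0 \<le> (s - a0) / (2 * pi)" using s by simp
    then have "real j \<le> (s - a0) / (2 * pi)" "(s - a0) / (2 * pi) < real j + 1"
      unfolding j_def by linarith+
    then have "2 * pi * real j \<le> s - a0" "s - a0 < 2 * pi * (real j + 1)"
      by (simp_all add: field_simps)
    then have lu: "a0 + 2 * pi * real j \<le> s" "s < a0 + 2 * pi * real (Suc j)"
      by (simp_all add: algebra_simps)
    moreover have "a0 + 2 * pi * real j \<noteq> s" using y[of j] s by auto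
    ultimately have "T \<subseteq> {a0 + 2 * pi * real j<..<a0 + 2 * pi * real (Suc j)}"
      using a y[of j] y[of "Suc j"] s(1)
      by (intro connected_in_hump[OF T, of _ _ s]) (auto intro: add_increasing2)
    then show ?thesis using T(1) by (intro exI[of _ "a0 + 2 * pi * real (Suc j)"]) (auto simp: subset_iff)
  next
    case False
    then show ?thesis using T(1) by (intro exI[of _ a0]) (auto simp: not_less subset_iff)
  qed
  have snd_q: "snd (q (2 + c + 2 * pi * real j)) = sin (3 * pi / 2 + c)" if "c \<ge> 0" for c and j :: nat
  proof -
    have "2 \<le> 2 + c + 2 * pi * real j" using that by simp
    from q_sine[OF this] have "snd (q (2 + c + 2 * pi * real j)) = sin ((3 * pi / 2 + c) + 2 * real j * pi)"
      by (simp add: algebra_simps)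
    then show ?thesis by (simp add: sin_add[of "3 * pi / 2 + c"])
  qed
  show ?thesis
  \<comment> \<open>Minima come at times \<open>2 + 2 * pi * j\<close> and maxima at
    \<open>2 + pi + 2 * pi * j\<close>; the kind that \<open>T\<close> misses is fed to
    \<open>avoid\<close>.\<close>
  proof (cases "\<exists>s\<in>T. snd (q s) \<le> -1")
    case True
    then obtain s where s: "s \<in> T" "snd (q s) \<le> -1" by blast
    have "snd (q u) < 1" if "u \<in> T" for u
      using diam[OF s(1) that] dist_snd_le[of "q s" "q u"] s(2) by (auto simp: dist_real_def)
    moreover have "sin (3 * pi / 2 + pi) = 1" using sin_periodic_pi[of "3 * pi / 2"] sin_3pi_half by simp
    ultimately have "2 + pi + 2 * pi * real j \<notin> T" for j
      using snd_q[of pi j] by fastforce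
    then show ?thesis by (intro avoid[of "2 + pi"]) auto
  next
    case False
    moreover have "snd (q (2 + 2 * pi * real j)) = -1" for j using snd_q[of 0 j] sin_3pi_half by simp
    ultimately have "2 + 2 * pi * real j \<notin> T" for j by (metis order_refl)
    then show ?thesis by (intro avoid[of 2]) auto
  qed
qed

text \<open>Up to time 2, injectivity and compactness bound the displacement from below; afterwards
  the second coordinate is a sine of the time, and three equally spaced values of it cannot be close
  together.\<close>

lemma q_moves:
  assumes e: "e > 0"
  obtains d where "d > 0" "\<And>s. s \<ge> 0 \<Longrightarrow> \<exists>v\<in>{s..s + e}. dist (q s) (q v) \<ge> d"
proof -
  have "continuous_on {0..2} (\<lambda>s. dist (q s) (q (s + e)))"
    using e by (intro continuous_intros continuous_on_compose2[OF continuous_on_q]) auto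
  then obtain s0 where s0: "s0 \<in> {0..2}" "\<And>s. s \<in> {0..2} \<Longrightarrow> dist (q s0) (q (s0 + e)) \<le> dist (q s) (q (s + e))"
    using continuous_attains_inf[of "{0..2}" "\<lambda>s. dist (q s) (q (s + e))"] by auto
  define d1 where "d1 = dist (q s0) (q (s0 + e))"
  have "q s0 \<noteq> q (s0 + e)" using inj_q s0(1) e unfolding inj_on_def by fastforce
  then have d1: "d1 > 0" by (simp add: d1_def)
  \<comment> \<open>Both sample times \<open>s + h\<close> and \<open>s + 2 * h\<close> must fall in
    the window of length \<open>e\<close>, and \<open>h \<le> 1\<close> is the range of
    \<open>three_sines_apart\<close>.\<close>
  define h where "h = min (e / 2) 1"
  have h: "0 < h" "h \<le> 1" "2 * h \<le> e" using e by (auto simp: h_def)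
  define d2 where "d2 = min (1 - cos h) (sin h) / 3"
  have d2: "d2 > 0" using three_sines_apart(1)[OF h(1,2)] by (simp add: d2_def)
  have "\<exists>v\<in>{s..s + e}. dist (q s) (q v) \<ge> min d1 d2" if s: "s \<ge> 0" for s
  proof (cases "s \<le> 2")
    case True
    then show ?thesis using s0(2)[of s] s e by (intro bexI[of _ "s + e"]) (auto simp: d1_def)
  next
    case False
    let ?s = "s - 2 + 3 * pi / 2"
    have sn: "snd (q (s + u)) = sin (?s + u)" if "u \<ge> 0" for u
      using q_sine[of "s + u"] False that by (simp add: algebra_simps)
    have "\<bar>sin ?s - sin (?s + h)\<bar> \<ge> d2 \<or> \<bar>sin ?s - sin (?s + 2 * h)\<bar> \<ge> d2"
      using three_sines_apart(2)[OF h(1,2)] by (simp add: d2_def)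
    then obtain u where u: "u \<in> {h, 2 * h}" "\<bar>sin ?s - sin (?s + u)\<bar> \<ge> d2" by blast
    then have "dist (snd (q s)) (snd (q (s + u))) \<ge> d2"
      using sn[of 0] sn[of u] h by (auto simp: dist_real_def)
    then have "dist (q s) (q (s + u)) \<ge> d2" using dist_snd_le[of "q s" "q (s + u)"] by linarith
    then show ?thesis using u(1) h by (intro bexI[of _ "s + u"]) auto
  qed
  then show ?thesis using that[of "min d1 d2"] d1 d2 by simp
qed

text \<open>Smallness bounds \<open>T\<close>, and on a bounded parameter interval \<open>q\<close>
  is a homeomorphism onto its image, so \<open>T\<close> is itself connected. If it contained points
  \<open>e\<close> apart, it would contain the interval in which \<open>q\<close> has to move by
  \<open>d\<close>.\<close>

lemma lift_q:
  assumes e: "e > 0"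
  shows "\<exists>d>0. \<forall>T\<subseteq>{0..}. connected (q ` T) \<longrightarrow>
      (\<forall>s\<in>T. \<forall>u\<in>T. dist (q s) (q u) < d) \<longrightarrow> (\<forall>s\<in>T. \<forall>u\<in>T. dist s u < e)"
proof -
  obtain d where d: "d > 0" "\<And>s. s \<ge> 0 \<Longrightarrow> \<exists>v\<in>{s..s + e}. dist (q s) (q v) \<ge> d"
    using q_moves[OF e] by metis
  have "dist s u < e"
    if T: "T \<subseteq> {0..}" "connected (q ` T)" and small: "\<forall>s\<in>T. \<forall>u\<in>T. dist (q s) (q u) < min d 1"
      and su: "s \<in> T" "u \<in> T" for T s u
  proof -
    obtain c where c: "T \<subseteq> {0..c}" using small_connected_bounded[OF T] small by auto
    have inj: "inj_on q {0..c}" using inj_q by (rule inj_on_subset) auto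
    have "continuous_on (q ` {0..c}) (inv_into {0..c} q)"
      by (rule continuous_on_inv) (auto intro: continuous_on_subset[OF continuous_on_q] simp: inj)
    then have "connected (inv_into {0..c} q ` q ` T)"
      using c by (intro connected_continuous_image[OF _ T(2)]) (auto elim!: continuous_on_subset)
    moreover have "inv_into {0..c} q ` q ` T = T" by (rule inv_into_image_cancel[OF inj c])
    ultimately have conn: "connected T" by simp
    have *: "u' - s' < e" if s': "s' \<in> T" "u' \<in> T" for s' u'
    proof (rule ccontr)
      assume "\<not> u' - s' < e"
      moreover obtain v where v: "v \<in> {s'..s' + e}" "dist (q s') (q v) \<ge> d" using d(2) s' T(1) by blast
      ultimately have "v \<in> T" using connectedD_interval[OF conn s'(1,2), of v] by auto
      then show False using small s' v(2) by fastforce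
    qed
    show ?thesis using *[OF su] *[OF su(2,1)] by (simp add: dist_real_def abs_if)
  qed
  \<comment> \<open>The bound 1 is what confines \<open>T\<close> to a bounded interval,
    \<open>d\<close> what limits its length.\<close>
  then show ?thesis using d(1) by (intro exI[of _ "min d 1"]) auto
qed

end

theorem theorem3:
  fixes \<gamma> :: "real \<Rightarrow> real \<times> real" and n :: nat
  assumes "arc \<gamma>"
    and "pathstart \<gamma> = (0, -1)"
    and "pathfinish \<gamma> = (2 / (3 * pi), -1)"
    and "path_image \<gamma> \<inter> (sine_part \<union> limit_segment) = {(0, -1), (2 / (3 * pi), -1)}"
    and "n > 0"
  shows "MT_homology_trivial n (subtopology euclidean (warsaw_circle \<gamma>))"
proof -
  interpret w: warsaw \<gamma> using assms by unfold_locales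
  interpret half_line_image "warsaw_path \<gamma>" "warsaw_circle \<gamma>"
    using w.q_image w.inj_q w.uc_q w.compact_warsaw_circle w.lift_q by unfold_locales auto
  obtain m where "n = Suc m" using \<open>n > 0\<close> by (cases n) auto
  then show ?thesis using MT_homology_trivial_Suc by simp
qed

end
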